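(* Let $\Omega\subset\mathbb{C}$ be an $n$-connected domain whose boundary consists of $n$ disjoint $C^\infty$ smooth real analytic closed curves, let $\phi$ be a positive $C^\infty$ weight on $b\Omega$ with weighted Szegő kernel $\sigma$, and let $G_1,G_2$ be a primitive pair for the field of meromorphic functions on the double of $\Omega$. Then for every $b\in\Omega$ there is a complex rational function $R$ of four variables such that $$\sigma(z,w)=\sigma(z,b)\sigma(b,w)\,R(G_1(z),G_2(z),\overline{G_1(w)},\overline{G_2(w)})$$ for $z,w\in\Omega$; in particular $\sigma$ is a rational combination of three functions of one complex variable on $\Omega$.
   Context: The weighted Szegő kernel $\sigma(z,w)$ is the kernel of the orthogonal projection of $L^2(b\Omega,\phi\,ds)$ onto the Hardy space $H^2(b\Omega)$ (closure of boundary values of holomorphic functions smooth up to the boundary). The double of $\Omega$ is the compact Riemann surface formed by $\Omega$, $b\Omega$ and a reflected copy of $\Omega$ glued along $b\Omega$; a primitive pair is a pair of meromorphic functions on it generating its field of meromorphic functions (viewed on $\Omega$ by restriction). *)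

theory Defs
  imports "HOL-Complex_Analysis.Complex_Analysis"
begin

definition real_analytic_curve :: "(real \<Rightarrow> complex) \<Rightarrow> bool" where
  "real_analytic_curve g \<longleftrightarrow>
     (\<forall>t. \<exists>r>0. \<exists>c::nat \<Rightarrow> complex. \<forall>s. \<bar>s - t\<bar> < r \<longrightarrow>
        (\<lambda>k. c k * (complex_of_real (s - t)) ^ k) sums g s)"

definition analytic_closed_curve :: "(real \<Rightarrow> complex) \<Rightarrow> bool" where
  "analytic_closed_curve g \<longleftrightarrow>
     real_analytic_curve g \<and> (\<forall>t. g (t + 1) = g t) \<and> inj_on g {0..<1} \<and>
     (\<forall>t. vector_derivative g (at t) \<noteq> 0)"

definition smooth_nconnected_domain ::
  "complex set \<Rightarrow> nat \<Rightarrow> (nat \<Rightarrow> real \<Rightarrow> complex) \<Rightarrow> bool" where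
  "smooth_nconnected_domain \<Omega> n \<Gamma> \<longleftrightarrow>
     n \<ge> 1 \<and> open \<Omega> \<and> connected \<Omega> \<and> \<Omega> \<noteq> {} \<and> bounded \<Omega> \<and>
     card (components (- \<Omega>)) = n \<and>
     (\<forall>j<n. analytic_closed_curve (\<Gamma> j)) \<and>
     (\<forall>i<n. \<forall>j<n. i \<noteq> j \<longrightarrow> \<Gamma> i ` {0..1} \<inter> \<Gamma> j ` {0..1} = {}) \<and>
     frontier \<Omega> = (\<Union>j<n. \<Gamma> j ` {0..1})"

definition smooth_real :: "(real \<Rightarrow> real) \<Rightarrow> bool" where
  "smooth_real g \<longleftrightarrow> (\<forall>k t. ((deriv ^^ k) g) differentiable (at t))"

definition boundary_weight ::
  "complex set \<Rightarrow> nat \<Rightarrow> (nat \<Rightarrow> real \<Rightarrow> complex) \<Rightarrow> (complex \<Rightarrow> real) \<Rightarrow> bool" where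
  "boundary_weight \<Omega> n \<Gamma> \<phi> \<longleftrightarrow>
     (\<forall>\<zeta>\<in>frontier \<Omega>. \<phi> \<zeta> > 0) \<and> (\<forall>j<n. smooth_real (\<lambda>t. \<phi> (\<Gamma> j t)))"

definition bint :: "nat \<Rightarrow> (nat \<Rightarrow> real \<Rightarrow> complex) \<Rightarrow> (complex \<Rightarrow> complex) \<Rightarrow> complex" where
  "bint n \<Gamma> g = (\<Sum>j<n. LINT t:{0..1}|lborel.
      g (\<Gamma> j t) * complex_of_real (norm (vector_derivative (\<Gamma> j) (at t))))"

text \<open>Membership in L2(b Omega, phi ds) (the weight is bounded above and below, and so is
  the arc length density, so this is the unweighted L2 condition on each curve).\<close>
definition L2_bdry :: "nat \<Rightarrow> (nat \<Rightarrow> real \<Rightarrow> complex) \<Rightarrow> (complex \<Rightarrow> complex) \<Rightarrow> bool" where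
  "L2_bdry n \<Gamma> f \<longleftrightarrow> (\<forall>j<n. set_borel_measurable lborel {0..1} (\<lambda>t. f (\<Gamma> j t)) \<and>
      set_integrable lborel {0..1} (\<lambda>t. (cmod (f (\<Gamma> j t)))\<^sup>2))"

definition winner ::
  "nat \<Rightarrow> (nat \<Rightarrow> real \<Rightarrow> complex) \<Rightarrow> (complex \<Rightarrow> real) \<Rightarrow>
   (complex \<Rightarrow> complex) \<Rightarrow> (complex \<Rightarrow> complex) \<Rightarrow> complex" where
  "winner n \<Gamma> \<phi> f g = bint n \<Gamma> (\<lambda>\<zeta>. complex_of_real (\<phi> \<zeta>) * f \<zeta> * cnj (g \<zeta>))"

definition wnorm2 ::
  "nat \<Rightarrow> (nat \<Rightarrow> real \<Rightarrow> complex) \<Rightarrow> (complex \<Rightarrow> real) \<Rightarrow> (complex \<Rightarrow> complex) \<Rightarrow> real" where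
  "wnorm2 n \<Gamma> \<phi> f = Re (winner n \<Gamma> \<phi> f f)"

definition smooth_up_to_boundary :: "complex set \<Rightarrow> (complex \<Rightarrow> complex) \<Rightarrow> bool" where
  "smooth_up_to_boundary \<Omega> h \<longleftrightarrow> h holomorphic_on \<Omega> \<and> continuous_on (closure \<Omega>) h \<and>
     (\<forall>k. \<exists>g. continuous_on (closure \<Omega>) g \<and> (\<forall>z\<in>\<Omega>. g z = (deriv ^^ k) h z))"

text \<open>hardy_ext ... f F: the boundary function f lies in H2(b Omega), i.e. in the
  L2(phi ds)-closure of boundary values of functions holomorphic on Omega and smooth up to the
  boundary, and F is its holomorphic extension to Omega (pointwise limit of the approximants).\<close>
definition hardy_ext ::
  "complex set \<Rightarrow> nat \<Rightarrow> (nat \<Rightarrow> real \<Rightarrow> complex) \<Rightarrow> (complex \<Rightarrow> real) \<Rightarrow>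
   (complex \<Rightarrow> complex) \<Rightarrow> (complex \<Rightarrow> complex) \<Rightarrow> bool" where
  "hardy_ext \<Omega> n \<Gamma> \<phi> f F \<longleftrightarrow> L2_bdry n \<Gamma> f \<and>
     (\<exists>h::nat \<Rightarrow> complex \<Rightarrow> complex. (\<forall>k. smooth_up_to_boundary \<Omega> (h k)) \<and>
        (\<lambda>k. wnorm2 n \<Gamma> \<phi> (\<lambda>\<zeta>. h k \<zeta> - f \<zeta>)) \<longlonglongrightarrow> 0 \<and>
        (\<forall>z\<in>\<Omega>. (\<lambda>k. h k z) \<longlonglongrightarrow> F z))"

text \<open>sigma is the weighted Szego kernel (restricted to Omega x Omega): for each w in Omega,
  sigma(., w) is (the extension of) an element K w of H2, and K w reproduces evaluation at w,
  so that the orthogonal projection P onto H2 satisfies (Pg)(w) = <g, K w> and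
  sigma(z,w) = <K w, K z>.\<close>
definition szego_kernel ::
  "complex set \<Rightarrow> nat \<Rightarrow> (nat \<Rightarrow> real \<Rightarrow> complex) \<Rightarrow> (complex \<Rightarrow> real) \<Rightarrow>
   (complex \<Rightarrow> complex \<Rightarrow> complex) \<Rightarrow> bool" where
  "szego_kernel \<Omega> n \<Gamma> \<phi> \<sigma> \<longleftrightarrow>
     (\<exists>K::complex \<Rightarrow> complex \<Rightarrow> complex.
        (\<forall>w\<in>\<Omega>. hardy_ext \<Omega> n \<Gamma> \<phi> (K w) (\<lambda>z. \<sigma> z w)) \<and>
        (\<forall>f F w. hardy_ext \<Omega> n \<Gamma> \<phi> f F \<and> w \<in> \<Omega> \<longrightarrow> F w = winner n \<Gamma> \<phi> f (K w)))"

text \<open>G (on Omega) is the restriction of a meromorphic function on the double of Omega: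
  G and a companion H (giving the values conj (H z) on the reflected copy) extend
  meromorphically to a neighbourhood of the closure and glue along the boundary:
  G = conj H on b Omega.\<close>
definition mero_on_double :: "complex set \<Rightarrow> (complex \<Rightarrow> complex) \<Rightarrow> bool" where
  "mero_on_double \<Omega> G \<longleftrightarrow>
     (\<exists>U Gt Ht. open U \<and> closure \<Omega> \<subseteq> U \<and> Gt meromorphic_on U \<and> Ht meromorphic_on U \<and>
        (\<forall>z\<in>\<Omega>. eventually (\<lambda>x. Gt x = G x) (at z)) \<and>
        (\<forall>\<zeta>\<in>frontier \<Omega>. Gt analytic_on {\<zeta>} \<and> Ht analytic_on {\<zeta>} \<longrightarrow> Gt \<zeta> = cnj (Ht \<zeta>)))"

definition poly2 :: "nat \<Rightarrow> (nat \<Rightarrow> nat \<Rightarrow> complex) \<Rightarrow> complex \<Rightarrow> complex \<Rightarrow> complex" where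
  "poly2 N c x y = (\<Sum>i<N. \<Sum>j<N. c i j * x ^ i * y ^ j)"

definition poly4 :: "nat \<Rightarrow> (nat \<Rightarrow> nat \<Rightarrow> nat \<Rightarrow> nat \<Rightarrow> complex) \<Rightarrow>
    complex \<Rightarrow> complex \<Rightarrow> complex \<Rightarrow> complex \<Rightarrow> complex" where
  "poly4 N c x1 x2 x3 x4 =
     (\<Sum>i<N. \<Sum>j<N. \<Sum>k<N. \<Sum>l<N. c i j k l * x1 ^ i * x2 ^ j * x3 ^ k * x4 ^ l)"

definition primitive_pair :: "complex set \<Rightarrow> (complex \<Rightarrow> complex) \<Rightarrow> (complex \<Rightarrow> complex) \<Rightarrow> bool" where
  "primitive_pair \<Omega> G1 G2 \<longleftrightarrow> mero_on_double \<Omega> G1 \<and> mero_on_double \<Omega> G2 \<and>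
     (\<forall>G. mero_on_double \<Omega> G \<longrightarrow>
        (\<exists>N p q. (\<exists>x\<in>\<Omega>. G1 analytic_on {x} \<and> G2 analytic_on {x} \<and> poly2 N q (G1 x) (G2 x) \<noteq> 0) \<and>
           (\<forall>z\<in>\<Omega>. eventually (\<lambda>x. G x = poly2 N p (G1 x) (G2 x) / poly2 N q (G1 x) (G2 x)) (at z))))"

end

theory Submission
  imports Defs
begin

text \<open>Write \<open>K\<^sub>w\<close> for the boundary values of \<open>\<sigma>(\<cdot>,w)\<close> and \<open>C\<close> for the Cauchy transform of a
  measure on the boundary. Applying the reproducing property of \<open>K\<^sub>b\<close> to \<open>h(\<zeta>)/(\<zeta> - \<xi>)\<close> for \<open>\<xi>\<close> outside,
  and to \<open>(h(\<zeta>) - h(\<xi>))/(\<zeta> - \<xi>)\<close> for \<open>\<xi>\<close> inside \<open>\<Omega>\<close>, and letting \<open>h\<close> tend to \<open>K\<^sub>w\<close>, shows that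
  \<open>F\<^sub>w\<^sub>b(\<xi>) = C(K\<^sub>w cnj(K\<^sub>b) \<phi> ds)(\<xi>) - \<sigma>(b,w)/(b - \<xi>)\<close> vanishes outside \<open>\<Omega>\<close> and equals
  \<open>\<sigma>(\<xi>,w) \<Lambda>\<^sub>b(\<xi>)\<close> inside, where \<open>\<Lambda>\<^sub>b = C(cnj(K\<^sub>b) \<phi> ds)(\<xi>) - 1/(b - \<xi>)\<close>. The densities belonging to
  \<open>F\<^sub>w\<^sub>b\<close> and \<open>F\<^sub>b\<^sub>w\<close> are conjugate. In a chart that straightens the analytic boundary, the two Cauchy
  transforms are therefore exchanged by reflection up to holomorphic terms, and since both functions
  vanish on the outer side, they continue across the boundary as negative reflections of each other.
  Hence \<open>\<sigma>(\<cdot>,w)/\<sigma>(\<cdot>,b) = F\<^sub>w\<^sub>b/F\<^sub>b\<^sub>b\<close> extends to the double, with companion \<open>F\<^sub>b\<^sub>w/F\<^sub>b\<^sub>b\<close>. No regularity of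
  \<open>K\<^sub>w\<close> up to the boundary is used.

  So \<open>\<sigma>(z,w)/(\<sigma>(z,b) \<sigma>(b,w))\<close> is rational in \<open>G\<^sub>1(z), G\<^sub>2(z)\<close> for each \<open>w\<close>, and by Hermitian symmetry rational
  in the conjugates of \<open>G\<^sub>1(w), G\<^sub>2(w)\<close> for each \<open>z\<close>. Uncountably many \<open>w\<close> share a degree bound, and
  Gaussian elimination over the ring of functions of \<open>w\<close> turns their linear relations into one
  relation whose coefficients are rational in the conjugates of \<open>G\<^sub>1(w), G\<^sub>2(w)\<close>.\<close>

text \<open>Since the weight is only smooth, a single kernel function need not continue across the
  boundary; only quotients do. With smooth data the Plemelj formula would give, along the positively
  oriented boundary, \<open>F\<^sub>w\<^sub>b\<close> dz = 2 pi i
  \<open>K\<^sub>w cnj(K\<^sub>b)\<close> phi ds, and conjugation turns the right-hand side into the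
  negative of the one with w and b exchanged. So \<open>F\<^sub>w\<^sub>b\<close> dz is minus the
  conjugate of \<open>F\<^sub>b\<^sub>w\<close> dz, and dividing by the case w = b removes both dz
  and the sign. The function \<open>\<Lambda>\<^sub>b\<close> plays the part of the weighted
  Garabedian kernel. For densities that are merely integrable there are no boundary values to
  compare, which is why the relation is proved between Cauchy integrals in a chart. On the algebraic
  side, G1 and G2 are algebraically dependent, so a nonzero coefficient array may define the zero
  function. A basis of the monomials is therefore fixed before the elimination starts.\<close>

subsection \<open>Separately rational functions are jointly rational\<close>

text \<open>\<open>R\<close> behaves like an integral domain: a nonzero element vanishes at only
  countably many points of \<open>S\<close>, and countable sets cannot cover \<open>S\<close>.
  Fraction-free elimination on the columns \<open>k\<close>, with rows indexed by \<open>z\<close>,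
  either meets a column that vanishes identically, which yields a relation over \<open>R\<close>, or
  finds only nonzero pivots, which leaves the columns independent at each \<open>w\<close> off the
  zeros of the pivots.\<close>

lemma relation_or_independent:
  fixes v :: "'k \<Rightarrow> 'z \<Rightarrow> 'w \<Rightarrow> complex" and R :: "('w \<Rightarrow> complex) set"
  assumes add: "\<And>f g. f \<in> R \<Longrightarrow> g \<in> R \<Longrightarrow> (\<lambda>w. f w + g w) \<in> R"
    and mult: "\<And>f g. f \<in> R \<Longrightarrow> g \<in> R \<Longrightarrow> (\<lambda>w. f w * g w) \<in> R"
    and neg: "\<And>f. f \<in> R \<Longrightarrow> (\<lambda>w. - f w) \<in> R"
    and one: "(\<lambda>_. 1) \<in> R"
    and zeros: "\<And>f. f \<in> R \<Longrightarrow> (\<exists>w\<in>S. f w \<noteq> 0) \<Longrightarrow> countable {w\<in>S. f w = 0}"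
    and unc: "uncountable S"
    and fin: "finite K"
    and v: "\<And>k z. k \<in> K \<Longrightarrow> z \<in> Z \<Longrightarrow> v k z \<in> R"
  shows "(\<exists>d. (\<forall>k\<in>K. d k \<in> R) \<and> (\<exists>k\<in>K. \<exists>w\<in>S. d k w \<noteq> 0) \<and>
            (\<forall>z\<in>Z. \<forall>w\<in>S. (\<Sum>k\<in>K. d k w * v k z w) = 0))
       \<or> (\<exists>C. countable C \<and> (\<forall>w\<in>S - C. \<forall>a. (\<forall>z\<in>Z. (\<Sum>k\<in>K. a k * v k z w) = 0) \<longrightarrow> (\<forall>k\<in>K. a k = 0)))"
  using fin v
proof (induction K arbitrary: v rule: finite_induct)
  case empty
  show ?case by (intro disjI2 exI[of _ "{}"]) auto
next
  case (insert x F)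
  have vx: "v x z \<in> R" if "z \<in> Z" for z using insert.prems that by blast
  have vF: "v k z \<in> R" if "z \<in> Z" "k \<in> F" for k z using insert.prems that by blast
  have zero: "(\<lambda>_. 0) \<in> R"
    using add[OF one neg[OF one]] by simp
  have sumR: "finite A \<Longrightarrow> (\<And>k. k \<in> A \<Longrightarrow> g k \<in> R) \<Longrightarrow> (\<lambda>w. \<Sum>k\<in>A. g k w) \<in> R"
    for A :: "'k set" and g
  proof (induction A rule: finite_induct)
    case empty
    then show ?case using zero by simp
  next
    case (insert y A)
    then show ?case using add[of "g y" "\<lambda>w. \<Sum>k\<in>A. g k w"] by simp
  qed
  show ?case
  proof (cases "\<forall>z\<in>Z. \<forall>w\<in>S. v x z w = 0")
    case True
    have ne: "S \<noteq> {}" using unc by auto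
    show ?thesis
    proof (intro disjI1 exI[of _ "\<lambda>k. if k = x then (\<lambda>_. 1) else (\<lambda>_. 0)"] conjI ballI)
      fix z w assume "z \<in> Z" "w \<in> S"
      have "(\<Sum>k\<in>F. (if k = x then (\<lambda>_. 1) else (\<lambda>_. 0)) w * v k z w) = 0"
        using insert.hyps by (intro sum.neutral) auto
      then show "(\<Sum>k\<in>insert x F. (if k = x then (\<lambda>_. 1) else (\<lambda>_. 0)) w * v k z w) = 0"
        using insert.hyps True \<open>z \<in> Z\<close> \<open>w \<in> S\<close> by simp
    next
      show "\<exists>k\<in>insert x F. \<exists>w\<in>S. (if k = x then (\<lambda>_. 1) else (\<lambda>_. 0)) w \<noteq> (0::complex)"
        using ne by auto
    qed (use one zero in auto)
  next
    case False
    then obtain z1 w1 where z1: "z1 \<in> Z" "w1 \<in> S" "v x z1 w1 \<noteq> 0" by blast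
    \<comment> \<open>A 2-by-2 minor in the rows \<open>z1\<close>, \<open>z\<close> and the columns
      \<open>x\<close>, \<open>k\<close>: the pivot \<open>v x z1\<close> clears column
      \<open>x\<close> without division, so the entries stay in \<open>R\<close>.\<close>
    define v' where "v' = (\<lambda>k z w. v x z1 w * v k z w - v k z1 w * v x z w)"
    have v'R: "v' k z \<in> R" if "k \<in> F" "z \<in> Z" for k z
    proof -
      have "(\<lambda>w. v x z1 w * v k z w + - (v k z1 w * v x z w)) \<in> R"
        using that z1 vx vF by (intro add neg mult) auto
      then show ?thesis by (simp add: v'_def)
    qed
    have cz: "countable {w\<in>S. v x z1 w = 0}"
      using zeros[OF vx[OF z1(1)]] z1 by blast
    consider (rel) d where "\<forall>k\<in>F. d k \<in> R" "\<exists>k\<in>F. \<exists>w\<in>S. d k w \<noteq> 0"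
        "\<forall>z\<in>Z. \<forall>w\<in>S. (\<Sum>k\<in>F. d k w * v' k z w) = 0"
      | (ind) C where "countable C"
        "\<forall>w\<in>S - C. \<forall>a. (\<forall>z\<in>Z. (\<Sum>k\<in>F. a k * v' k z w) = 0) \<longrightarrow> (\<forall>k\<in>F. a k = 0)"
      using insert.IH[of v'] v'R by blast
    then show ?thesis
    proof cases
      case (rel d)
      note d = rel
      then obtain k0 where k0: "k0 \<in> F" "\<exists>w\<in>S. d k0 w \<noteq> 0" by blast
      \<comment> \<open>The pivot and \<open>d k0\<close> are nonzero at a common point, so
        multiplying the relation by the pivot does not kill it.\<close>
      have "countable ({w\<in>S. v x z1 w = 0} \<union> {w\<in>S. d k0 w = 0})"
        using cz zeros[of "d k0"] d(1) k0 by blast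
      then have "\<not> S \<subseteq> {w\<in>S. v x z1 w = 0} \<union> {w\<in>S. d k0 w = 0}"
        using unc countable_subset by blast
      then obtain w2 where w2: "w2 \<in> S" "v x z1 w2 \<noteq> 0" "d k0 w2 \<noteq> 0" by blast
      \<comment> \<open>Back-substitution: after scaling by the pivot, row \<open>z1\<close>
        determines the coefficient of \<open>x\<close>.\<close>
      define e where "e = (\<lambda>k. if k = x then (\<lambda>w. - (\<Sum>k\<in>F. d k w * v k z1 w)) else (\<lambda>w. d k w * v x z1 w))"
      show ?thesis
      proof (intro disjI1 exI[of _ e] conjI ballI)
        fix k assume "k \<in> insert x F"
        then show "e k \<in> R"
          using d(1) z1 vx vF insert.hyps unfolding e_def
          by (auto intro!: neg sumR mult)
      next
        have "e k0 w2 \<noteq> 0" using w2 k0 insert.hyps by (auto simp: e_def)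
        then show "\<exists>k\<in>insert x F. \<exists>w\<in>S. e k w \<noteq> 0" using k0 w2 by blast
      next
        fix z w assume zw: "z \<in> Z" "w \<in> S"
        have "(\<Sum>k\<in>F. e k w * v k z w) = (\<Sum>k\<in>F. d k w * v x z1 w * v k z w)"
          using insert.hyps by (intro sum.cong) (auto simp: e_def)
        then have "(\<Sum>k\<in>insert x F. e k w * v k z w)
            = - (\<Sum>k\<in>F. d k w * v k z1 w) * v x z w + (\<Sum>k\<in>F. d k w * v x z1 w * v k z w)"
          using insert.hyps by (simp add: e_def)
        also have "\<dots> = (\<Sum>k\<in>F. d k w * v' k z w)"
          by (simp add: v'_def right_diff_distrib sum_subtractf sum_distrib_left sum_distrib_right mult_ac)
        finally show "(\<Sum>k\<in>insert x F. e k w * v k z w) = 0" using d(3) zw by simp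
      qed
    next
      case (ind C)
      note C = ind
      show ?thesis
      proof (intro disjI2 exI[of _ "C \<union> {w\<in>S. v x z1 w = 0}"] conjI ballI allI impI)
        show "countable (C \<union> {w \<in> S. v x z1 w = 0})" using C cz by blast
      next
        fix w a k
        assume w: "w \<in> S - (C \<union> {w \<in> S. v x z1 w = 0})"
          and rel: "\<forall>z\<in>Z. (\<Sum>k\<in>insert x F. a k * v k z w) = 0" and k: "k \<in> insert x F"
        have rel': "a x * v x z w + (\<Sum>k\<in>F. a k * v k z w) = 0" if "z \<in> Z" for z
          using rel that insert.hyps by simp
        have "(\<Sum>k\<in>F. a k * v' k z w) = 0" if z: "z \<in> Z" for z
        proof -
          have "(\<Sum>k\<in>F. a k * v' k z w) = v x z1 w * (\<Sum>k\<in>F. a k * v k z w) - v x z w * (\<Sum>k\<in>F. a k * v k z1 w)"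
            by (simp add: v'_def sum_distrib_left sum_subtractf[symmetric] algebra_simps)
          also have "\<dots> = v x z1 w * (a x * v x z w + (\<Sum>k\<in>F. a k * v k z w))
               - v x z w * (a x * v x z1 w + (\<Sum>k\<in>F. a k * v k z1 w))"
            by (simp add: algebra_simps)
          finally show ?thesis using rel'[OF z] rel'[OF z1(1)] by simp
        qed
        then have aF: "\<forall>k\<in>F. a k = 0" using C(2) w by blast
        then have "(\<Sum>k\<in>F. a k * v k z1 w) = 0" by simp
        then have "a x * v x z1 w = 0" using rel'[OF z1(1)] by simp
        then have "a x = 0" using w by auto
        then show "a k = 0" using aF k by blast
      qed
    qed
  qed
qed

text \<open>Meant for the monomials of \<open>g1\<close> and \<open>g2\<close>, which may be
  dependent on \<open>S\<close>. In a maximal independent subfamily nonzero coefficients do give a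
  nonzero function.\<close>

lemma finite_family_basis:
  fixes u :: "'k \<Rightarrow> 'z \<Rightarrow> complex"
  assumes "finite J"
  shows "\<exists>I\<subseteq>J. (\<forall>a. (\<forall>z\<in>Z. (\<Sum>i\<in>I. a i * u i z) = 0) \<longrightarrow> (\<forall>i\<in>I. a i = 0)) \<and>
           (\<forall>j\<in>J. \<exists>c. \<forall>z\<in>Z. u j z = (\<Sum>i\<in>I. c i * u i z))"
  using assms
proof (induction J rule: finite_induct)
  case empty
  show ?case by auto
next
  case (insert x J)
  then obtain I where I: "I \<subseteq> J"
    "\<forall>a. (\<forall>z\<in>Z. (\<Sum>i\<in>I. a i * u i z) = 0) \<longrightarrow> (\<forall>i\<in>I. a i = 0)"
    "\<forall>j\<in>J. \<exists>c. \<forall>z\<in>Z. u j z = (\<Sum>i\<in>I. c i * u i z)" by blast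
  have fI: "finite I" "x \<notin> I" using I(1) insert.hyps finite_subset by auto
  show ?case
  proof (cases "\<exists>c. \<forall>z\<in>Z. u x z = (\<Sum>i\<in>I. c i * u i z)")
    case True
    show ?thesis
      by (rule exI[of _ I]) (use I True in blast)
  next
    case False
    show ?thesis
    proof (intro exI[of _ "insert x I"] conjI allI impI ballI)
      show "insert x I \<subseteq> insert x J" using I by blast
    next
      fix a i assume a: "\<forall>z\<in>Z. (\<Sum>i\<in>insert x I. a i * u i z) = 0" and i: "i \<in> insert x I"
      have a': "a x * u x z + (\<Sum>i\<in>I. a i * u i z) = 0" if "z \<in> Z" for z
        using a that fI by simp
      have ax: "a x = 0"
      proof (rule ccontr)
        assume n: "a x \<noteq> 0"
        have "u x z = (\<Sum>i\<in>I. (- a i / a x) * u i z)" if "z \<in> Z" for z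
        proof -
          have "a x * u x z = - (\<Sum>i\<in>I. a i * u i z)" using a'[OF that] by (simp add: add_eq_0_iff)
          then have "u x z = - (\<Sum>i\<in>I. a i * u i z) / a x" using n by (simp add: field_simps)
          also have "\<dots> = (\<Sum>i\<in>I. (- a i / a x) * u i z)"
            by (simp add: sum_negf[symmetric] sum_divide_distrib)
          finally show ?thesis .
        qed
        then have "\<forall>z\<in>Z. u x z = (\<Sum>i\<in>I. (- a i / a x) * u i z)" by blast
        then show False using False by (elim notE) (rule exI)
      qed
      then have "\<forall>z\<in>Z. (\<Sum>i\<in>I. a i * u i z) = 0" using a' by simp
      then have "\<forall>i\<in>I. a i = 0" using I(2) by blast
      then show "a i = 0" using ax i by blast
    next
      fix j assume "j \<in> insert x J"
      then consider "j = x" | "j \<in> J" by blast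
      then show "\<exists>c. \<forall>z\<in>Z. u j z = (\<Sum>i\<in>insert x I. c i * u i z)"
      proof cases
        case 1
        have "(\<Sum>i\<in>I. (if i = x then 1 else 0) * u i z) = 0" for z
          using fI by (intro sum.neutral) auto
        then show ?thesis using fI 1
          by (intro exI[of _ "\<lambda>i. if i = x then 1 else 0"]) simp
      next
        case 2
        then obtain c where c: "\<forall>z\<in>Z. u j z = (\<Sum>i\<in>I. c i * u i z)" using I(3) by blast
        have "(\<Sum>i\<in>I. (if i = x then 0 else c i) * u i z) = (\<Sum>i\<in>I. c i * u i z)" for z
          using fI by (intro sum.cong) auto
        then show ?thesis using fI c
          by (intro exI[of _ "\<lambda>i. if i = x then 0 else c i"]) simp
      qed
    qed
  qed
qed

text \<open>Nested polynomials are closed under ring operations without tracking the bound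
  \<open>N\<close> of \<open>poly2\<close>. The outer variable is \<open>y\<close>, so the
  coefficient of x^i y^j is \<open>coeff (coeff P j) i\<close>.\<close>

definition biv :: "complex poly poly \<Rightarrow> complex \<Rightarrow> complex \<Rightarrow> complex" where
  "biv P x y = poly (poly P [:y:]) x"

lemma biv_simps [simp]:
  "biv (P + Q) x y = biv P x y + biv Q x y"
  "biv (P * Q) x y = biv P x y * biv Q x y"
  "biv (- P) x y = - biv P x y"
  "biv 1 x y = 1" "biv 0 x y = 0"
  by (simp_all add: biv_def)

lemma biv_prod: "biv (prod f A) x y = (\<Prod>a\<in>A. biv (f a) x y)"
  by (simp add: biv_def poly_prod)

lemma biv_eq_poly2:
  assumes "\<And>j. degree (coeff P j) < N" "degree P < N"
  shows "biv P x y = poly2 N (\<lambda>i j. coeff (coeff P j) i) x y"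
proof -
  have c: "poly (coeff P j) x = (\<Sum>i<N. coeff (coeff P j) i * x ^ i)" for j
    unfolding poly_altdef
    using assms(1)[of j] by (intro sum.mono_neutral_left) (auto simp: coeff_eq_0)
  have "poly P [:y:] = (\<Sum>j<N. coeff P j * [:y:] ^ j)"
    unfolding poly_altdef
    using assms(2) by (intro sum.mono_neutral_left) (auto simp: coeff_eq_0)
  then have "biv P x y = (\<Sum>j<N. poly (coeff P j) x * y ^ j)"
    by (simp add: biv_def poly_sum)
  also have "\<dots> = (\<Sum>j<N. \<Sum>i<N. coeff (coeff P j) i * x ^ i * y ^ j)"
    by (simp add: c sum_distrib_right)
  also have "\<dots> = poly2 N (\<lambda>i j. coeff (coeff P j) i) x y"
    unfolding poly2_def by (rule sum.swap)
  finally show ?thesis .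
qed

lemma poly2_eq_biv: "\<exists>P. \<forall>x y. poly2 N c x y = biv P x y"
proof -
  have "biv (\<Sum>i<N. \<Sum>j<N. monom (monom (c i j) i) j) x y = poly2 N c x y" for x y
    by (simp add: biv_def poly2_def poly_sum poly_monom mult_ac)
  then show ?thesis by (intro exI[of _ "\<Sum>i<N. \<Sum>j<N. monom (monom (c i j) i) j"]) simp
qed

text \<open>\<open>poly4\<close> has one bound for all its indices, so finitely many polynomials
  have to share one.\<close>

lemma poly2_bound_exists:
  assumes "finite A"
  shows "\<exists>N. \<forall>P\<in>A. degree P < N \<and> (\<forall>j. degree (coeff (P::complex poly poly) j) < N)"
  using assms
proof (induction A rule: finite_induct)
  case empty
  then show ?case by simp
next
  case (insert P A)
  then obtain N where N: "\<forall>P\<in>A. degree P < N \<and> (\<forall>j. degree (coeff P j) < N)" by blast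
  define N' where "N' = N + degree P + 1 + (\<Sum>j\<le>degree P. degree (coeff P j))"
  have "degree (coeff P j) < N'" for j
  proof (cases "j \<le> degree P")
    case True
    then have "degree (coeff P j) \<le> (\<Sum>j\<le>degree P. degree (coeff P j))"
      by (intro member_le_sum) auto
    then show ?thesis by (simp add: N'_def)
  qed (simp add: coeff_eq_0 N'_def)
  moreover have "degree P < N'" "N \<le> N'" by (auto simp: N'_def)
  ultimately show ?case using N
    by (intro exI[of _ N']) (auto intro: less_le_trans)
qed

section \<open>Zero sets of holomorphic functions\<close>

lemma uncountable_open_complex:
  assumes "open S" "S \<noteq> {}"
  shows "uncountable (S :: complex set)"
proof -
  obtain x r where "r > 0" "ball x r \<subseteq> S" using assms open_contains_ball by (metis ex_in_conv)
  then show ?thesis using uncountable_ball[of r x] countable_subset by blast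
qed

lemma holomorphic_zeros_countable:
  assumes "f holomorphic_on S" "open S" "connected S" "\<exists>x\<in>S. f x \<noteq> 0"
  shows "countable {z\<in>S. f z = 0}"
proof (cases "f constant_on S")
  case True
  then have "{z\<in>S. f z = 0} = {}" using assms(4) unfolding constant_on_def by auto
  then show ?thesis by (metis countable_empty)
next
  case False
  obtain C :: "nat \<Rightarrow> complex set" where "\<And>n. compact (C n)" "\<Union>(range C) = S"
    using open_Union_compact_subsets[OF assms(2)] by metis
  then have "fsigma S" using fsigma.intros[of C] compact_imp_closed by metis
  then show ?thesis using assms False holomorphic_countable_zeros by blast
qed

lemma holomorphic_prod_nonzero:
  assumes "finite A" "\<And>k. k \<in> A \<Longrightarrow> f k holomorphic_on S" "open S" "connected S" "S \<noteq> {}"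
    and "\<And>k. k \<in> A \<Longrightarrow> \<exists>x\<in>S. f k x \<noteq> 0"
  shows "\<exists>x\<in>S. \<forall>k\<in>A. f k x \<noteq> (0::complex)"
proof -
  have "countable (\<Union>k\<in>A. {z\<in>S. f k z = 0})"
    using assms by (intro countable_UN) (auto intro: countable_finite holomorphic_zeros_countable)
  moreover have "uncountable S"
    using assms by (simp add: uncountable_open_complex)
  ultimately have "\<not> S \<subseteq> (\<Union>k\<in>A. {z\<in>S. f k z = 0})"
    using countable_subset by blast
  then show ?thesis by blast
qed

text \<open>For fixed \<open>w\<close>, rationality is a linear relation between the functions
  \<open>u i\<close> and \<open>u i * T\<close> of \<open>z\<close>; by \<open>sym\<close> these
  entries, seen as functions of \<open>w\<close>, lie in a ring of conjugates of rational functions.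
  The columns are dependent for uncountably many \<open>w\<close>, so
  \<open>relation_or_independent\<close> supplies one relation valid for all \<open>w\<close>, and
  solving it for \<open>T\<close> gives the quotient.\<close>

lemma separately_rational_imp_rational:
  fixes T :: "complex \<Rightarrow> complex \<Rightarrow> complex"
  assumes S: "open S" "connected S" "S \<noteq> {}"
    and g: "g1 holomorphic_on S" "g2 holomorphic_on S"
    and T: "\<And>w. w \<in> S \<Longrightarrow> (\<lambda>z. T z w) holomorphic_on S"
    and sym: "\<And>z w. z \<in> S \<Longrightarrow> w \<in> S \<Longrightarrow> T z w = cnj (T w z)"
    and rat: "\<And>w. w \<in> S \<Longrightarrow> \<exists>N p q. (\<exists>x\<in>S. poly2 N q (g1 x) (g2 x) \<noteq> 0) \<and>
                (\<forall>x\<in>S. T x w * poly2 N q (g1 x) (g2 x) = poly2 N p (g1 x) (g2 x))"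
  shows "\<exists>N p q. (\<exists>z\<in>S. \<exists>w\<in>S. poly4 N q (g1 z) (g2 z) (cnj (g1 w)) (cnj (g2 w)) \<noteq> 0) \<and>
           (\<forall>z\<in>S. \<forall>w\<in>S. T z w * poly4 N q (g1 z) (g2 z) (cnj (g1 w)) (cnj (g2 w)) =
                poly4 N p (g1 z) (g2 z) (cnj (g1 w)) (cnj (g2 w)))"
proof -
  have uncS: "uncountable S" using S by (simp add: uncountable_open_complex)
  obtain Nf pf qf where rat': "\<And>w. w \<in> S \<Longrightarrow> (\<exists>x\<in>S. poly2 (Nf w) (qf w) (g1 x) (g2 x) \<noteq> 0) \<and>
      (\<forall>x\<in>S. T x w * poly2 (Nf w) (qf w) (g1 x) (g2 x) = poly2 (Nf w) (pf w) (g1 x) (g2 x))"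
    using rat by metis
  \<comment> \<open>The degree bound varies with \<open>w\<close>, but \<open>S\<close> is the
    countable union of the level sets of \<open>Nf\<close>.\<close>
  have "\<exists>N. uncountable {w\<in>S. Nf w = N}"
  proof (rule ccontr)
    assume "\<nexists>N. uncountable {w\<in>S. Nf w = N}"
    then have "countable (\<Union>N. {w\<in>S. Nf w = N})" by (intro countable_UN) auto
    moreover have "(\<Union>N. {w\<in>S. Nf w = N}) = S" by auto
    ultimately show False using uncS by simp
  qed
  then obtain N where N: "uncountable {w\<in>S. Nf w = N}" by blast
  define J where "J = {..<N} \<times> {..<N}"
  define u where "u = (\<lambda>(i,j) z. g1 z ^ i * g2 z ^ j :: complex)"
  have finJ: "finite J" by (simp add: J_def)
  have poly2_u: "poly2 N c (g1 z) (g2 z) = (\<Sum>m\<in>J. c (fst m) (snd m) * u m z)" for c z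
    by (simp add: poly2_def J_def sum.cartesian_product u_def case_prod_unfold mult.assoc)
  obtain I where I: "I \<subseteq> J"
    "\<forall>a. (\<forall>z\<in>S. (\<Sum>i\<in>I. a i * u i z) = 0) \<longrightarrow> (\<forall>i\<in>I. a i = 0)"
    "\<forall>j\<in>J. \<exists>c. \<forall>z\<in>S. u j z = (\<Sum>i\<in>I. c i * u i z)"
    using finite_family_basis[OF finJ, of S u] by blast
  have finI: "finite I" using I(1) finJ finite_subset by blast
  obtain cf where cf: "\<And>j z. j \<in> J \<Longrightarrow> z \<in> S \<Longrightarrow> u j z = (\<Sum>i\<in>I. cf j i * u i z)"
    using I(3) by metis
  have span: "poly2 N c (g1 z) (g2 z) = (\<Sum>i\<in>I. (\<Sum>m\<in>J. c (fst m) (snd m) * cf m i) * u i z)" if "z \<in> S" for c z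
  proof -
    have "poly2 N c (g1 z) (g2 z) = (\<Sum>m\<in>J. \<Sum>i\<in>I. c (fst m) (snd m) * cf m i * u i z)"
      unfolding poly2_u using cf that by (intro sum.cong) (auto simp: sum_distrib_left mult.assoc)
    also have "\<dots> = (\<Sum>i\<in>I. \<Sum>m\<in>J. c (fst m) (snd m) * cf m i * u i z)" by (rule sum.swap)
    finally show ?thesis by (simp add: sum_distrib_right)
  qed
  \<comment> \<open>Rationality with the denominator cleared, so that zeros of \<open>Q\<close> need
    no exception. \<open>R\<close> takes conjugates because \<open>T z w\<close> is antiholomorphic
    in \<open>w\<close>.\<close>
  define rf where "rf = (\<lambda>f. f holomorphic_on S \<and> (\<exists>P Q. (\<exists>x\<in>S. biv Q (g1 x) (g2 x) \<noteq> 0) \<and>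
      (\<forall>x\<in>S. f x * biv Q (g1 x) (g2 x) = biv P (g1 x) (g2 x))))"
  define R where "R = {f. rf (\<lambda>w. cnj (f w))}"
  have biv_hol: "(\<lambda>x. biv P (g1 x) (g2 x)) holomorphic_on S" for P
  proof -
    obtain N where "\<forall>Q\<in>{P}. degree Q < N \<and> (\<forall>j. degree (coeff Q j) < N)"
      using poly2_bound_exists[of "{P}"] by blast
    then have "biv P x y = poly2 N (\<lambda>i j. coeff (coeff P j) i) x y" for x y
      by (intro biv_eq_poly2) auto
    then show ?thesis unfolding poly2_def by (simp, intro holomorphic_intros g)
  qed
  have nz2: "\<exists>x\<in>S. biv (Q * Q') (g1 x) (g2 x) \<noteq> 0"
    if "\<exists>x\<in>S. biv Q (g1 x) (g2 x) \<noteq> 0" "\<exists>x\<in>S. biv Q' (g1 x) (g2 x) \<noteq> 0" for Q Q'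
    using holomorphic_prod_nonzero[of "{Q,Q'}" "\<lambda>Q x. biv Q (g1 x) (g2 x)" S] S biv_hol that by auto
  have rf_add: "rf (\<lambda>x. f x + g x)" if f: "rf f" and g: "rf g" for f g
  proof -
    obtain P Q where PQ: "f holomorphic_on S" "\<exists>x\<in>S. biv Q (g1 x) (g2 x) \<noteq> 0"
      "\<forall>x\<in>S. f x * biv Q (g1 x) (g2 x) = biv P (g1 x) (g2 x)" using f unfolding rf_def by blast
    obtain P' Q' where PQ': "g holomorphic_on S" "\<exists>x\<in>S. biv Q' (g1 x) (g2 x) \<noteq> 0"
      "\<forall>x\<in>S. g x * biv Q' (g1 x) (g2 x) = biv P' (g1 x) (g2 x)" using g unfolding rf_def by blast
    have "(f x + g x) * biv (Q * Q') (g1 x) (g2 x) = biv (P * Q' + P' * Q) (g1 x) (g2 x)" if "x \<in> S" for x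
    proof -
      have "(f x + g x) * biv (Q * Q') (g1 x) (g2 x) = (f x * biv Q (g1 x) (g2 x)) * biv Q' (g1 x) (g2 x)
          + (g x * biv Q' (g1 x) (g2 x)) * biv Q (g1 x) (g2 x)" by (simp add: algebra_simps)
      then show ?thesis using PQ(3) PQ'(3) that by simp
    qed
    then show ?thesis unfolding rf_def using PQ(1) PQ'(1) nz2[OF PQ(2) PQ'(2)]
      by (intro conjI exI[of _ "P * Q' + P' * Q"] exI[of _ "Q * Q'"] ballI holomorphic_on_add) simp_all
  qed
  have rf_mult: "rf (\<lambda>x. f x * g x)" if f: "rf f" and g: "rf g" for f g
  proof -
    obtain P Q where PQ: "f holomorphic_on S" "\<exists>x\<in>S. biv Q (g1 x) (g2 x) \<noteq> 0"
      "\<forall>x\<in>S. f x * biv Q (g1 x) (g2 x) = biv P (g1 x) (g2 x)" using f unfolding rf_def by blast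
    obtain P' Q' where PQ': "g holomorphic_on S" "\<exists>x\<in>S. biv Q' (g1 x) (g2 x) \<noteq> 0"
      "\<forall>x\<in>S. g x * biv Q' (g1 x) (g2 x) = biv P' (g1 x) (g2 x)" using g unfolding rf_def by blast
    have "(f x * g x) * biv (Q * Q') (g1 x) (g2 x) = biv (P * P') (g1 x) (g2 x)" if "x \<in> S" for x
    proof -
      have "(f x * g x) * biv (Q * Q') (g1 x) (g2 x)
          = (f x * biv Q (g1 x) (g2 x)) * (g x * biv Q' (g1 x) (g2 x))" by (simp add: algebra_simps)
      then show ?thesis using PQ(3) PQ'(3) that by simp
    qed
    then show ?thesis unfolding rf_def using PQ(1) PQ'(1) nz2[OF PQ(2) PQ'(2)]
      by (intro conjI exI[of _ "P * P'"] exI[of _ "Q * Q'"] ballI holomorphic_on_mult) simp_all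
  qed
  have rf_const: "rf (\<lambda>_. c)" for c
  proof -
    have "\<exists>x\<in>S. biv 1 (g1 x) (g2 x) \<noteq> 0" using S by auto
    moreover have "\<forall>x\<in>S. c * biv 1 (g1 x) (g2 x) = biv [:[:c:]:] (g1 x) (g2 x)" by (simp add: biv_def)
    ultimately show ?thesis unfolding rf_def
      by (intro conjI exI[of _ "[:[:c:]:]"] exI[of _ 1] holomorphic_on_const)
  qed
  have rf_T: "rf (\<lambda>z. T z w)" if w: "w \<in> S" for w
  proof -
    obtain N p q where a: "\<exists>x\<in>S. poly2 N q (g1 x) (g2 x) \<noteq> 0"
      "\<forall>x\<in>S. T x w * poly2 N q (g1 x) (g2 x) = poly2 N p (g1 x) (g2 x)" using rat[OF w] by blast
    obtain P Q where "\<forall>x y. poly2 N q x y = biv Q x y" "\<forall>x y. poly2 N p x y = biv P x y"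
      using poly2_eq_biv by metis
    with a have "\<exists>x\<in>S. biv Q (g1 x) (g2 x) \<noteq> 0" "\<forall>x\<in>S. T x w * biv Q (g1 x) (g2 x) = biv P (g1 x) (g2 x)"
      by auto
    then show ?thesis unfolding rf_def using T[OF w] by blast
  qed
  \<comment> \<open>The flag tells whether a basis monomial is multiplied by \<open>T\<close>:
    \<open>True\<close> marks denominator coefficients, \<open>False\<close> negated numerator
    coefficients.\<close>
  define K where "K = I \<times> (UNIV :: bool set)"
  have finK: "finite K" using finI by (simp add: K_def)
  define v where "v = (\<lambda>(i, t) z w. u i z * (if t then T z w else 1) :: complex)"
  have sumK: "(\<Sum>k\<in>K. a k * v k z w) = (\<Sum>i\<in>I. a (i, True) * u i z) * T z w + (\<Sum>i\<in>I. a (i, False) * u i z)"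
    for a z w
  proof -
    have "(\<Sum>k\<in>K. a k * v k z w) = (\<Sum>i\<in>I. \<Sum>t\<in>UNIV. a (i,t) * v (i,t) z w)"
      by (simp add: K_def sum.cartesian_product case_prod_unfold)
    then show ?thesis
      by (simp add: UNIV_bool v_def sum.distrib sum_distrib_right add.commute mult.assoc)
  qed
  have R1: "(\<lambda>w. f w + g w) \<in> R" if "f \<in> R" "g \<in> R" for f g
    using that rf_add[of "\<lambda>w. cnj (f w)" "\<lambda>w. cnj (g w)"] by (simp add: R_def)
  have R2: "(\<lambda>w. f w * g w) \<in> R" if "f \<in> R" "g \<in> R" for f g
    using that rf_mult[of "\<lambda>w. cnj (f w)" "\<lambda>w. cnj (g w)"] by (simp add: R_def)
  have R3: "(\<lambda>w. - f w) \<in> R" if "f \<in> R" for f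
    using that rf_mult[of "\<lambda>_. -1" "\<lambda>w. cnj (f w)"] rf_const by (simp add: R_def)
  have Rc: "(\<lambda>_. c) \<in> R" for c
    using rf_const by (simp add: R_def)
  have R5: "countable {w\<in>S. f w = 0}" if "f \<in> R" "\<exists>w\<in>S. f w \<noteq> 0" for f
  proof -
    have "(\<lambda>w. cnj (f w)) holomorphic_on S" using that by (simp add: R_def rf_def)
    then have "countable {w\<in>S. cnj (f w) = 0}"
      using that S by (intro holomorphic_zeros_countable) auto
    then show ?thesis by simp
  qed
  have rf_cong: "rf f \<longleftrightarrow> rf g" if "\<And>x. x \<in> S \<Longrightarrow> f x = g x" for f g
    using that holomorphic_cong[of S S f g] unfolding rf_def by simp
  have R6: "v k z \<in> R" if kz: "k \<in> K" "z \<in> S" for k z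
  proof -
    have "(\<lambda>w. T z w) \<in> R"
      using rf_T[OF kz(2)] rf_cong[of "\<lambda>w. cnj (T z w)" "\<lambda>w. T w z"] sym[OF _ kz(2)] by (simp add: R_def)
    then have "(\<lambda>w. u (fst k) z * T z w) \<in> R" by (intro R2 Rc)
    then show ?thesis using Rc[of "u (fst k) z"] by (cases k; cases "snd k") (simp_all add: v_def)
  qed
  \<comment> \<open>Each \<open>w\<close> with bound \<open>N\<close> has the nontrivial relation
    given by \<open>qf w\<close> and \<open>pf w\<close>, and these \<open>w\<close> are too many
    for a countable exceptional set.\<close>
  have nind: "\<not> (\<exists>C. countable C \<and> (\<forall>w\<in>S - C. \<forall>a. (\<forall>z\<in>S. (\<Sum>k\<in>K. a k * v k z w) = 0) \<longrightarrow> (\<forall>k\<in>K. a k = 0)))"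
  proof (intro notI, elim exE conjE)
    fix C assume C: "countable C"
      "\<forall>w\<in>S - C. \<forall>a. (\<forall>z\<in>S. (\<Sum>k\<in>K. a k * v k z w) = 0) \<longrightarrow> (\<forall>k\<in>K. a k = 0)"
    have "\<not> {w\<in>S. Nf w = N} \<subseteq> C" using N C(1) countable_subset by blast
    then obtain w where w: "w \<in> S" "w \<notin> C" "Nf w = N" by blast
    obtain x where x: "x \<in> S" "poly2 N (qf w) (g1 x) (g2 x) \<noteq> 0"
      using rat'[OF w(1)] w(3) by auto
    have rel: "T x w * poly2 N (qf w) (g1 x) (g2 x) = poly2 N (pf w) (g1 x) (g2 x)" if "x \<in> S" for x
      using rat'[OF w(1)] w(3) that by auto
    define a where "a = (\<lambda>(i, t). if t then (\<Sum>m\<in>J. qf w (fst m) (snd m) * cf m i)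
        else - (\<Sum>m\<in>J. pf w (fst m) (snd m) * cf m i))"
    have "(\<Sum>k\<in>K. a k * v k z w) = 0" if z: "z \<in> S" for z
    proof -
      have e1: "(\<Sum>i\<in>I. a (i, True) * u i z) = poly2 N (qf w) (g1 z) (g2 z)"
        by (simp add: span[OF z] a_def)
      have e2: "(\<Sum>i\<in>I. a (i, False) * u i z) = - poly2 N (pf w) (g1 z) (g2 z)"
        by (simp add: span[OF z] a_def sum_negf)
      show ?thesis using rel[OF z] unfolding sumK e1 e2 by (simp add: mult.commute)
    qed
    then have "\<forall>k\<in>K. a k = 0" using C(2) w by blast
    then have "\<forall>i\<in>I. a (i, True) = 0" by (simp add: K_def)
    then have "poly2 N (qf w) (g1 x) (g2 x) = 0"
      by (simp add: span[OF x(1)] a_def)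
    then show False using x by simp
  qed
  have "(\<exists>d. (\<forall>k\<in>K. d k \<in> R) \<and> (\<exists>k\<in>K. \<exists>w\<in>S. d k w \<noteq> 0) \<and>
            (\<forall>z\<in>S. \<forall>w\<in>S. (\<Sum>k\<in>K. d k w * v k z w) = 0))"
    by (rule disjE[OF relation_or_independent[where R=R and S=S and Z=S and v=v and K=K] _ notE[OF nind]];
        (assumption | rule R1 R2 R3 Rc R5 uncS finK R6; assumption))
  then obtain d where d: "\<forall>k\<in>K. d k \<in> R" "\<exists>k\<in>K. \<exists>w\<in>S. d k w \<noteq> 0"
    "\<And>z w. z \<in> S \<Longrightarrow> w \<in> S \<Longrightarrow> (\<Sum>k\<in>K. d k w * v k z w) = 0" by blast
  \<comment> \<open>Without a term in \<open>T\<close> the relation would be a dependence among the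
    basis monomials alone.\<close>
  have "\<exists>i\<in>I. \<exists>w\<in>S. d (i, True) w \<noteq> 0"
  proof (rule ccontr)
    assume n: "\<not> ?thesis"
    obtain k w where kw: "k \<in> K" "w \<in> S" "d k w \<noteq> 0" using d(2) by blast
    have z0: "(\<Sum>i\<in>I. d (i, True) w * u i z) = 0" for z
      using n kw(2) by (intro sum.neutral) auto
    have "(\<Sum>i\<in>I. d (i, False) w * u i z) = 0" if z: "z \<in> S" for z
      using d(3)[OF z kw(2)] sumK[of "\<lambda>k. d k w" z w] z0[of z] by simp
    then have F0: "\<forall>i\<in>I. d (i, False) w = 0" using I(2)[rule_format, of "\<lambda>i. d (i, False) w"] by blast
    obtain i t where "k = (i, t)" by (cases k)
    then show False using F0 n kw by (cases t) (auto simp: K_def)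
  qed
  then obtain i0 where i0: "i0 \<in> I" "\<exists>w\<in>S. d (i0, True) w \<noteq> 0" by blast
  have "\<forall>k\<in>K. \<exists>P Q. (\<exists>x\<in>S. biv Q (g1 x) (g2 x) \<noteq> 0) \<and>
      (\<forall>x\<in>S. cnj (d k x) * biv Q (g1 x) (g2 x) = biv P (g1 x) (g2 x))"
    using d(1) by (simp add: R_def rf_def)
  then obtain P Q where PQ: "\<And>k. k \<in> K \<Longrightarrow> \<exists>x\<in>S. biv (Q k) (g1 x) (g2 x) \<noteq> 0"
      "\<And>k x. k \<in> K \<Longrightarrow> x \<in> S \<Longrightarrow> cnj (d k x) * biv (Q k) (g1 x) (g2 x) = biv (P k) (g1 x) (g2 x)"
    by metis
  \<comment> \<open>Numerators over the common denominator \<open>QQ\<close>: multiplying the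
    relation by \<open>cnj (QQ w)\<close> turns its coefficients into polynomials in the
    conjugates.\<close>
  define D where "D = (\<lambda>k. P k * (\<Prod>l\<in>K - {k}. Q l))"
  define QQ where "QQ = (\<lambda>x. \<Prod>l\<in>K. biv (Q l) (g1 x) (g2 x))"
  have D: "biv (D k) (g1 x) (g2 x) = cnj (d k x) * QQ x" if "k \<in> K" "x \<in> S" for k x
  proof -
    have "QQ x = biv (Q k) (g1 x) (g2 x) * (\<Prod>l\<in>K - {k}. biv (Q l) (g1 x) (g2 x))"
      unfolding QQ_def using that finK by (intro prod.remove) auto
    then show ?thesis using PQ(2)[OF that] by (simp add: D_def biv_prod mult.assoc[symmetric])
  qed
  \<comment> \<open>\<open>None\<close> stands for the coefficient that must survive and
    \<open>Some k\<close> for the denominators, so that one application finds a point where all of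
    them are nonzero.\<close>
  have "\<exists>x\<in>S. \<forall>k\<in>insert None (Some ` K). (case k of None \<Rightarrow> cnj (d (i0, True) x) | Some k \<Rightarrow> biv (Q k) (g1 x) (g2 x)) \<noteq> 0"
  proof (rule holomorphic_prod_nonzero)
    fix k assume "k \<in> insert None (Some ` K)"
    have "(\<lambda>x. cnj (d (i0, True) x)) holomorphic_on S" using d(1) i0 by (simp add: R_def rf_def K_def)
    then show "(\<lambda>x. case k of None \<Rightarrow> cnj (d (i0, True) x) | Some k \<Rightarrow> biv (Q k) (g1 x) (g2 x)) holomorphic_on S"
      using biv_hol by (cases k) auto
    show "\<exists>x\<in>S. (case k of None \<Rightarrow> cnj (d (i0, True) x) | Some k \<Rightarrow> biv (Q k) (g1 x) (g2 x)) \<noteq> 0"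
      using \<open>k \<in> insert None (Some ` K)\<close> PQ(1) i0(2) by (cases k) auto
  qed (use finK S in auto)
  then obtain w0 where w0: "w0 \<in> S" "d (i0, True) w0 \<noteq> 0" "\<forall>k\<in>K. biv (Q k) (g1 w0) (g2 w0) \<noteq> 0"
    by auto
  have QQ0: "QQ w0 \<noteq> 0" using w0(3) finK by (simp add: QQ_def)
  have "\<exists>z\<in>S. (\<Sum>i\<in>I. (d (i, True) w0 * cnj (QQ w0)) * u i z) \<noteq> 0"
    using I(2)[rule_format, of "\<lambda>i. d (i, True) w0 * cnj (QQ w0)" i0] i0 w0 QQ0 by auto
  then obtain z0 where z0: "z0 \<in> S" "(\<Sum>i\<in>I. (d (i, True) w0 * cnj (QQ w0)) * u i z0) \<noteq> 0" by blast
  obtain N1 where N1: "\<And>k. k \<in> K \<Longrightarrow> degree (D k) < N1 \<and> (\<forall>j. degree (coeff (D k) j) < N1)"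
    using poly2_bound_exists[of "D ` K"] finK by auto
  define M where "M = max N N1"
  have Dp: "biv (D k) x y = poly2 M (\<lambda>i j. coeff (coeff (D k) j) i) x y" if "k \<in> K" for k x y
    using N1[OF that] by (intro biv_eq_poly2) (auto simp: M_def less_max_iff_disj)
  \<comment> \<open>The outer coefficient index of \<open>D\<close> belongs to the second variable,
    hence \<open>l\<close> before \<open>k\<close>. The conjugate appears because \<open>D\<close>
    represents \<open>cnj (d k)\<close>; monomials outside the basis get 0.\<close>
  define cc where "cc = (\<lambda>t i j k l. if (i,j) \<in> I then cnj (coeff (coeff (D ((i,j), t)) l) k) else 0)"
  have cc: "poly4 M (cc t) (g1 z) (g2 z) (cnj (g1 w)) (cnj (g2 w)) = (\<Sum>i\<in>I. (d (i, t) w * cnj (QQ w)) * u i z)"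
    if w: "w \<in> S" for t z w
  proof -
    have IM: "I \<subseteq> {..<M} \<times> {..<M}" using I(1) by (auto simp: J_def M_def)
    have "poly4 M (cc t) (g1 z) (g2 z) (cnj (g1 w)) (cnj (g2 w)) =
       (\<Sum>i<M. \<Sum>j<M. (if (i,j) \<in> I then u (i,j) z * cnj (biv (D ((i,j),t)) (g1 w) (g2 w)) else 0))"
      unfolding poly4_def
    proof (intro sum.cong refl)
      fix i j
      show "(\<Sum>k<M. \<Sum>l<M. cc t i j k l * g1 z ^ i * g2 z ^ j * cnj (g1 w) ^ k * cnj (g2 w) ^ l) =
        (if (i,j) \<in> I then u (i,j) z * cnj (biv (D ((i,j),t)) (g1 w) (g2 w)) else 0)"
      proof (cases "(i,j) \<in> I")
        case True
        then have "((i,j),t) \<in> K" by (simp add: K_def)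
        then have "cnj (biv (D ((i,j),t)) (g1 w) (g2 w)) =
           (\<Sum>k<M. \<Sum>l<M. cc t i j k l * cnj (g1 w) ^ k * cnj (g2 w) ^ l)"
          using True by (simp add: Dp poly2_def cc_def)
        then show ?thesis using True
          by (simp add: u_def sum_distrib_left mult_ac)
      qed (simp add: cc_def)
    qed
    also have "\<dots> = (\<Sum>m\<in>{..<M}\<times>{..<M}. if m \<in> I then u m z * cnj (biv (D (m,t)) (g1 w) (g2 w)) else 0)"
      by (simp add: sum.cartesian_product case_prod_unfold cong: if_cong)
    also have "\<dots> = (\<Sum>m\<in>I. u m z * cnj (biv (D (m,t)) (g1 w) (g2 w)))"
      using IM by (intro sum.mono_neutral_cong_right) auto
    also have "\<dots> = (\<Sum>i\<in>I. (d (i, t) w * cnj (QQ w)) * u i z)"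
      using D w by (intro sum.cong) (auto simp: K_def)
    finally show ?thesis .
  qed
  have neg4: "poly4 M (\<lambda>i j k l. - c i j k l) a1 a2 a3 a4 = - poly4 M c a1 a2 a3 a4" for c a1 a2 a3 a4
    by (simp add: poly4_def sum_negf)
  show ?thesis
  proof (rule exI[of _ M], rule exI[of _ "\<lambda>i j k l. - cc False i j k l"], rule exI[of _ "cc True"], intro conjI ballI)
    show "\<exists>z\<in>S. \<exists>w\<in>S. poly4 M (cc True) (g1 z) (g2 z) (cnj (g1 w)) (cnj (g2 w)) \<noteq> 0"
      using z0 w0(1) by (intro bexI[of _ z0] bexI[of _ w0]) (simp_all only: cc not_False_eq_True)
  next
    fix z w assume zw: "z \<in> S" "w \<in> S"
    have fac: "(\<Sum>i\<in>I. (d (i, t) w * cnj (QQ w)) * u i z) = cnj (QQ w) * (\<Sum>i\<in>I. d (i,t) w * u i z)" for t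
      by (simp add: sum_distrib_left mult_ac)
    have "(\<Sum>i\<in>I. d (i, True) w * u i z) * T z w + (\<Sum>i\<in>I. d (i, False) w * u i z) = 0"
      using d(3)[OF zw] sumK[of "\<lambda>k. d k w" z w] by simp
    then have "T z w * (\<Sum>i\<in>I. d (i, True) w * u i z) = - (\<Sum>i\<in>I. d (i, False) w * u i z)"
      by (simp add: add_eq_0_iff mult.commute)
    then show "T z w * poly4 M (cc True) (g1 z) (g2 z) (cnj (g1 w)) (cnj (g2 w)) =
       poly4 M (\<lambda>i j k l. - cc False i j k l) (g1 z) (g2 z) (cnj (g1 w)) (cnj (g2 w))"
      by (simp only: neg4 cc[OF zw(2)] fac) (simp add: mult.left_commute)
  qed
qed

subsection \<open>Cauchy transforms in a chart\<close>

text \<open>Cauchy's inequality bounds the derivative of the integrand, hence its difference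
  quotients, by \<open>g t / r\<close>; dominated convergence then permits differentiation under the
  integral.\<close>

lemma holomorphic_on_lebesgue_integral:
  fixes f :: "complex \<Rightarrow> 'a \<Rightarrow> complex"
  assumes U: "open U"
    and hol: "\<And>t. t \<in> space M \<Longrightarrow> (\<lambda>z. f z t) holomorphic_on U"
    and meas: "\<And>z. z \<in> U \<Longrightarrow> f z \<in> borel_measurable M"
    and g: "integrable M g"
    and bound: "\<And>z t. z \<in> U \<Longrightarrow> t \<in> space M \<Longrightarrow> norm (f z t) \<le> g t"
  shows "(\<lambda>z. \<integral>t. f z t \<partial>M) holomorphic_on U"
proof -
  have fint: "integrable M (f z)" if "z \<in> U" for z
    by (rule Bochner_Integration.integrable_bound[OF g meas[OF that]])
      (use bound[OF that] in \<open>auto intro!: AE_I2 order_trans[OF _ abs_ge_self]\<close>)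
  have "\<exists>D. ((\<lambda>z. \<integral>t. f z t \<partial>M) has_field_derivative D) (at z0)" if z0: "z0 \<in> U" for z0
  proof -
    obtain r0 where r0: "r0 > 0" "cball z0 r0 \<subseteq> U" using U z0 open_contains_cball by metis
    \<comment> \<open>Half the radius leaves room in \<open>U\<close> for a closed disc of radius
      \<open>r\<close> about every point of \<open>ball z0 r\<close>.\<close>
    define r where "r = r0 / 2"
    have r: "r > 0" "2 * r = r0" using r0 by (auto simp: r_def)
    have sub: "cball z r \<subseteq> U" if "z \<in> ball z0 r" for z
    proof -
      have "cball z r \<subseteq> cball z0 r0" using that r by (intro subset_trans[OF cball_subset_cball_iff[THEN iffD2] order_refl]) (auto simp: dist_commute)
      then show ?thesis using r0 by blast
    qed
    have sub': "ball z0 r \<subseteq> U" using sub r by (meson centre_in_cball less_imp_le subset_iff)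
    have dbound: "norm (deriv (\<lambda>z. f z t) z) \<le> g t / r" if "t \<in> space M" "z \<in> ball z0 r" for t z
    proof -
      have h: "(\<lambda>z. f z t) holomorphic_on cball z r" using hol sub that holomorphic_on_subset by blast
      have "norm ((deriv ^^ 1) (\<lambda>z. f z t) z) \<le> fact 1 * g t / r ^ 1"
      proof (rule Cauchy_inequality)
        show "(\<lambda>z. f z t) holomorphic_on ball z r" using h holomorphic_on_subset ball_subset_cball by blast
        show "continuous_on (cball z r) (\<lambda>z. f z t)" using h holomorphic_on_imp_continuous_on by blast
        show "r > 0" by fact
        fix x assume "norm (z - x) = r"
        then have "x \<in> U" using sub[OF that(2)] by (auto simp: dist_norm)
        then show "norm (f x t) \<le> g t" using bound that by blast
      qed
      then show ?thesis by simp
    qed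
    have quot: "norm ((f z t - f z0 t) / (z - z0)) \<le> g t / r" if "t \<in> space M" "z \<in> ball z0 r - {z0}" for t z
    proof -
      have "norm (f z t - f z0 t) \<le> g t / r * norm (z - z0)"
      proof (rule field_differentiable_bound[where S = "ball z0 r" and f' = "\<lambda>z. deriv (\<lambda>z. f z t) z"])
        fix w assume "w \<in> ball z0 r"
        then show "((\<lambda>z. f z t) has_field_derivative deriv (\<lambda>z. f z t) w) (at w within ball z0 r)"
          using holomorphic_derivI[OF hol[OF that(1)] U] sub' by blast
      qed (use dbound that r in auto)
      then show ?thesis using that(2) by (simp add: norm_divide divide_le_eq)
    qed
    define D where "D = (\<lambda>t. deriv (\<lambda>z. f z t) z0)"
    have lim: "(\<lambda>i. (f (X i) t - f z0 t) / (X i - z0)) \<longlonglongrightarrow> D t"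
      if "\<forall>i. X i \<in> ball z0 r - {z0}" "X \<longlonglongrightarrow> z0" "t \<in> space M" for X t
    proof -
      have "((\<lambda>z. f z t) has_field_derivative D t) (at z0)"
        unfolding D_def using holomorphic_derivI[OF hol[OF that(3)] U z0] .
      then have "((\<lambda>z. (f z t - f z0 t) / (z - z0)) \<longlongrightarrow> D t) (at z0)"
        by (simp add: has_field_derivative_iff)
      then show ?thesis using that unfolding tendsto_at_iff_sequentially o_def by blast
    qed
    have "((\<lambda>z. ((\<integral>t. f z t \<partial>M) - (\<integral>t. f z0 t \<partial>M)) / (z - z0)) \<longlongrightarrow> (\<integral>t. D t \<partial>M)) (at z0 within ball z0 r)"
      unfolding tendsto_at_iff_sequentially
    proof (intro allI impI)
      fix X assume X: "\<forall>i. X i \<in> ball z0 r - {z0}" "X \<longlonglongrightarrow> z0"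
      have XU: "X i \<in> U" for i using X sub' by blast
      have ms: "(\<lambda>t. (f (X i) t - f z0 t) / (X i - z0)) \<in> borel_measurable M" for i
        using meas[OF XU] meas[OF z0] by measurable
      have "(\<lambda>i. \<integral>t. (f (X i) t - f z0 t) / (X i - z0) \<partial>M) \<longlonglongrightarrow> (\<integral>t. D t \<partial>M)"
      proof (rule integral_dominated_convergence[where w = "\<lambda>t. g t / r"])
        show "D \<in> borel_measurable M"
          by (rule borel_measurable_LIMSEQ_metric[OF ms lim[OF X]])
      qed (use ms g lim[OF X] quot X in auto)
      moreover have "(\<integral>t. (f (X i) t - f z0 t) / (X i - z0) \<partial>M) = ((\<integral>t. f (X i) t \<partial>M) - (\<integral>t. f z0 t \<partial>M)) / (X i - z0)" for i
        using fint[OF XU] fint[OF z0] by simp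
      ultimately show "((\<lambda>z. ((\<integral>t. f z t \<partial>M) - (\<integral>t. f z0 t \<partial>M)) / (z - z0)) \<circ> X) \<longlonglongrightarrow> (\<integral>t. D t \<partial>M)"
        unfolding o_def by (simp only:)
    qed
    then have "((\<lambda>z. \<integral>t. f z t \<partial>M) has_field_derivative (\<integral>t. D t \<partial>M)) (at z0)"
      using r by (simp add: has_field_derivative_iff at_within_open[of z0 "ball z0 r"])
    then show ?thesis by blast
  qed
  then show ?thesis using U by (auto simp: holomorphic_on_open)
qed

text \<open>For \<open>p = \<psi> a\<close> the kernel is \<open>- g' / g\<close> with \<open>g x = (\<psi> x - \<psi> a) / (x - a)\<close>.\<close>

lemma chart_kernel:
  fixes \<psi> :: "complex \<Rightarrow> complex"
  assumes hol: "\<psi> holomorphic_on ball 0 \<rho>" and inj: "inj_on \<psi> (ball 0 \<rho>)" and \<rho>: "\<rho> > 0"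
    and s: "\<And>z. z \<in> ball 0 \<rho> \<Longrightarrow> s (\<psi> z) = z" and cs: "continuous_on (\<psi> ` ball 0 \<rho>) s"
  obtains \<kappa> :: "complex \<Rightarrow> complex \<Rightarrow> complex" and B where
    "\<And>p. \<kappa> p holomorphic_on ball 0 (\<rho>/4)"
    "\<And>p x. x \<in> ball 0 (\<rho>/4) \<Longrightarrow> cmod (\<kappa> p x) \<le> B"
    "\<And>p x. x \<in> ball 0 (\<rho>/4) \<Longrightarrow> p \<noteq> \<psi> x \<Longrightarrow>
       \<kappa> p x = deriv \<psi> x / (p - \<psi> x) - (if p \<in> \<psi> ` ball 0 (\<rho>/2) then 1 / (s p - x) else 0)"
    "\<And>x. x \<in> ball 0 (\<rho>/4) \<Longrightarrow> (\<lambda>p. \<kappa> p x) \<in> borel_measurable borel"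
proof -
  define g where "g = (\<lambda>a x. if x = a then deriv \<psi> a else (\<psi> x - \<psi> a) / (x - a))"
  have g_hol: "g a holomorphic_on ball 0 \<rho>" for a
    unfolding g_def using pole_lemma_open[OF hol open_ball] .
  have dpsi: "deriv \<psi> holomorphic_on ball 0 \<rho>" using hol holomorphic_deriv by blast
  have g_nz: "g a x \<noteq> 0" if "a \<in> ball 0 \<rho>" "x \<in> ball 0 \<rho>" for a x
  proof (cases "x = a")
    case True
    then show ?thesis using holomorphic_injective_imp_regular[OF hol open_ball inj that(1)] by (simp add: g_def)
  next
    case False
    then have "\<psi> x \<noteq> \<psi> a" using inj that by (auto dest: inj_onD)
    then show ?thesis using False by (simp add: g_def)
  qed
  define k where "k = (\<lambda>a x. - deriv (g a) x / g a x)"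
  have k_hol: "k a holomorphic_on ball 0 \<rho>" if "a \<in> ball 0 \<rho>" for a
    unfolding k_def using g_nz[OF that] g_hol
    by (intro holomorphic_intros holomorphic_deriv) auto
  have k_eq: "k a x = deriv \<psi> x / (\<psi> a - \<psi> x) - 1 / (a - x)"
    if "a \<in> ball 0 \<rho>" "x \<in> ball 0 \<rho>" "x \<noteq> a" for a x
  proof -
    have gd: "(g a has_field_derivative deriv (g a) x) (at x)"
      using holomorphic_derivI[OF g_hol open_ball that(2)] .
    have "((\<lambda>x. g a x * (x - a) + \<psi> a) has_field_derivative deriv (g a) x * (x - a) + g a x) (at x)"
      by (auto intro!: derivative_eq_intros gd)
    moreover have "(\<lambda>x. g a x * (x - a) + \<psi> a) = \<psi>" by (auto simp: g_def)
    ultimately have "deriv \<psi> x = deriv (g a) x * (x - a) + g a x" by (simp add: DERIV_imp_deriv)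
    then have e1: "deriv \<psi> x = g a x - deriv (g a) x * (a - x)" by (simp add: algebra_simps)
    have "\<psi> x - \<psi> a = g a x * (x - a)" using that by (simp add: g_def)
    then have e2: "\<psi> a - \<psi> x = g a x * (a - x)" by (simp add: algebra_simps)
    show ?thesis using g_nz[OF that(1,2)] that(3)
      unfolding k_def e1 e2 by (simp add: diff_divide_distrib)
  qed
  have cont: "continuous_on (cball 0 r) \<psi>" if "r < \<rho>" for r
    using hol that by (intro holomorphic_on_imp_continuous_on holomorphic_on_subset[OF hol]) auto
  have cpt: "compact (\<psi> ` cball 0 r)" if "r < \<rho>" for r
    using cont[OF that] by (intro compact_continuous_image compact_cball)
  have op: "open (\<psi> ` ball 0 r)" if "r \<le> \<rho>" for r
    using that by (intro open_mapping_thm3 holomorphic_on_subset[OF hol] inj_on_subset[OF inj] open_ball) auto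
  obtain C where C: "\<And>x. x \<in> cball 0 (3*\<rho>/4) \<Longrightarrow> cmod (deriv \<psi> x) \<le> C"
  proof -
    have "continuous_on (cball 0 (3*\<rho>/4)) (deriv \<psi>)"
      using \<rho> by (intro holomorphic_on_imp_continuous_on holomorphic_on_subset[OF dpsi]) auto
    then have "bounded (deriv \<psi> ` cball 0 (3*\<rho>/4))"
      by (intro compact_imp_bounded compact_continuous_image compact_cball)
    then show ?thesis using that unfolding bounded_iff by blast
  qed
  have C0: "C \<ge> 0" using order_trans[OF norm_ge_zero C[of 0]] \<rho> by simp
  \<comment> \<open>Three nested radii: \<open>x\<close> stays within \<open>\<rho>/4\<close>,
    \<open>p\<close> counts as a chart point up to \<open>\<rho>/2\<close>, and the maximum
    principle is used on the circle of radius \<open>3*\<rho>/4\<close>.\<close>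
  have "\<psi> ` cball 0 (\<rho>/2) \<inter> \<psi> ` sphere 0 (3*\<rho>/4) = {}"
  proof -
    have "cball 0 (\<rho>/2) \<subseteq> ball (0::complex) \<rho>" "sphere 0 (3*\<rho>/4) \<subseteq> ball (0::complex) \<rho>" using \<rho> by auto
    then have "\<psi> ` cball 0 (\<rho>/2) \<inter> \<psi> ` sphere 0 (3*\<rho>/4) = \<psi> ` (cball 0 (\<rho>/2) \<inter> sphere 0 (3*\<rho>/4))"
      using inj_on_image_Int[OF inj] by simp
    also have "cball 0 (\<rho>/2) \<inter> sphere (0::complex) (3*\<rho>/4) = {}" using \<rho> by auto
    finally show ?thesis by simp
  qed
  moreover have cs2: "compact (\<psi> ` sphere 0 (3*\<rho>/4))"
    using \<rho> by (intro compact_continuous_image compact_sphere continuous_on_subset[OF cont[of "3*\<rho>/4"]]) auto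
  moreover have "compact (\<psi> ` cball 0 (\<rho>/2))" "compact (\<psi> ` cball 0 (\<rho>/4))" using cpt \<rho> by auto
  moreover have "\<psi> ` cball 0 (\<rho>/4) \<inter> - \<psi> ` ball 0 (\<rho>/2) = {}" using \<rho> by auto
  moreover have "closed (- \<psi> ` ball 0 (\<rho>/2))" using op[of "\<rho>/2"] \<rho> by (simp add: closed_Compl)
  moreover note compact_imp_closed[OF cs2]
  ultimately have ex: "\<exists>d>0. \<forall>p\<in>\<psi> ` cball 0 (\<rho>/2). \<forall>q\<in>\<psi> ` sphere 0 (3*\<rho>/4). d \<le> dist p q"
    "\<exists>d>0. \<forall>p\<in>\<psi> ` cball 0 (\<rho>/4). \<forall>q\<in>- \<psi> ` ball 0 (\<rho>/2). d \<le> dist p q"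
    by (rule_tac [!] separate_compact_closed) (assumption+)
  obtain d2 where d2: "d2 > 0" "\<And>p q. p \<in> \<psi> ` cball 0 (\<rho>/2) \<Longrightarrow> q \<in> \<psi> ` sphere 0 (3*\<rho>/4) \<Longrightarrow> d2 \<le> dist p q"
    using ex(1) by blast
  obtain d1 where d1: "d1 > 0" "\<And>p q. p \<in> \<psi> ` cball 0 (\<rho>/4) \<Longrightarrow> q \<in> - \<psi> ` ball 0 (\<rho>/2) \<Longrightarrow> d1 \<le> dist p q"
    using ex(2) by blast
  \<comment> \<open>The first summand serves \<open>p\<close> off the inner chart, at distance at
    least \<open>d1\<close> from \<open>\<psi> x\<close>. The bracket serves \<open>p\<close> in it,
    with \<open>4 / \<rho>\<close> because \<open>s p\<close> is at least \<open>\<rho>/4\<close>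
    away from the circle.\<close>
  define B where "B = C / d1 + (C / d2 + 4 / \<rho>)"
  define \<kappa> where "\<kappa> = (\<lambda>p x. if p \<in> \<psi> ` ball 0 (\<rho>/2) then k (s p) x else deriv \<psi> x / (p - \<psi> x))"
  have far: "d1 \<le> cmod (p - \<psi> x)" if "x \<in> ball 0 (\<rho>/4)" "p \<notin> \<psi> ` ball 0 (\<rho>/2)" for x p
    using d1(2)[of "\<psi> x" p] that by (auto simp: dist_norm norm_minus_commute)
  have sp: "s p \<in> ball 0 (\<rho>/2) \<and> \<psi> (s p) = p" if "p \<in> \<psi> ` ball 0 (\<rho>/2)" for p
    using that s \<rho> by auto
  show thesis
  proof (rule that)
    show "\<kappa> p holomorphic_on ball 0 (\<rho>/4)" for p
    proof (cases "p \<in> \<psi> ` ball 0 (\<rho>/2)")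
      case True
      then have "s p \<in> ball 0 \<rho>" using sp \<rho> by force
      then have "k (s p) holomorphic_on ball 0 (\<rho>/4)"
        using \<rho> by (intro holomorphic_on_subset[OF k_hol]) auto
      moreover have "\<kappa> p = k (s p)" using True by (auto simp: \<kappa>_def)
      ultimately show ?thesis by simp
    next
      case False
      have "p - \<psi> x \<noteq> 0" if "x \<in> ball 0 (\<rho>/4)" for x using far[OF that False] d1(1) by auto
      then have "(\<lambda>x. deriv \<psi> x / (p - \<psi> x)) holomorphic_on ball 0 (\<rho>/4)"
        using \<rho> by (intro holomorphic_intros holomorphic_on_subset[OF dpsi] holomorphic_on_subset[OF hol]) auto
      moreover have "\<kappa> p = (\<lambda>x. deriv \<psi> x / (p - \<psi> x))" using False by (auto simp: \<kappa>_def)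
      ultimately show ?thesis by simp
    qed
    show "cmod (\<kappa> p x) \<le> B" if x: "x \<in> ball 0 (\<rho>/4)" for p x
    proof (cases "p \<in> \<psi> ` ball 0 (\<rho>/2)")
      case True
      note sp = sp[OF True]
      then have spr: "s p \<in> ball 0 \<rho>" using \<rho> by force
      \<comment> \<open>Near \<open>x = s p\<close> the two singular terms cancel and cannot be
        estimated separately; on the circle they can.\<close>
      have "cmod (k (s p) x) \<le> C / d2 + 4 / \<rho>"
      proof (rule maximum_modulus_frontier[where S = "cball 0 (3*\<rho>/4)" and f = "k (s p)"])
        have *: "cball 0 (3*\<rho>/4) \<subseteq> ball (0::complex) \<rho>" using \<rho> by auto
        show "k (s p) holomorphic_on interior (cball 0 (3*\<rho>/4))"
          using k_hol[OF spr] * interior_subset holomorphic_on_subset by blast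
        show "continuous_on (closure (cball 0 (3*\<rho>/4))) (k (s p))"
          using k_hol[OF spr] * by (simp, intro holomorphic_on_imp_continuous_on) (rule holomorphic_on_subset)
        show "x \<in> cball 0 (3*\<rho>/4)" using x \<rho> by auto
        fix z assume "z \<in> frontier (cball 0 (3*\<rho>/4) :: complex set)"
        then have z: "cmod z = 3*\<rho>/4" using \<rho> by (simp add: frontier_cball)
        then have zb: "z \<in> ball 0 \<rho>" using \<rho> by simp
        have nz: "z \<noteq> s p" using sp z \<rho> by auto
        have a: "d2 \<le> cmod (p - \<psi> z)" using d2(2)[of p "\<psi> z"] z sp
          by (metis (no_types, lifting) ball_subset_cball dist_norm image_eqI mem_sphere_0 subsetD)
        have b: "\<rho>/4 \<le> cmod (s p - z)" using sp z norm_triangle_ineq2[of z "s p"] by (simp add: norm_minus_commute)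
        have "cmod (k (s p) z) \<le> cmod (deriv \<psi> z) / cmod (p - \<psi> z) + 1 / cmod (s p - z)"
          using k_eq[OF spr zb nz] sp by (simp add: norm_triangle_ineq4 flip: norm_divide) (metis norm_divide norm_one norm_triangle_ineq4)
        also have "\<dots> \<le> C / d2 + 1 / (\<rho>/4)"
          using a b C[of z] z d2(1) \<rho> C0 by (intro add_mono frac_le) auto
        finally show "cmod (k (s p) z) \<le> C / d2 + 4 / \<rho>" by simp
      qed auto
      moreover have "C / d1 \<ge> 0" using C0 d1 by simp
      ultimately show ?thesis using True by (simp add: \<kappa>_def B_def)
    next
      case False
      have "cmod (deriv \<psi> x / (p - \<psi> x)) \<le> C / d1"
        unfolding norm_divide using far[OF x False] C[of x] x d1(1) \<rho> C0 by (intro frac_le) auto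
      moreover have "C / d2 + 4 / \<rho> \<ge> 0" using C0 d2 \<rho> by simp
      ultimately show ?thesis using False by (simp add: \<kappa>_def B_def)
    qed
    show eq: "\<kappa> p x = deriv \<psi> x / (p - \<psi> x) - (if p \<in> \<psi> ` ball 0 (\<rho>/2) then 1 / (s p - x) else 0)"
      if x: "x \<in> ball 0 (\<rho>/4)" and p: "p \<noteq> \<psi> x" for p x
    proof (cases "p \<in> \<psi> ` ball 0 (\<rho>/2)")
      case True
      note sp = sp[OF True]
      have "k (s p) x = deriv \<psi> x / (\<psi> (s p) - \<psi> x) - 1 / (s p - x)"
        using sp x p \<rho> by (intro k_eq) auto
      then show ?thesis using True sp by (simp add: \<kappa>_def)
    qed (simp add: \<kappa>_def)
    show "(\<lambda>p. \<kappa> p x) \<in> borel_measurable borel" if x: "x \<in> ball 0 (\<rho>/4)" for x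
    proof -
      \<comment> \<open>The closed formula fails at the single point \<open>p = \<psi> x\<close>,
        which is split off as a separate measurable summand.\<close>
      let ?A = "\<psi> ` ball 0 (\<rho>/2) - {\<psi> x}"
      let ?B = "- {\<psi> x}"
      have "continuous_on ?A (\<lambda>p. - (1 / (s p - x)))"
      proof (intro continuous_intros continuous_on_subset[OF cs])
        show "?A \<subseteq> \<psi> ` ball 0 \<rho>" using \<rho> by auto
        show "\<forall>p\<in>?A. s p - x \<noteq> 0" using sp by auto
      qed
      then have A: "(\<lambda>p. indicator ?A p *\<^sub>R (- (1 / (s p - x)))) \<in> borel_measurable borel"
        using op[of "\<rho>/2"] \<rho> by (intro borel_measurable_continuous_on_indicator) auto
      have "continuous_on ?B (\<lambda>p. deriv \<psi> x / (p - \<psi> x))"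
        by (intro continuous_intros) auto
      then have B: "(\<lambda>p. indicator ?B p *\<^sub>R (deriv \<psi> x / (p - \<psi> x))) \<in> borel_measurable borel"
        by (intro borel_measurable_continuous_on_indicator) auto
      have "(\<lambda>p. \<kappa> p x) = (\<lambda>p. indicator ?B p *\<^sub>R (deriv \<psi> x / (p - \<psi> x)) + indicator ?A p *\<^sub>R (- (1 / (s p - x)))
          + indicator {\<psi> x} p *\<^sub>R \<kappa> (\<psi> x) x)"
      proof
        fix p
        show "\<kappa> p x = indicator ?B p *\<^sub>R (deriv \<psi> x / (p - \<psi> x)) + indicator ?A p *\<^sub>R (- (1 / (s p - x)))
          + indicator {\<psi> x} p *\<^sub>R \<kappa> (\<psi> x) x"
          using eq[OF x, of p] by (cases "p = \<psi> x") (auto simp: indicator_def)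
      qed
      then show ?thesis using A B by simp
    qed
  qed
qed

text \<open>In the chart the Cauchy kernel differs from the model kernel
  \<open>1 / (s (\<gamma> t) - x)\<close> by the bounded \<open>\<kappa>\<close> of
  \<open>chart_kernel\<close>, holomorphic in \<open>x\<close> even across the real axis; its
  integral is \<open>E\<close>. By \<open>real\<close> the point \<open>s (\<gamma> t)\<close> is
  real, which bounds the model kernel by \<open>1 / \<bar>Im x\<bar>\<close>.\<close>

lemma cauchy_transform_in_chart:
  fixes \<psi> :: "complex \<Rightarrow> complex" and f :: "'a \<Rightarrow> complex"
  assumes hol: "\<psi> holomorphic_on ball 0 \<rho>" and inj: "inj_on \<psi> (ball 0 \<rho>)" and \<rho>: "\<rho> > 0"
    and s: "\<And>z. z \<in> ball 0 \<rho> \<Longrightarrow> s (\<psi> z) = z" and cs: "continuous_on (\<psi> ` ball 0 \<rho>) s"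
    and \<gamma>: "\<gamma> \<in> borel_measurable M" and f: "integrable M f"
    and real: "\<And>t x. x \<in> ball 0 \<rho> \<Longrightarrow> \<psi> x = \<gamma> t \<Longrightarrow> Im x = 0"
  shows "\<exists>E. E holomorphic_on ball 0 (\<rho>/4) \<and> (\<forall>x\<in>ball 0 (\<rho>/4). Im x \<noteq> 0 \<longrightarrow>
     deriv \<psi> x * (\<integral>t. f t / (\<gamma> t - \<psi> x) \<partial>M) =
       (\<integral>t. f t * (if \<gamma> t \<in> \<psi> ` ball 0 (\<rho>/2) then 1 / (s (\<gamma> t) - x) else 0) \<partial>M) + E x)"
proof -
  obtain \<kappa> B where \<kappa>: "\<And>p. \<kappa> p holomorphic_on ball 0 (\<rho>/4)"
    "\<And>p x. x \<in> ball 0 (\<rho>/4) \<Longrightarrow> cmod (\<kappa> p x) \<le> B"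
    "\<And>p x. x \<in> ball 0 (\<rho>/4) \<Longrightarrow> p \<noteq> \<psi> x \<Longrightarrow>
       \<kappa> p x = deriv \<psi> x / (p - \<psi> x) - (if p \<in> \<psi> ` ball 0 (\<rho>/2) then 1 / (s p - x) else 0)"
    "\<And>x. x \<in> ball 0 (\<rho>/4) \<Longrightarrow> (\<lambda>p. \<kappa> p x) \<in> borel_measurable borel"
    using chart_kernel[OF hol inj \<rho> s cs] by blast
  have fm [measurable]: "f \<in> borel_measurable M" using f by simp
  note \<gamma> [measurable]
  define E where "E = (\<lambda>x. \<integral>t. f t * \<kappa> (\<gamma> t) x \<partial>M)"
  have \<kappa>m: "(\<lambda>t. \<kappa> (\<gamma> t) x) \<in> borel_measurable M" if "x \<in> ball 0 (\<rho>/4)" for x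
    using measurable_compose[OF \<gamma> \<kappa>(4)[OF that]] .
  have bd: "norm (f t * \<kappa> (\<gamma> t) x) \<le> norm (f t) * B" if "x \<in> ball 0 (\<rho>/4)" for x t
    using \<kappa>(2)[OF that] by (simp add: norm_mult mult_left_mono)
  have gi: "integrable M (\<lambda>t. norm (f t) * B)" using f by simp
  have "E holomorphic_on ball 0 (\<rho>/4)"
    unfolding E_def
  proof (rule holomorphic_on_lebesgue_integral[OF open_ball _ _ gi])
    show "(\<lambda>z. f t * \<kappa> (\<gamma> t) z) holomorphic_on ball 0 (\<rho>/4)" for t by (intro holomorphic_intros \<kappa>(1))
    show "(\<lambda>t. f t * \<kappa> (\<gamma> t) z) \<in> borel_measurable M" if "z \<in> ball 0 (\<rho>/4)" for z
      using \<kappa>m[OF that] by measurable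
  qed (use bd in auto)
  moreover have "deriv \<psi> x * (\<integral>t. f t / (\<gamma> t - \<psi> x) \<partial>M) =
       (\<integral>t. f t * (if \<gamma> t \<in> \<psi> ` ball 0 (\<rho>/2) then 1 / (s (\<gamma> t) - x) else 0) \<partial>M) + E x"
    if x: "x \<in> ball 0 (\<rho>/4)" and im: "Im x \<noteq> 0" for x
  proof -
    let ?c = "\<lambda>t. if \<gamma> t \<in> \<psi> ` ball 0 (\<rho>/2) then 1 / (s (\<gamma> t) - x) else 0"
    have xr: "x \<in> ball 0 \<rho>" using x \<rho> by simp
    have "\<gamma> t \<noteq> \<psi> x" for t using real[OF xr, of t] im by auto
    then have eq: "\<kappa> (\<gamma> t) x = deriv \<psi> x / (\<gamma> t - \<psi> x) - ?c t" for t using \<kappa>(3)[OF x] by blast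
    have op: "open (\<psi> ` ball 0 (\<rho>/2))"
      using \<rho> by (intro open_mapping_thm3 holomorphic_on_subset[OF hol] inj_on_subset[OF inj] open_ball) auto
    \<comment> \<open>\<open>s\<close> is controlled only on the chart, so it is cut off before
      measurability is claimed on the whole plane.\<close>
    have "(\<lambda>p. indicator (\<psi> ` ball 0 (\<rho>/2)) p *\<^sub>R s p) \<in> borel_measurable borel"
      using op \<rho> by (intro borel_measurable_continuous_on_indicator continuous_on_subset[OF cs]) auto
    then have m: "(\<lambda>p. 1 / (indicator (\<psi> ` ball 0 (\<rho>/2)) p *\<^sub>R s p - x)) \<in> borel_measurable borel"
      by (intro borel_measurable_divide borel_measurable_diff borel_measurable_const)
    have "(\<lambda>p. if p \<in> \<psi> ` ball 0 (\<rho>/2) then 1 / (indicator (\<psi> ` ball 0 (\<rho>/2)) p *\<^sub>R s p - x) else 0) \<in> borel_measurable borel"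
      by (rule measurable_If_set[OF m]) (use op in auto)
    moreover have "(\<lambda>p. if p \<in> \<psi> ` ball 0 (\<rho>/2) then 1 / (indicator (\<psi> ` ball 0 (\<rho>/2)) p *\<^sub>R s p - x) else 0) =
       (\<lambda>p. if p \<in> \<psi> ` ball 0 (\<rho>/2) then 1 / (s p - x) else 0)" by (auto simp: indicator_def)
    ultimately have cm: "?c \<in> borel_measurable M"
      using measurable_compose[OF \<gamma>] by simp
    have cb: "norm (?c t) \<le> 1 / \<bar>Im x\<bar>" for t
    proof (cases "\<gamma> t \<in> \<psi> ` ball 0 (\<rho>/2)")
      case True
      then obtain y where y: "y \<in> ball 0 (\<rho>/2)" "\<gamma> t = \<psi> y" by blast
      then have yr: "y \<in> ball 0 \<rho>" using \<rho> by simp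
      have "s (\<gamma> t) = y" "Im y = 0" using s[OF yr] real[OF yr, of t] y by auto
      then have "\<bar>Im x\<bar> \<le> cmod (s (\<gamma> t) - x)" using abs_Im_le_cmod[of "s (\<gamma> t) - x"] by simp
      then show ?thesis using im True by (auto simp: norm_divide intro!: frac_le)
    qed simp
    have cb': "norm (f t * ?c t) \<le> norm (f t) * (1 / \<bar>Im x\<bar>)" for t
      unfolding norm_mult by (rule mult_left_mono[OF cb norm_ge_zero])
    have ic: "integrable M (\<lambda>t. f t * ?c t)"
    proof (rule Bochner_Integration.integrable_bound)
      show "integrable M (\<lambda>t. norm (f t) * (1 / \<bar>Im x\<bar>))" using f by simp
      show "(\<lambda>t. f t * ?c t) \<in> borel_measurable M" by (rule borel_measurable_times[OF fm cm])
      show "AE t in M. norm (f t * ?c t) \<le> norm (norm (f t) * (1 / \<bar>Im x\<bar>))"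
        unfolding real_norm_def by (rule AE_I2, rule order_trans[OF cb' abs_ge_self])
    qed
    have ik: "integrable M (\<lambda>t. f t * \<kappa> (\<gamma> t) x)"
      by (rule Bochner_Integration.integrable_bound[OF gi]) (use \<kappa>m[OF x] in \<open>auto intro!: AE_I2 order_trans[OF bd[OF x] abs_ge_self]\<close>)
    have "(\<integral>t. f t * ?c t \<partial>M) + E x = (\<integral>t. f t * ?c t + f t * \<kappa> (\<gamma> t) x \<partial>M)"
      using ic ik by (simp add: E_def)
    also have "\<dots> = (\<integral>t. deriv \<psi> x * (f t / (\<gamma> t - \<psi> x)) \<partial>M)"
      by (intro Bochner_Integration.integral_cong refl) (simp only: eq, simp add: algebra_simps)
    also have "\<dots> = deriv \<psi> x * (\<integral>t. f t / (\<gamma> t - \<psi> x) \<partial>M)"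
      by (rule integral_mult_right_zero)
    finally show ?thesis by (rule sym)
  qed
  ultimately show ?thesis by blast
qed

text \<open>The local reflection principle: both functions agree with the Cauchy transforms of
  conjugate densities up to holomorphic terms, and these transforms are exchanged by
  \<open>x \<mapsto> cnj x\<close>; since the functions vanish below the real axis, each transform
  continues holomorphically from below.\<close>

lemma conjugate_transforms_reflect:
  fixes \<psi> F F' h h' :: "complex \<Rightarrow> complex" and f :: "nat \<Rightarrow> 'a \<Rightarrow> complex"
  assumes hol: "\<psi> holomorphic_on ball 0 \<rho>" and inj: "inj_on \<psi> (ball 0 \<rho>)" and \<rho>: "\<rho> > 0"
    and \<gamma>: "\<And>j. j < n \<Longrightarrow> \<gamma> j \<in> borel_measurable M" and f: "\<And>j. j < n \<Longrightarrow> integrable M (f j)"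
    and real: "\<And>j t x. j < n \<Longrightarrow> x \<in> ball 0 \<rho> \<Longrightarrow> \<psi> x = \<gamma> j t \<Longrightarrow> Im x = 0"
    and h: "(\<lambda>x. h (\<psi> x)) holomorphic_on ball 0 \<rho>" "(\<lambda>x. h' (\<psi> x)) holomorphic_on ball 0 \<rho>"
    and F: "\<And>x. x \<in> ball 0 \<rho> \<Longrightarrow> Im x \<noteq> 0 \<Longrightarrow> F (\<psi> x) = (\<Sum>j<n. \<integral>t. f j t / (\<gamma> j t - \<psi> x) \<partial>M) + h (\<psi> x)"
    and F': "\<And>x. x \<in> ball 0 \<rho> \<Longrightarrow> Im x \<noteq> 0 \<Longrightarrow> F' (\<psi> x) = (\<Sum>j<n. \<integral>t. cnj (f j t) / (\<gamma> j t - \<psi> x) \<partial>M) + h' (\<psi> x)"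
    and zero: "\<And>x. x \<in> ball 0 \<rho> \<Longrightarrow> Im x < 0 \<Longrightarrow> F (\<psi> x) = 0"
    and zero': "\<And>x. x \<in> ball 0 \<rho> \<Longrightarrow> Im x < 0 \<Longrightarrow> F' (\<psi> x) = 0"
  shows "\<exists>A. A holomorphic_on ball 0 (\<rho>/4) \<and> (\<forall>x\<in>ball 0 (\<rho>/4). Im x > 0 \<longrightarrow>
     deriv \<psi> x * F (\<psi> x) = A x \<and> deriv \<psi> x * F' (\<psi> x) = - cnj (A (cnj x)))"
proof -
  obtain s where s: "s holomorphic_on \<psi> ` ball 0 \<rho>" "\<And>z. z \<in> ball 0 \<rho> \<Longrightarrow> s (\<psi> z) = z"
    using holomorphic_has_inverse[OF hol open_ball inj] by metis
  have cs: "continuous_on (\<psi> ` ball 0 \<rho>) s" using s(1) holomorphic_on_imp_continuous_on by blast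
  define c where "c = (\<lambda>j x t. if \<gamma> j t \<in> \<psi> ` ball 0 (\<rho>/2) then 1 / (s (\<gamma> j t) - x) else 0)"
  define C where "C = (\<lambda>x. \<Sum>j<n. \<integral>t. f j t * c j x t \<partial>M)"
  define C' where "C' = (\<lambda>x. \<Sum>j<n. \<integral>t. cnj (f j t) * c j x t \<partial>M)"
  have f': "integrable M (\<lambda>t. cnj (f j t))" if "j < n" for j using f[OF that] by simp
  have "\<forall>j\<in>{..<n}. \<exists>E. E holomorphic_on ball 0 (\<rho>/4) \<and> (\<forall>x\<in>ball 0 (\<rho>/4). Im x \<noteq> 0 \<longrightarrow>
     deriv \<psi> x * (\<integral>t. f j t / (\<gamma> j t - \<psi> x) \<partial>M) = (\<integral>t. f j t * c j x t \<partial>M) + E x)"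
    unfolding c_def
    by (intro ballI cauchy_transform_in_chart[OF hol inj \<rho> s(2) cs]) (use \<gamma> f real in auto)
  from bchoice[OF this] obtain E where "\<forall>j\<in>{..<n}. E j holomorphic_on ball 0 (\<rho>/4) \<and> (\<forall>x\<in>ball 0 (\<rho>/4). Im x \<noteq> 0 \<longrightarrow>
     deriv \<psi> x * (\<integral>t. f j t / (\<gamma> j t - \<psi> x) \<partial>M) = (\<integral>t. f j t * c j x t \<partial>M) + E j x)"
    by (rule exE)
  then have E: "\<And>j. j < n \<Longrightarrow> E j holomorphic_on ball 0 (\<rho>/4)"
    "\<And>j x. j < n \<Longrightarrow> x \<in> ball 0 (\<rho>/4) \<Longrightarrow> Im x \<noteq> 0 \<Longrightarrow>
      deriv \<psi> x * (\<integral>t. f j t / (\<gamma> j t - \<psi> x) \<partial>M) = (\<integral>t. f j t * c j x t \<partial>M) + E j x"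
    by simp_all
  have "\<forall>j\<in>{..<n}. \<exists>E. E holomorphic_on ball 0 (\<rho>/4) \<and> (\<forall>x\<in>ball 0 (\<rho>/4). Im x \<noteq> 0 \<longrightarrow>
     deriv \<psi> x * (\<integral>t. cnj (f j t) / (\<gamma> j t - \<psi> x) \<partial>M) = (\<integral>t. cnj (f j t) * c j x t \<partial>M) + E x)"
    unfolding c_def
    by (intro ballI cauchy_transform_in_chart[OF hol inj \<rho> s(2) cs]) (use \<gamma> f' real in auto)
  from bchoice[OF this] obtain E' where "\<forall>j\<in>{..<n}. E' j holomorphic_on ball 0 (\<rho>/4) \<and> (\<forall>x\<in>ball 0 (\<rho>/4). Im x \<noteq> 0 \<longrightarrow>
     deriv \<psi> x * (\<integral>t. cnj (f j t) / (\<gamma> j t - \<psi> x) \<partial>M) = (\<integral>t. cnj (f j t) * c j x t \<partial>M) + E' j x)"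
    by (rule exE)
  then have E': "\<And>j. j < n \<Longrightarrow> E' j holomorphic_on ball 0 (\<rho>/4)"
    "\<And>j x. j < n \<Longrightarrow> x \<in> ball 0 (\<rho>/4) \<Longrightarrow> Im x \<noteq> 0 \<Longrightarrow>
      deriv \<psi> x * (\<integral>t. cnj (f j t) / (\<gamma> j t - \<psi> x) \<partial>M) = (\<integral>t. cnj (f j t) * c j x t \<partial>M) + E' j x"
    by simp_all
  define e where "e = (\<lambda>x. (\<Sum>j<n. E j x) + deriv \<psi> x * h (\<psi> x))"
  define e' where "e' = (\<lambda>x. (\<Sum>j<n. E' j x) + deriv \<psi> x * h' (\<psi> x))"
  have sub: "ball 0 (\<rho>/4) \<subseteq> ball (0::complex) \<rho>" using \<rho> by auto
  have dh: "deriv \<psi> holomorphic_on ball 0 (\<rho>/4)"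
    using holomorphic_on_subset[OF holomorphic_deriv[OF hol open_ball] sub] .
  have eh: "e holomorphic_on ball 0 (\<rho>/4)" "e' holomorphic_on ball 0 (\<rho>/4)"
    unfolding e_def e'_def using E(1) E'(1)
    by (auto intro!: holomorphic_on_add holomorphic_on_sum holomorphic_on_mult dh
        holomorphic_on_subset[OF h(1) sub] holomorphic_on_subset[OF h(2) sub])
  have FC: "deriv \<psi> x * F (\<psi> x) = C x + e x" if "x \<in> ball 0 (\<rho>/4)" "Im x \<noteq> 0" for x
  proof -
    have "x \<in> ball 0 \<rho>" using that sub by blast
    then have "deriv \<psi> x * F (\<psi> x) = (\<Sum>j<n. deriv \<psi> x * (\<integral>t. f j t / (\<gamma> j t - \<psi> x) \<partial>M)) + deriv \<psi> x * h (\<psi> x)"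
      using F that(2) by (simp add: distrib_left sum_distrib_left)
    also have "\<dots> = C x + e x" using E(2) that by (simp add: C_def e_def sum.distrib)
    finally show ?thesis .
  qed
  have FC': "deriv \<psi> x * F' (\<psi> x) = C' x + e' x" if "x \<in> ball 0 (\<rho>/4)" "Im x \<noteq> 0" for x
  proof -
    have "x \<in> ball 0 \<rho>" using that sub by blast
    then have "deriv \<psi> x * F' (\<psi> x) = (\<Sum>j<n. deriv \<psi> x * (\<integral>t. cnj (f j t) / (\<gamma> j t - \<psi> x) \<partial>M)) + deriv \<psi> x * h' (\<psi> x)"
      using F' that(2) by (simp add: distrib_left sum_distrib_left)
    also have "\<dots> = C' x + e' x" using E'(2) that by (simp add: C'_def e'_def sum.distrib)
    finally show ?thesis .
  qed
  \<comment> \<open>Wherever the kernel is nonzero \<open>s (\<gamma> j t)\<close> is real, so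
    conjugating the kernel only conjugates \<open>x\<close>.\<close>
  have ccnj: "cnj (c j (cnj x) t) = c j x t" if j: "j < n" for j x t
  proof (cases "\<gamma> j t \<in> \<psi> ` ball 0 (\<rho>/2)")
    case True
    then obtain y where y: "y \<in> ball 0 (\<rho>/2)" "\<gamma> j t = \<psi> y" by blast
    then have yr: "y \<in> ball 0 \<rho>" using \<rho> by simp
    have "s (\<gamma> j t) = y" "Im y = 0" using s(2)[OF yr] real[OF j yr, of t] y by auto
    then have "cnj (s (\<gamma> j t)) = s (\<gamma> j t)" by (simp add: complex_eq_iff)
    then show ?thesis by (simp add: c_def)
  qed (simp add: c_def)
  have CC: "cnj (C (cnj x)) = C' x" for x
    unfolding C_def C'_def cnj_sum
  proof (intro sum.cong refl)
    fix j assume "j \<in> {..<n}"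
    then have eq: "cnj (f j t * c j (cnj x) t) = cnj (f j t) * c j x t" for t
      by (simp add: ccnj)
    have "cnj (\<integral>t. f j t * c j (cnj x) t \<partial>M) = (\<integral>t. cnj (f j t * c j (cnj x) t) \<partial>M)"
      by (rule Bochner_Integration.integral_cnj[symmetric])
    then show "cnj (\<integral>t. f j t * c j (cnj x) t \<partial>M) = (\<integral>t. cnj (f j t) * c j x t \<partial>M)"
      unfolding eq .
  qed
  \<comment> \<open>Below the axis \<open>C' = - e'\<close>, and \<open>CC\<close> carries this to
    \<open>C x = - cnj (e' (cnj x))\<close> above it; adding \<open>e x\<close> gives
    \<open>A x\<close>.\<close>
  define A where "A = (\<lambda>x. e x - cnj (e' (cnj x)))"
  have cb: "cnj ` ball 0 (\<rho>/4) \<subseteq> ball 0 (\<rho>/4)" by auto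
  have "(cnj \<circ> e' \<circ> cnj) holomorphic_on ball 0 (\<rho>/4)"
    using holomorphic_on_compose_cnj_cnj[of e' "ball 0 (\<rho>/4)"] eh(2) cb by (auto intro: holomorphic_on_subset)
  then have "A holomorphic_on ball 0 (\<rho>/4)"
    unfolding A_def using eh(1) by (intro holomorphic_intros) (simp_all add: o_def)
  moreover have "deriv \<psi> x * F (\<psi> x) = A x \<and> deriv \<psi> x * F' (\<psi> x) = - cnj (A (cnj x))"
    if x: "x \<in> ball 0 (\<rho>/4)" "Im x > 0" for x
  proof -
    have y: "cnj x \<in> ball 0 (\<rho>/4)" "Im (cnj x) < 0" using x by auto
    then have "cnj x \<in> ball 0 \<rho>" using sub by blast
    then have "C (cnj x) + e (cnj x) = 0" "C' (cnj x) + e' (cnj x) = 0"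
      using FC[OF y(1)] FC'[OF y(1)] y(2) zero[OF _ y(2)] zero'[OF _ y(2)] by auto
    then have "C (cnj x) = - e (cnj x)" "C' (cnj x) = - e' (cnj x)"
      by (simp_all add: eq_neg_iff_add_eq_0)
    moreover have "C x = cnj (C' (cnj x))" using arg_cong[OF CC[of "cnj x"], of cnj] by simp
    moreover have "C' x = cnj (C (cnj x))" using CC[of x] by simp
    ultimately show ?thesis using FC[of x] FC'[of x] x by (simp add: A_def)
  qed
  ultimately show ?thesis by blast
qed

subsection \<open>Boundary charts\<close>

text \<open>A power series that converges on a real interval about its centre converges on the
  complex disc of the same radius, so the local series of the curve is its own
  complexification.\<close>

lemma real_analytic_curve_extension:
  assumes "real_analytic_curve g"
  obtains r \<psi> where "r > 0" "\<psi> holomorphic_on ball 0 r" "\<And>s. \<bar>s\<bar> < r \<Longrightarrow> g (t + s) = \<psi> (of_real s)"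
    "\<And>s. \<bar>s\<bar> < r \<Longrightarrow> (g has_vector_derivative deriv \<psi> (of_real s)) (at (t + s))"
proof -
  obtain r c where r: "r > 0" and c: "\<And>s. \<bar>s - t\<bar> < r \<Longrightarrow> (\<lambda>k. c k * (complex_of_real (s - t)) ^ k) sums g s"
    using assms unfolding real_analytic_curve_def by blast
  have c': "(\<lambda>k. c k * (complex_of_real s) ^ k) sums g (t + s)" if "\<bar>s\<bar> < r" for s
    using c[of "t + s"] that by simp
  define \<psi> where "\<psi> = (\<lambda>w. \<Sum>k. c k * w ^ k)"
  have sm: "(\<lambda>k. c k * (w - 0) ^ k) sums \<psi> w" if w: "w \<in> ball 0 r" for w
  proof -
    \<comment> \<open>Convergence at a real point of larger modulus gives absolute convergence at
      \<open>w\<close>.\<close>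
    obtain x where x: "cmod w < x" "x < r" using w dense by auto
    have "x > 0" using x(1) norm_ge_zero[of w] by linarith
    then have "summable (\<lambda>k. c k * (complex_of_real x) ^ k)"
      using c'[of x] x(2) by (auto simp: sums_iff)
    then have "summable (\<lambda>k. norm (c k * w ^ k))"
      using x(1) \<open>x > 0\<close> by (intro powser_insidea[where x = "complex_of_real x"]) auto
    then show ?thesis by (simp add: \<psi>_def summable_norm_cancel summable_sums)
  qed
  have hol: "\<psi> holomorphic_on ball 0 r" using power_series_holomorphic[OF sm] .
  have eq: "g (t + s) = \<psi> (of_real s)" if "\<bar>s\<bar> < r" for s
    using sums_unique2[OF c'[OF that]] sm[of "of_real s"] that by simp
  have "(g has_vector_derivative deriv \<psi> (of_real s)) (at (t + s))" if s: "\<bar>s\<bar> < r" for s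
  proof -
    have "((\<lambda>u. complex_of_real (u - t)) has_vector_derivative 1) (at (t + s))"
      by (auto intro!: derivative_eq_intros simp: has_vector_derivative_def scaleR_conv_of_real)
    moreover have "(\<psi> has_field_derivative deriv \<psi> (of_real s)) (at (complex_of_real ((t + s) - t)))"
      using holomorphic_derivI[OF hol open_ball, of "of_real s"] s by simp
    ultimately have "((\<psi> \<circ> (\<lambda>u. complex_of_real (u - t))) has_vector_derivative 1 * deriv \<psi> (of_real s)) (at (t + s))"
      by (rule field_vector_diff_chain_at)
    then have "((\<psi> \<circ> (\<lambda>u. complex_of_real (u - t))) has_vector_derivative deriv \<psi> (of_real s)) (at (t + s))"
      by (simp only: mult_1)
    then show ?thesis
    proof (rule has_vector_derivative_transform_within_open[where S = "ball t r"])
      fix u assume "u \<in> ball t r"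
      then show "(\<psi> \<circ> (\<lambda>u. complex_of_real (u - t))) u = g u"
        using eq[of "u - t"] by (simp add: dist_real_def abs_minus_commute)
    qed (use s in \<open>auto simp: dist_real_def\<close>)
  qed
  then show thesis using that r hol eq by blast
qed

lemma real_analytic_curve_C1:
  assumes "real_analytic_curve g"
  shows "continuous_on UNIV g" "continuous_on UNIV (\<lambda>t. vector_derivative g (at t))"
proof -
  have "isCont g t \<and> isCont (\<lambda>t. vector_derivative g (at t)) t" for t
  proof -
    obtain r \<psi> where r: "r > 0" "\<psi> holomorphic_on ball 0 r"
      and d: "\<And>s. \<bar>s\<bar> < r \<Longrightarrow> (g has_vector_derivative deriv \<psi> (of_real s)) (at (t + s))"
      using real_analytic_curve_extension[OF assms, of t] by metis
    have "continuous_on (ball 0 r) (deriv \<psi>)"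
      using holomorphic_deriv[OF r(2) open_ball] holomorphic_on_imp_continuous_on by blast
    then have "isCont (deriv \<psi>) (complex_of_real (t - t))"
      using r(1) by (simp add: continuous_on_eq_continuous_at)
    then have c: "isCont (\<lambda>u. deriv \<psi> (complex_of_real (u - t))) t"
      by (rule isCont_o2[where f = "\<lambda>u. complex_of_real (u - t)", rotated]) (intro continuous_intros)
    have ev: "eventually (\<lambda>u. deriv \<psi> (complex_of_real (u - t)) = vector_derivative g (at u)) (nhds t)"
    proof (rule eventually_nhds_in_open[of "ball t r", THEN eventually_mono])
      fix u assume "u \<in> ball t r"
      then show "deriv \<psi> (complex_of_real (u - t)) = vector_derivative g (at u)"
        using vector_derivative_at[OF d[of "u - t"]] by (simp add: dist_real_def abs_minus_commute)
    qed (use r in auto)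
    have "isCont (\<lambda>t. vector_derivative g (at t)) t"
      by (rule iffD1[OF isCont_cong[OF ev] c])
    moreover have "isCont g t"
      using d[of 0] r(1) has_vector_derivative_continuous by fastforce
    ultimately show ?thesis by blast
  qed
  then show "continuous_on UNIV g" "continuous_on UNIV (\<lambda>t. vector_derivative g (at t))"
    by (auto simp: continuous_on_eq_continuous_at)
qed

section \<open>Periodic parametrizations and injectivity modulo 1\<close>

lemma periodic_int:
  assumes "\<And>t::real. g (t + 1) = g t"
  shows "g (t + of_int k) = g t"
proof -
  have nat: "g (t + of_nat m) = g t" for t m
  proof (induction m)
    case (Suc m)
    then show ?case using assms[of "t + of_nat m"] by (simp add: algebra_simps)
  qed simp
  show ?thesis
  proof (cases "k \<ge> 0")
    case True
    then show ?thesis using nat[of t "nat k"] by simp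
  next
    case False
    then show ?thesis using nat[of "t + of_int k" "nat (- k)"] by simp
  qed
qed

lemma analytic_closed_curve_eq_iff:
  assumes "analytic_closed_curve g"
  shows "g s = g t \<longleftrightarrow> s - t \<in> \<int>"
proof -
  have per: "g (t + of_int k) = g t" for t k
    using assms periodic_int unfolding analytic_closed_curve_def by blast
  have fr: "g (frac x) = g x" for x using per[of x "- \<lfloor>x\<rfloor>"] by (simp add: frac_def)
  have inj: "inj_on g {0..<1}" using assms unfolding analytic_closed_curve_def by blast
  show ?thesis
  proof
    assume "g s = g t"
    then have "frac s = frac t" using inj fr frac_ge_0 frac_lt_1
      by (intro inj_onD[OF inj]) auto
    then have "s - t = of_int (\<lfloor>s\<rfloor> - \<lfloor>t\<rfloor>)" by (simp add: frac_def)
    then show "s - t \<in> \<int>" by (metis Ints_of_int)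
  next
    assume "s - t \<in> \<int>"
    then obtain k where "s = t + of_int k" by (metis Ints_cases add_diff_cancel_left' diff_add_cancel add.commute)
    then show "g s = g t" using per by simp
  qed
qed

lemma analytic_closed_curve_range:
  assumes "analytic_closed_curve g"
  shows "g t \<in> g ` {0..1}"
proof -
  have "t - frac t \<in> \<int>" by (simp add: frac_def)
  then have "g t = g (frac t)" using analytic_closed_curve_eq_iff[OF assms] by blast
  then show ?thesis using frac_ge_0[of t] frac_lt_1[of t] by (intro image_eqI[of _ _ "frac t"]) auto
qed

lemma analytic_closed_curve_simple_path:
  assumes g: "analytic_closed_curve g"
  shows "simple_path g" "pathfinish g = pathstart g"
proof -
  show "simple_path g"
  proof
    show "path g"
      using g real_analytic_curve_C1(1) continuous_on_subset unfolding analytic_closed_curve_def path_def by blast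
    fix x y :: real assume xy: "0 \<le> x" "x < y" "y \<le> 1" "g x = g y"
    then have "y - x \<in> \<int>" using analytic_closed_curve_eq_iff[OF g, of y x] by simp
    then obtain k where k: "y - x = of_int k" by (auto elim: Ints_cases)
    then have "0 < real_of_int k" "real_of_int k \<le> 1" using xy by auto
    then have "k = 1" by linarith
    with k have "y - x = 1" by simp
    then show "x = 0 \<and> y = 1" using xy by auto
  qed
  have "g 1 = g 0" using analytic_closed_curve_eq_iff[OF g, of 1 0] by simp
  then show "pathfinish g = pathstart g" by (simp add: pathfinish_def pathstart_def)
qed

text \<open>Modulo 1 the parameter is \<open>t0 + x\<close> with \<open>0 \<le> x\<close> and
  \<open>x < 1\<close>; the case \<open>x > 1 - d\<close> wraps around to the small negative shift
  \<open>x - 1\<close>.\<close>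

lemma analytic_closed_curve_cover:
  assumes g: "analytic_closed_curve g" and d: "0 < d" "d < 1/2"
  shows "g ` {0..1} \<subseteq> {g (t0 + s) | s. \<bar>s\<bar> < d} \<union> g ` {t0 + d..t0 + 1 - d}"
proof
  fix p assume "p \<in> g ` {0..1}"
  then obtain t where t: "p = g t" by blast
  define x where "x = frac (t - t0)"
  have x: "0 \<le> x" "x < 1" by (auto simp: x_def frac_lt_1)
  have eq: "p = g (t0 + x)" "p = g (t0 + (x - 1))"
    unfolding t using analytic_closed_curve_eq_iff[OF g] by (auto simp: x_def frac_def)
  consider "x < d" | "d \<le> x" "x \<le> 1 - d" | "x > 1 - d" by linarith
  then show "p \<in> {g (t0 + s) | s. \<bar>s\<bar> < d} \<union> g ` {t0 + d..t0 + 1 - d}"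
  proof cases
    case 1
    then have "\<bar>x\<bar> < d" using x by simp
    then show ?thesis using eq(1) by blast
  next
    case 2
    then show ?thesis using eq(1) by auto
  next
    case 3
    then have "\<bar>x - 1\<bar> < d" using x by simp
    then show ?thesis using eq(2) by blast
  qed
qed

text \<open>The other curves and the part of \<open>\<Gamma> j\<close> at parameter distance at
  least \<open>d\<close> from \<open>t0\<close> form a closed set missing
  \<open>\<Gamma> j t0\<close>; a ball in its complement sees only the short arc.\<close>

lemma frontier_near_boundary_point:
  assumes dom: "smooth_nconnected_domain \<Omega> n \<Gamma>" and j: "j < n" and d: "0 < d" "d < 1/2"
  obtains e where "e > 0" "\<And>p. p \<in> frontier \<Omega> \<Longrightarrow> p \<in> ball (\<Gamma> j t0) e \<Longrightarrow> \<exists>s. \<bar>s\<bar> < d \<and> p = \<Gamma> j (t0 + s)"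
proof -
  have curves: "analytic_closed_curve (\<Gamma> i)" if "i < n" for i
    using dom that by (simp add: smooth_nconnected_domain_def)
  have ct: "continuous_on A (\<Gamma> i)" if "i < n" for i A
    using curves[OF that] real_analytic_curve_C1(1) continuous_on_subset
    unfolding analytic_closed_curve_def by blast
  define B where "B = (\<Union>i\<in>{..<n} - {j}. \<Gamma> i ` {0..1}) \<union> \<Gamma> j ` {t0 + d..t0 + 1 - d}"
  have "closed B" unfolding B_def
    using ct j by (intro closed_Un closed_UN ballI compact_imp_closed compact_continuous_image) auto
  moreover have "\<Gamma> j t0 \<notin> B"
  proof
    assume "\<Gamma> j t0 \<in> B"
    then consider i where "i < n" "i \<noteq> j" "\<Gamma> j t0 \<in> \<Gamma> i ` {0..1}"
      | t where "t0 + d \<le> t" "t \<le> t0 + 1 - d" "\<Gamma> j t0 = \<Gamma> j t" unfolding B_def by auto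
    then show False
    proof cases
      case 1
      then show False using analytic_closed_curve_range[OF curves[OF j], of t0] dom j
        unfolding smooth_nconnected_domain_def by blast
    next
      case 2
      then have "t - t0 \<in> \<int>" using analytic_closed_curve_eq_iff[OF curves[OF j], of t t0] by simp
      then obtain k where k: "t - t0 = of_int k" by (auto elim: Ints_cases)
      then have "0 < real_of_int k" "real_of_int k < 1" using 2 d by linarith+
      then have "0 < k \<and> k < 1" by simp
      then show False by linarith
    qed
  qed
  ultimately obtain e where e: "e > 0" "ball (\<Gamma> j t0) e \<subseteq> - B"
    using open_contains_ball[of "- B"] by auto
  show thesis
  proof (rule that[OF e(1)])
    fix p assume p: "p \<in> frontier \<Omega>" "p \<in> ball (\<Gamma> j t0) e"
    then have nB: "p \<notin> B" using e(2) by blast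
    obtain i where i: "i < n" "p \<in> \<Gamma> i ` {0..1}" using p(1) dom unfolding smooth_nconnected_domain_def by auto
    have "i = j" using nB i by (auto simp: B_def)
    then show "\<exists>s. \<bar>s\<bar> < d \<and> p = \<Gamma> j (t0 + s)"
      using analytic_closed_curve_cover[OF curves[OF j] d, of t0] i nB unfolding B_def by blast
  qed
qed

lemma convex_half_ball:
  "convex {x \<in> ball 0 r. Im x > 0}" "convex {x \<in> ball 0 r. Im x < 0}"
proof -
  have "{x \<in> ball 0 r. Im x > 0} = ball 0 r \<inter> {x. Im x > 0}" "{x \<in> ball 0 r. Im x < 0} = ball 0 r \<inter> {x. Im x < 0}"
    by auto
  then show "convex {x \<in> ball 0 r. Im x > 0}" "convex {x \<in> ball 0 r. Im x < 0}"
    by (auto intro!: convex_Int convex_ball convex_halfspace_Im_gt convex_halfspace_Im_lt)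
qed

text \<open>The chart is the complexified parametrization. Each half disc has a connected image that
  misses the frontier, so it lies in \<Omega> or off the closure. Both cannot lie off the closure,
  since \<zeta> is a limit of points of \<Omega>; both cannot lie in \<Omega>, by the Jordan curve
  theorem.\<close>

lemma boundary_chart:
  assumes dom: "smooth_nconnected_domain \<Omega> n \<Gamma>" and \<zeta>: "\<zeta> \<in> frontier \<Omega>" and e0: "e0 > 0"
  obtains \<rho> \<psi> where "\<rho> > 0" "\<psi> holomorphic_on ball 0 \<rho>" "inj_on \<psi> (ball 0 \<rho>)" "\<psi> 0 = \<zeta>"
    "\<psi> ` ball 0 \<rho> \<subseteq> ball \<zeta> e0"
    "\<And>x. x \<in> ball 0 \<rho> \<Longrightarrow> \<psi> x \<in> frontier \<Omega> \<longleftrightarrow> Im x = 0"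
    "\<And>x. x \<in> ball 0 \<rho> \<Longrightarrow> Im x > 0 \<Longrightarrow> \<psi> x \<in> \<Omega>"
    "\<And>x. x \<in> ball 0 \<rho> \<Longrightarrow> Im x < 0 \<Longrightarrow> \<psi> x \<notin> closure \<Omega>"
proof -
  have curves: "analytic_closed_curve (\<Gamma> i)" if "i < n" for i
    using dom that by (simp add: smooth_nconnected_domain_def)
  have \<Omega>: "open \<Omega>" "connected \<Omega>" "\<Omega> \<noteq> {}" and fr: "frontier \<Omega> = (\<Union>j<n. \<Gamma> j ` {0..1})"
    using dom by (auto simp: smooth_nconnected_domain_def)
  obtain j t0 where j: "j < n" and t0: "\<zeta> = \<Gamma> j t0" using \<zeta> fr by auto
  have ra: "real_analytic_curve (\<Gamma> j)" and vd: "vector_derivative (\<Gamma> j) (at t0) \<noteq> 0"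
    using curves[OF j] by (auto simp: analytic_closed_curve_def)
  have infr: "\<Gamma> j t \<in> frontier \<Omega>" for t
    unfolding fr using analytic_closed_curve_range[OF curves[OF j]] j by blast
  obtain r \<psi> where r: "r > 0" "\<psi> holomorphic_on ball 0 r" "\<And>s. \<bar>s\<bar> < r \<Longrightarrow> \<Gamma> j (t0 + s) = \<psi> (of_real s)"
    "\<And>s. \<bar>s\<bar> < r \<Longrightarrow> (\<Gamma> j has_vector_derivative deriv \<psi> (of_real s)) (at (t0 + s))"
    using real_analytic_curve_extension[OF ra, of t0] by metis
  have \<psi>0: "\<psi> 0 = \<zeta>" using r(3)[of 0] r(1) t0 by simp
  have dn: "deriv \<psi> 0 \<noteq> 0" using vector_derivative_at[OF r(4)[of 0]] r(1) vd by simp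
  have z0: "0 \<in> ball (0::complex) r" using r(1) by simp
  obtain r1 where r1: "r1 > 0" "ball 0 r1 \<subseteq> ball (0::complex) r" "inj_on \<psi> (ball 0 r1)"
    by (rule has_complex_derivative_locally_injective[OF r(2) z0 open_ball dn])
  \<comment> \<open>Small enough for injectivity, and below 1/2 so that the arc of parameter length
    \<open>2 * d\<close> does not close up.\<close>
  define d where "d = min r1 (1/4)"
  have d: "0 < d" "d < 1/2" "d \<le> r1" using r1(1) by (auto simp: d_def)
  have sub: "ball 0 d \<subseteq> ball (0::complex) r" using r1(2) d(3) by (meson order_trans subset_ball)
  have real_lt: "\<bar>s\<bar> < r" if "\<bar>s\<bar> < d" for s :: real
    using sub that by (metis mem_ball_0 norm_of_real subsetD)
  obtain e where e: "e > 0" "\<And>p. p \<in> frontier \<Omega> \<Longrightarrow> p \<in> ball (\<Gamma> j t0) e \<Longrightarrow> \<exists>s. \<bar>s\<bar> < d \<and> p = \<Gamma> j (t0 + s)"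
    using frontier_near_boundary_point[OF dom j d(1,2)] by blast
  have "isCont \<psi> 0"
    using holomorphic_on_imp_continuous_on[OF r(2)] r(1) by (simp add: continuous_on_eq_continuous_at)
  then obtain \<rho>0 where \<rho>0: "\<rho>0 > 0" "\<And>x. dist x 0 < \<rho>0 \<Longrightarrow> dist (\<psi> x) (\<psi> 0) < min e e0"
    using e(1) e0 unfolding continuous_at_eps_delta by (metis min_less_iff_conj)
  define \<rho> where "\<rho> = min \<rho>0 d"
  have \<rho>: "\<rho> > 0" "\<rho> \<le> \<rho>0" "\<rho> \<le> d" using \<rho>0 d by (auto simp: \<rho>_def)
  have hol: "\<psi> holomorphic_on ball 0 \<rho>"
    using sub \<rho> by (intro holomorphic_on_subset[OF r(2)]) (auto simp: subset_iff)
  have inj_d: "inj_on \<psi> (ball 0 d)" using r1(3) d(3) by (meson inj_on_subset subset_ball)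
  then have inj: "inj_on \<psi> (ball 0 \<rho>)" using \<rho>(3) by (meson inj_on_subset subset_ball)
  have near: "\<psi> x \<in> ball \<zeta> e \<and> \<psi> x \<in> ball \<zeta> e0" if "x \<in> ball 0 \<rho>" for x
    using \<rho>0(2)[of x] that \<rho> \<psi>0 by (auto simp: dist_commute)
  have iff: "\<psi> x \<in> frontier \<Omega> \<longleftrightarrow> Im x = 0" if x: "x \<in> ball 0 \<rho>" for x
  proof
    assume "\<psi> x \<in> frontier \<Omega>"
    then obtain s where s: "\<bar>s\<bar> < d" "\<psi> x = \<Gamma> j (t0 + s)" using e(2) near[OF x] t0 by blast
    then have "\<psi> x = \<psi> (of_real s)" using r(3)[OF real_lt[OF s(1)]] by simp
    then have "x = of_real s" using inj_d x \<rho>(3) s(1) by (auto dest!: inj_onD)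
    then show "Im x = 0" by simp
  next
    assume "Im x = 0"
    then have xr: "x = of_real (Re x)" by (simp add: complex_eq_iff)
    then have "cmod x = \<bar>Re x\<bar>" by (metis norm_of_real)
    then have "\<bar>Re x\<bar> < r" using x \<rho>(3) real_lt by simp
    then show "\<psi> x \<in> frontier \<Omega>" using r(3)[of "Re x"] infr xr by metis
  qed
  have op: "open (\<psi> ` ball 0 \<rho>)" using open_mapping_thm3[OF hol open_ball inj] .
  have cont: "continuous_on (ball 0 \<rho>) \<psi>" using hol holomorphic_on_imp_continuous_on by blast
  have dich: "\<psi> ` H \<subseteq> \<Omega> \<or> \<psi> ` H \<inter> closure \<Omega> = {}"
    if H: "convex H" "H \<subseteq> ball 0 \<rho>" "\<And>x. x \<in> H \<Longrightarrow> Im x \<noteq> 0" for H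
  proof -
    have "connected (\<psi> ` H)"
      using H(1,2) cont by (meson connected_continuous_image continuous_on_subset convex_connected)
    moreover have nf: "\<psi> ` H \<inter> frontier \<Omega> = {}" using H iff by blast
    ultimately have "\<psi> ` H \<inter> \<Omega> = {} \<or> \<psi> ` H \<subseteq> \<Omega>" using connected_Int_frontier[of "\<psi> ` H" \<Omega>] by blast
    moreover have "closure \<Omega> = \<Omega> \<union> frontier \<Omega>"
      using \<Omega>(1) by (metis closure_Un_frontier)
    ultimately show ?thesis using nf by blast
  qed
  define U where "U = {x \<in> ball 0 \<rho>. Im x > 0}"
  define L where "L = {x \<in> ball 0 \<rho>. Im x < 0}"
  have dU: "\<psi> ` U \<subseteq> \<Omega> \<or> \<psi> ` U \<inter> closure \<Omega> = {}" and dL: "\<psi> ` L \<subseteq> \<Omega> \<or> \<psi> ` L \<inter> closure \<Omega> = {}"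
    unfolding U_def L_def by (rule dich; use convex_half_ball in auto)+
  have cover: "x \<in> U \<or> x \<in> L \<or> \<psi> x \<in> \<Gamma> j ` {0..1} \<and> \<psi> x \<in> frontier \<Omega>" if x: "x \<in> ball 0 \<rho>" for x
  proof (cases "Im x = 0")
    case True
    then have xr: "x = of_real (Re x)" by (simp add: complex_eq_iff)
    then have "cmod x = \<bar>Re x\<bar>" by (metis norm_of_real)
    then have "\<bar>Re x\<bar> < r" using x \<rho>(3) real_lt by simp
    then have "\<psi> x = \<Gamma> j (t0 + Re x)" using r(3)[of "Re x"] xr by metis
    then show ?thesis using analytic_closed_curve_range[OF curves[OF j]] infr by simp
  qed (use x in \<open>auto simp: U_def L_def\<close>)
  have \<zeta>in: "\<zeta> \<in> \<psi> ` ball 0 \<rho>" using \<psi>0 \<rho>(1) by (metis centre_in_ball image_eqI)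
  have some: "\<psi> ` U \<subseteq> \<Omega> \<or> \<psi> ` L \<subseteq> \<Omega>"
  proof (rule ccontr)
    assume "\<not> ?thesis"
    then have "\<psi> ` U \<inter> closure \<Omega> = {}" "\<psi> ` L \<inter> closure \<Omega> = {}" using dU dL by auto
    then have "\<psi> ` ball 0 \<rho> \<inter> \<Omega> = {}"
      using cover \<Omega>(1) closure_subset[of \<Omega>] frontier_disjoint_eq[of \<Omega>] by fast
    moreover have "\<zeta> \<in> closure \<Omega>" using \<zeta> by (simp add: frontier_def)
    ultimately show False using op \<zeta>in open_Int_closure_eq_empty[OF op, of \<Omega>] by blast
  qed
  \<comment> \<open>\<Omega> is connected and misses the Jordan curve \<open>P\<close>, so it lies
    on one side of it. But every neighbourhood of \<zeta> meets both sides, and chart points off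
    \<open>P\<close> would all belong to \<Omega>.\<close>
  have notboth: "\<not> (\<psi> ` U \<subseteq> \<Omega> \<and> \<psi> ` L \<subseteq> \<Omega>)"
  proof
    assume both: "\<psi> ` U \<subseteq> \<Omega> \<and> \<psi> ` L \<subseteq> \<Omega>"
    define P where "P = path_image (\<Gamma> j)"
    have P: "P = \<Gamma> j ` {0..1}" by (simp add: P_def path_image_def)
    note J = Jordan_inside_outside[OF analytic_closed_curve_simple_path[OF curves[OF j]], folded P_def]
    have \<Omega>P: "\<Omega> \<inter> P = {}" using P fr j frontier_disjoint_eq[of \<Omega>] \<Omega>(1) by blast
    have side: "\<psi> ` ball 0 \<rho> \<inter> S \<noteq> {}" "\<Omega> \<inter> S \<noteq> {} \<longrightarrow> \<Omega> \<subseteq> S" if S: "frontier S = P" "open S" for S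
    proof -
      have "\<zeta> \<in> closure S" using S(1) P t0 analytic_closed_curve_range[OF curves[OF j]] by (auto simp: frontier_def)
      then show "\<psi> ` ball 0 \<rho> \<inter> S \<noteq> {}" using op \<zeta>in open_Int_closure_eq_empty[OF op, of S] by blast
      show "\<Omega> \<inter> S \<noteq> {} \<longrightarrow> \<Omega> \<subseteq> S" using connected_Int_frontier[OF \<Omega>(2), of S] S(1) \<Omega>P by blast
    qed
    have "\<Omega> \<inter> S \<noteq> {}" if S: "frontier S = P" "open S" "S \<inter> P = {}" for S
    proof -
      obtain x where x: "x \<in> ball 0 \<rho>" "\<psi> x \<in> S" using side(1)[OF S(1,2)] by blast
      then have "x \<in> U \<or> x \<in> L" using cover[OF x(1)] S(3) P by blast
      then show ?thesis using both x(2) by blast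
    qed
    then have "\<Omega> \<subseteq> inside P \<and> \<Omega> \<subseteq> outside P"
      using J side(2) by (metis Compl_disjoint Int_Un_distrib2 Int_commute Un_empty)
    then show False using J \<Omega>(3) by blast
  qed
  show thesis
  proof (cases "\<psi> ` U \<subseteq> \<Omega>")
    case True
    then have "\<psi> ` L \<inter> closure \<Omega> = {}" using notboth dL by blast
    with True show thesis
      by (intro that[of \<rho> \<psi>]) (use \<rho>(1) hol inj \<psi>0 near iff in \<open>auto simp: U_def L_def\<close>)
  next
    case False
    then have L: "\<psi> ` L \<subseteq> \<Omega>" "\<psi> ` U \<inter> closure \<Omega> = {}" using some dU by auto
    have mem: "- x \<in> ball 0 \<rho>" if "x \<in> ball 0 \<rho>" for x :: complex using that by simp
    show thesis
    \<comment> \<open>A half turn exchanges the half discs and preserves the real axis, and unlike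
      conjugation it is holomorphic.\<close>
    proof (rule that[of \<rho> "\<lambda>x. \<psi> (- x)"])
      show "(\<lambda>x. \<psi> (- x)) holomorphic_on ball 0 \<rho>"
      proof -
        have "uminus ` ball 0 \<rho> \<subseteq> ball (0::complex) \<rho>" using mem by blast
        from holomorphic_on_compose_gen[OF holomorphic_on_minus[OF holomorphic_on_ident] hol this]
        show ?thesis by (simp only: o_def)
      qed
      show "inj_on (\<lambda>x. \<psi> (- x)) (ball 0 \<rho>)"
        using inj unfolding inj_on_def by (metis mem neg_equal_iff_equal)
      show "(\<lambda>x. \<psi> (- x)) ` ball 0 \<rho> \<subseteq> ball \<zeta> e0" using near mem by blast
      fix x :: complex assume x: "x \<in> ball 0 \<rho>"
      show "\<psi> (- x) \<in> frontier \<Omega> \<longleftrightarrow> Im x = 0" using iff[OF mem[OF x]] by simp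
      show "\<psi> (- x) \<in> \<Omega>" if "Im x > 0" using L(1) mem[OF x] that by (auto simp: L_def)
      show "\<psi> (- x) \<notin> closure \<Omega>" if "Im x < 0"
      proof -
        have "- x \<in> U" using mem[OF x] that by (simp add: U_def)
        then show ?thesis using L(2) by blast
      qed
    qed (use \<rho>(1) \<psi>0 in auto)
  qed
qed

subsection \<open>Functions smooth up to the boundary\<close>

text \<open>Continuity is local, and every point of the closure has a relative neighbourhood inside
  one of the two pieces.\<close>

lemma continuous_on_closure_glue:
  assumes "open \<Omega>" "continuous_on \<Omega> g" "continuous_on (closure \<Omega> - {\<xi>}) g" "\<xi> \<in> \<Omega>"
  shows "continuous_on (closure \<Omega>) (g :: complex \<Rightarrow> complex)"
  unfolding continuous_on_eq_continuous_within
proof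
  fix x assume x: "x \<in> closure \<Omega>"
  show "continuous (at x within closure \<Omega>) g"
  proof (cases "x \<in> \<Omega>")
    case True
    then show ?thesis
      using assms(1,2) continuous_on_eq_continuous_at continuous_at_imp_continuous_within by blast
  next
    case False
    then have ne: "x \<noteq> \<xi>" using assms(4) by blast
    then have "continuous (at x within closure \<Omega> - {\<xi>}) g"
      using assms(3) x by (simp add: continuous_on_eq_continuous_within)
    moreover have "at x within closure \<Omega> - {\<xi>} = at x within closure \<Omega>"
      by (rule at_within_nhd[where S = "- {\<xi>}"]) (use ne in auto)
    ultimately show ?thesis by simp
  qed
qed

lemma smooth_up_to_boundary_add_const:
  assumes "smooth_up_to_boundary \<Omega> h" "open \<Omega>"
  shows "smooth_up_to_boundary \<Omega> (\<lambda>z. h z + a)"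
  unfolding smooth_up_to_boundary_def
proof (intro conjI allI)
  have h: "h holomorphic_on \<Omega>" "continuous_on (closure \<Omega>) h" using assms by (auto simp: smooth_up_to_boundary_def)
  show "(\<lambda>z. h z + a) holomorphic_on \<Omega>" "continuous_on (closure \<Omega>) (\<lambda>z. h z + a)"
    using h by (auto intro!: holomorphic_intros continuous_intros)
  fix k
  obtain g where g: "continuous_on (closure \<Omega>) g" "\<And>z. z \<in> \<Omega> \<Longrightarrow> g z = (deriv ^^ k) h z"
    using assms unfolding smooth_up_to_boundary_def by blast
  have "(deriv ^^ k) (\<lambda>z. h z + a) z = (deriv ^^ k) h z + (if k = 0 then a else 0)" if "z \<in> \<Omega>" for z
    using higher_deriv_add[OF h(1) holomorphic_on_const[of a] assms(2) that, of k] by (simp add: higher_deriv_const)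
  then show "\<exists>g. continuous_on (closure \<Omega>) g \<and> (\<forall>z\<in>\<Omega>. g z = (deriv ^^ k) (\<lambda>z. h z + a) z)"
    using g by (intro exI[of _ "\<lambda>z. g z + (if k = 0 then a else 0)"]) (auto intro!: continuous_intros)
qed

text \<open>Leibniz' rule applied to the extended derivatives of \<open>h\<close>. \<open>V\<close>
  may omit points of the closure, which admits the factor \<open>1 / (z - \<xi>)\<close>.\<close>

lemma higher_deriv_product_extension:
  assumes h: "smooth_up_to_boundary \<Omega> h" and \<Omega>: "open \<Omega>"
    and c: "c holomorphic_on V" "open V"
  shows "\<exists>g. continuous_on (closure \<Omega> \<inter> V) g \<and> (\<forall>z\<in>\<Omega> \<inter> V. g z = (deriv ^^ k) (\<lambda>z. h z * c z) z)"
proof -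
  have "\<forall>k. \<exists>g. continuous_on (closure \<Omega>) g \<and> (\<forall>z\<in>\<Omega>. g z = (deriv ^^ k) h z)"
    using h by (simp add: smooth_up_to_boundary_def)
  from choice[OF this] obtain g where g: "\<forall>k. continuous_on (closure \<Omega>) (g k) \<and> (\<forall>z\<in>\<Omega>. g k z = (deriv ^^ k) h z)"
    by (rule exE)
  define G where "G = (\<lambda>z. \<Sum>i = 0..k. of_nat (k choose i) * g i z * (deriv ^^ (k - i)) c z)"
  have "continuous_on V ((deriv ^^ i) c)" for i
    using holomorphic_higher_deriv[OF c] holomorphic_on_imp_continuous_on by blast
  then have "continuous_on (closure \<Omega> \<inter> V) G"
    unfolding G_def using g
    by (intro continuous_intros) (auto intro: continuous_on_subset)
  moreover have "G z = (deriv ^^ k) (\<lambda>z. h z * c z) z" if z: "z \<in> \<Omega> \<inter> V" for z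
  proof -
    have "h holomorphic_on \<Omega> \<inter> V" "c holomorphic_on \<Omega> \<inter> V"
      using h c(1) by (auto simp: smooth_up_to_boundary_def intro: holomorphic_on_subset)
    then have "(deriv ^^ k) (\<lambda>z. h z * c z) z = (\<Sum>i = 0..k. of_nat (k choose i) * (deriv ^^ i) h z * (deriv ^^ (k - i)) c z)"
      by (rule higher_deriv_mult[OF _ _ open_Int[OF \<Omega> c(2)] z])
    then show ?thesis using g z by (simp add: G_def)
  qed
  ultimately show ?thesis by blast
qed

lemma smooth_up_to_boundary_mult:
  assumes h: "smooth_up_to_boundary \<Omega> h" and \<Omega>: "open \<Omega>"
    and c: "c holomorphic_on V" "open V" "closure \<Omega> \<subseteq> V"
  shows "smooth_up_to_boundary \<Omega> (\<lambda>z. h z * c z)"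
  unfolding smooth_up_to_boundary_def
proof (intro conjI allI)
  have \<Omega>V: "\<Omega> \<subseteq> V" using c(3) closure_subset by blast
  show "(\<lambda>z. h z * c z) holomorphic_on \<Omega>"
    using h c \<Omega>V by (auto simp: smooth_up_to_boundary_def intro!: holomorphic_intros intro: holomorphic_on_subset)
  show "continuous_on (closure \<Omega>) (\<lambda>z. h z * c z)"
    using h c holomorphic_on_imp_continuous_on[OF c(1)]
    by (auto simp: smooth_up_to_boundary_def intro!: continuous_intros intro: continuous_on_subset)
  fix k
  have "closure \<Omega> \<inter> V = closure \<Omega>" "\<Omega> \<inter> V = \<Omega>" using c(3) \<Omega>V by auto
  then show "\<exists>g. continuous_on (closure \<Omega>) g \<and> (\<forall>z\<in>\<Omega>. g z = (deriv ^^ k) (\<lambda>z. h z * c z) z)"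
    using higher_deriv_product_extension[OF h \<Omega> c(1,2), of k] by simp
qed

text \<open>Inside \<Omega> the filled-in quotient is holomorphic; away from \<xi> it is
  \<open>h - h \<xi>\<close> times \<open>1 / (z - \<xi>)\<close>, whose derivatives extend to the
  boundary. The two descriptions glue because \<xi> is an interior point.\<close>

lemma smooth_up_to_boundary_diff_quotient:
  assumes h: "smooth_up_to_boundary \<Omega> h" and \<Omega>: "open \<Omega>" and \<xi>: "\<xi> \<in> \<Omega>"
  shows "smooth_up_to_boundary \<Omega> (\<lambda>z. if z = \<xi> then deriv h \<xi> else (h z - h \<xi>) / (z - \<xi>))" (is "smooth_up_to_boundary \<Omega> ?q")
proof -
  have hh: "h holomorphic_on \<Omega>" using h by (simp add: smooth_up_to_boundary_def)
  have q: "?q holomorphic_on \<Omega>" using pole_lemma_open[OF hh \<Omega>] .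
  define c where "c = (\<lambda>z. 1 / (z - \<xi>))"
  have c: "c holomorphic_on - {\<xi>}" unfolding c_def by (intro holomorphic_intros) auto
  \<comment> \<open>The last clause says that for \<open>k = 0\<close> the extension is the quotient
    itself on the boundary too, where the middle clause says nothing.\<close>
  have ext: "\<exists>g. continuous_on (closure \<Omega>) g \<and> (\<forall>z\<in>\<Omega>. g z = (deriv ^^ k) ?q z) \<and> (k = 0 \<longrightarrow> (\<forall>z\<in>closure \<Omega>. g z = ?q z))" for k
  proof -
    have h': "smooth_up_to_boundary \<Omega> (\<lambda>z. h z + - h \<xi>)" by (rule smooth_up_to_boundary_add_const[OF h \<Omega>])
    have e1: "(deriv ^^ k) (\<lambda>z. (h z + - h \<xi>) * c z) z = (deriv ^^ k) ?q z" if z: "z \<in> \<Omega> - {\<xi>}" for z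
    proof (rule higher_deriv_transform_within_open[where S = "\<Omega> - {\<xi>}"])
      have "c holomorphic_on \<Omega> - {\<xi>}" "h holomorphic_on \<Omega> - {\<xi>}" using c hh by (auto intro: holomorphic_on_subset)
      then show "(\<lambda>z. (h z + - h \<xi>) * c z) holomorphic_on \<Omega> - {\<xi>}" by (intro holomorphic_intros)
      show "?q holomorphic_on \<Omega> - {\<xi>}" using q by (rule holomorphic_on_subset) auto
    qed (use \<Omega> z in \<open>auto simp: c_def\<close>)
    show ?thesis
    proof (cases "k = 0")
      case True
      have "continuous_on (closure \<Omega> - {\<xi>}) ?q"
      proof (rule continuous_on_eq)
        show "continuous_on (closure \<Omega> - {\<xi>}) (\<lambda>z. (h z - h \<xi>) / (z - \<xi>))"
          using h by (auto simp: smooth_up_to_boundary_def intro!: continuous_intros intro: continuous_on_subset)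
      qed auto
      then have "continuous_on (closure \<Omega>) ?q"
        using continuous_on_closure_glue[OF \<Omega> holomorphic_on_imp_continuous_on[OF q] _ \<xi>] by blast
      then show ?thesis using True by (intro exI[of _ ?q]) auto
    next
      case False
      obtain G where G: "continuous_on (closure \<Omega> \<inter> - {\<xi>}) G"
        "\<And>z. z \<in> \<Omega> \<inter> - {\<xi>} \<Longrightarrow> G z = (deriv ^^ k) (\<lambda>z. (h z + - h \<xi>) * c z) z"
        using higher_deriv_product_extension[OF h' \<Omega> c, of k] by auto
      define g where "g = (\<lambda>z. if z \<in> \<Omega> then (deriv ^^ k) ?q z else G z)"
      have "continuous_on \<Omega> ((deriv ^^ k) ?q)"
        using holomorphic_higher_deriv[OF q \<Omega>] holomorphic_on_imp_continuous_on by blast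
      then have "continuous_on \<Omega> g" by (rule continuous_on_eq) (simp add: g_def)
      moreover have "continuous_on (closure \<Omega> - {\<xi>}) g"
      proof (rule continuous_on_eq)
        show "continuous_on (closure \<Omega> - {\<xi>}) G" using G(1) by (simp add: Diff_eq)
        show "\<And>x. x \<in> closure \<Omega> - {\<xi>} \<Longrightarrow> G x = g x" using G(2) e1 by (auto simp: g_def)
      qed
      ultimately have "continuous_on (closure \<Omega>) g" by (rule continuous_on_closure_glue[OF \<Omega> _ _ \<xi>])
      then show ?thesis using False by (intro exI[of _ g]) (auto simp: g_def)
    qed
  qed
  have "continuous_on (closure \<Omega>) ?q"
  proof -
    obtain g where g: "continuous_on (closure \<Omega>) g" "\<forall>z\<in>closure \<Omega>. g z = ?q z" using ext[of 0] by auto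
    show ?thesis by (rule continuous_on_eq[OF g(1)]) (use g(2) in simp)
  qed
  moreover have "\<exists>g. continuous_on (closure \<Omega>) g \<and> (\<forall>z\<in>\<Omega>. g z = (deriv ^^ k) ?q z)" for k
    using ext[of k] by (elim exE conjE) (rule exI, rule conjI)
  ultimately show ?thesis unfolding smooth_up_to_boundary_def using q by (intro conjI allI)
qed

subsection \<open>The weighted boundary pairing\<close>

text \<open>The density of phi f cnj(g) ds in the parameter of curve \<open>j\<close>. With the
  indicator built in, all integrals run over the whole line, as the Cauchy transform lemmas
  expect.\<close>

definition dens :: "(nat \<Rightarrow> real \<Rightarrow> complex) \<Rightarrow> (complex \<Rightarrow> real) \<Rightarrow> (complex \<Rightarrow> complex) \<Rightarrow> (complex \<Rightarrow> complex)
    \<Rightarrow> nat \<Rightarrow> real \<Rightarrow> complex" where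
  "dens \<Gamma> \<phi> f g j t = indicator {0..1} t *\<^sub>R (of_real (\<phi> (\<Gamma> j t)) * f (\<Gamma> j t) * cnj (g (\<Gamma> j t)) *
      of_real (norm (vector_derivative (\<Gamma> j) (at t))))"

definition cauchy_transform :: "nat \<Rightarrow> (nat \<Rightarrow> real \<Rightarrow> complex) \<Rightarrow> (complex \<Rightarrow> real) \<Rightarrow> (complex \<Rightarrow> complex)
    \<Rightarrow> (complex \<Rightarrow> complex) \<Rightarrow> complex \<Rightarrow> complex" where
  "cauchy_transform n \<Gamma> \<phi> f g \<xi> = (\<Sum>j<n. \<integral>t. dens \<Gamma> \<phi> f g j t / (\<Gamma> j t - \<xi>) \<partial>lborel)"

lemma winner_eq_dens: "winner n \<Gamma> \<phi> f g = (\<Sum>j<n. \<integral>t. dens \<Gamma> \<phi> f g j t \<partial>lborel)"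
  unfolding winner_def bint_def set_lebesgue_integral_def dens_def ..

lemma cnj_dens: "cnj (dens \<Gamma> \<phi> f g j t) = dens \<Gamma> \<phi> g f j t"
  by (simp add: dens_def mult_ac)

lemma cnj_winner: "cnj (winner n \<Gamma> \<phi> f g) = winner n \<Gamma> \<phi> g f"
  unfolding winner_eq_dens cnj_sum
  by (intro sum.cong refl) (simp only: Bochner_Integration.integral_cnj[symmetric] cnj_dens)

locale weighted_domain =
  fixes \<Omega> :: "complex set" and n :: nat and \<Gamma> :: "nat \<Rightarrow> real \<Rightarrow> complex" and \<phi> :: "complex \<Rightarrow> real"
  assumes dom: "smooth_nconnected_domain \<Omega> n \<Gamma>" and weight: "boundary_weight \<Omega> n \<Gamma> \<phi>"
begin

lemma open_domain: "open \<Omega>" and connected_domain: "connected \<Omega>" and bounded_domain: "bounded \<Omega>"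
  and frontier_domain: "frontier \<Omega> = (\<Union>j<n. \<Gamma> j ` {0..1})"
  and curve: "j < n \<Longrightarrow> analytic_closed_curve (\<Gamma> j)"
  using dom by (auto simp: smooth_nconnected_domain_def)

lemma closure_domain: "closure \<Omega> = \<Omega> \<union> frontier \<Omega>"
  by (metis closure_Un_frontier)

lemma frontier_disjoint_domain: "\<Omega> \<inter> frontier \<Omega> = {}"
  using open_domain frontier_disjoint_eq by blast

lemma curve_continuous: "j < n \<Longrightarrow> continuous_on UNIV (\<Gamma> j)"
  and speed_continuous: "j < n \<Longrightarrow> continuous_on UNIV (\<lambda>t. norm (vector_derivative (\<Gamma> j) (at t)))"
  using real_analytic_curve_C1(1)[of "\<Gamma> j"] continuous_on_norm[OF real_analytic_curve_C1(2)[of "\<Gamma> j"]] curve[of j]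
  by (simp_all add: analytic_closed_curve_def)

lemma curve_in_frontier: "j < n \<Longrightarrow> \<Gamma> j t \<in> frontier \<Omega>"
  unfolding frontier_domain using analytic_closed_curve_range[OF curve] by blast

definition arc_weight :: "nat \<Rightarrow> real \<Rightarrow> real" where
  "arc_weight j t = \<phi> (\<Gamma> j t) * norm (vector_derivative (\<Gamma> j) (at t))"

lemma arc_weight_nonneg: "j < n \<Longrightarrow> arc_weight j t \<ge> 0"
  using curve_in_frontier weight by (simp add: arc_weight_def boundary_weight_def less_imp_le)

lemma arc_weight_continuous: "j < n \<Longrightarrow> continuous_on UNIV (arc_weight j)"
proof -
  assume j: "j < n"
  have "smooth_real (\<lambda>t. \<phi> (\<Gamma> j t))" using weight j by (simp add: boundary_weight_def)
  then have "(\<lambda>t. \<phi> (\<Gamma> j t)) differentiable (at t)" for t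
    unfolding smooth_real_def by (metis funpow_0)
  then have "continuous_on UNIV (\<lambda>t. \<phi> (\<Gamma> j t))"
    by (simp add: continuous_on_eq_continuous_at differentiable_imp_continuous_within)
  then show ?thesis
    unfolding arc_weight_def using speed_continuous[OF j] by (rule continuous_on_mult)
qed

lemma arc_weight_bound: "j < n \<Longrightarrow> \<exists>W. \<forall>t\<in>{0..1}. arc_weight j t \<le> W"
proof -
  assume j: "j < n"
  have "compact (arc_weight j ` {0..1})"
    using arc_weight_continuous[OF j] continuous_on_subset by (intro compact_continuous_image) auto
  then have "bounded (arc_weight j ` {0..1})" by (rule compact_imp_bounded)
  then show ?thesis unfolding bounded_iff by (metis abs_le_D1 image_eqI real_norm_def)
qed

text \<open>The indicator is attached to both factors because \<open>L2_bdry\<close> asserts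
  measurability only after cutting off to \<open>{0..1}\<close>.\<close>

lemma dens_eq: "dens \<Gamma> \<phi> f g j t = of_real (arc_weight j t) * (indicator {0..1} t *\<^sub>R f (\<Gamma> j t)) * cnj (indicator {0..1} t *\<^sub>R g (\<Gamma> j t))"
  by (cases "t \<in> {0..1}") (simp_all add: dens_def arc_weight_def mult_ac)

lemma norm_dens: "j < n \<Longrightarrow> norm (dens \<Gamma> \<phi> f g j t) = arc_weight j t * indicator {0..1} t * (cmod (f (\<Gamma> j t)) * cmod (g (\<Gamma> j t)))"
  using arc_weight_nonneg[of j t] by (cases "t \<in> {0..1}") (simp_all add: dens_eq norm_mult)

lemma dens_measurable:
  assumes "L2_bdry n \<Gamma> f" "L2_bdry n \<Gamma> g" "j < n"
  shows "dens \<Gamma> \<phi> f g j \<in> borel_measurable lborel"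
proof -
  have [measurable]: "(\<lambda>t. indicator {0..1} t *\<^sub>R f (\<Gamma> j t)) \<in> borel_measurable lborel"
    "(\<lambda>t. indicator {0..1} t *\<^sub>R g (\<Gamma> j t)) \<in> borel_measurable lborel"
    using assms by (auto simp: L2_bdry_def set_borel_measurable_def)
  have "arc_weight j \<in> borel_measurable borel"
    using arc_weight_continuous[OF assms(3)] by (rule borel_measurable_continuous_onI)
  then have [measurable]: "(\<lambda>t. complex_of_real (arc_weight j t)) \<in> borel_measurable lborel" by simp
  have "(\<lambda>t. of_real (arc_weight j t) * (indicator {0..1} t *\<^sub>R f (\<Gamma> j t)) * cnj (indicator {0..1} t *\<^sub>R g (\<Gamma> j t))) \<in> borel_measurable lborel"
    by (intro borel_measurable_times measurable_compose[OF _ borel_measurable_continuous_onI[OF continuous_on_cnj[OF continuous_on_id]]]) measurable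
  then show ?thesis by (simp only: dens_eq[abs_def])
qed

text \<open>The arc weight is bounded on \<open>{0..1}\<close>, and
  \<open>x * y \<le> x\<^sup>2 + y\<^sup>2\<close> reduces the product to the two square-integrable
  factors.\<close>

lemma dens_integrable:
  assumes f: "L2_bdry n \<Gamma> f" and g: "L2_bdry n \<Gamma> g" and j: "j < n"
  shows "integrable lborel (dens \<Gamma> \<phi> f g j)"
proof -
  obtain W where W: "\<And>t. t \<in> {0..1} \<Longrightarrow> arc_weight j t \<le> W" using arc_weight_bound[OF j] by blast
  show ?thesis
  proof (rule Bochner_Integration.integrable_bound)
    show "integrable lborel (\<lambda>t. W * (indicator {0..1} t *\<^sub>R (cmod (f (\<Gamma> j t)))\<^sup>2) + W * (indicator {0..1} t *\<^sub>R (cmod (g (\<Gamma> j t)))\<^sup>2))"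
      using f g j unfolding L2_bdry_def set_integrable_def by (intro Bochner_Integration.integrable_add integrable_mult_right) auto
    show "dens \<Gamma> \<phi> f g j \<in> borel_measurable lborel" by (rule dens_measurable[OF f g j])
    have "norm (dens \<Gamma> \<phi> f g j t) \<le> W * (indicator {0..1} t *\<^sub>R (cmod (f (\<Gamma> j t)))\<^sup>2) + W * (indicator {0..1} t *\<^sub>R (cmod (g (\<Gamma> j t)))\<^sup>2)" for t
    proof (cases "t \<in> {0..1}")
      case True
      let ?x = "cmod (f (\<Gamma> j t))" and ?y = "cmod (g (\<Gamma> j t))"
      have "?x * ?y \<le> ?x\<^sup>2 + ?y\<^sup>2"
        using sum_squares_bound[of ?x ?y] mult_nonneg_nonneg[OF norm_ge_zero norm_ge_zero, of "f (\<Gamma> j t)" "g (\<Gamma> j t)"] by linarith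
      then have "arc_weight j t * (?x * ?y) \<le> W * (?x\<^sup>2 + ?y\<^sup>2)"
        using W[OF True] arc_weight_nonneg[OF j, of t] by (intro mult_mono) auto
      then show ?thesis using True by (simp add: norm_dens[OF j] distrib_left)
    qed (simp add: norm_dens[OF j])
    then show "AE t in lborel. norm (dens \<Gamma> \<phi> f g j t) \<le> norm (W * (indicator {0..1} t *\<^sub>R (cmod (f (\<Gamma> j t)))\<^sup>2) + W * (indicator {0..1} t *\<^sub>R (cmod (g (\<Gamma> j t)))\<^sup>2))"
      unfolding real_norm_def by (intro AE_I2 order_trans[OF _ abs_ge_self])
  qed
qed

lemma L2_bdry_diff:
  assumes f: "L2_bdry n \<Gamma> f" and g: "L2_bdry n \<Gamma> g"
  shows "L2_bdry n \<Gamma> (\<lambda>\<zeta>. f \<zeta> - g \<zeta>)"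
  unfolding L2_bdry_def
proof (intro allI impI conjI)
  fix j assume j: "j < n"
  have mf: "(\<lambda>t. indicator {0..1} t *\<^sub>R f (\<Gamma> j t)) \<in> borel_measurable lborel"
    "(\<lambda>t. indicator {0..1} t *\<^sub>R g (\<Gamma> j t)) \<in> borel_measurable lborel"
    using f g j by (auto simp: L2_bdry_def set_borel_measurable_def)
  have m: "(\<lambda>t. indicator {0..1} t *\<^sub>R (f (\<Gamma> j t) - g (\<Gamma> j t))) \<in> borel_measurable lborel"
    using borel_measurable_diff[OF mf] by (simp only: scaleR_right_diff_distrib)
  then show "set_borel_measurable lborel {0..1} (\<lambda>t. f (\<Gamma> j t) - g (\<Gamma> j t))"
    by (simp add: set_borel_measurable_def)
  have eq: "indicator {0..1} t *\<^sub>R (cmod (f (\<Gamma> j t) - g (\<Gamma> j t)))\<^sup>2 = (norm (indicator {0..1} t *\<^sub>R (f (\<Gamma> j t) - g (\<Gamma> j t))))\<^sup>2" for t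
    by (cases "t \<in> {0..1}") auto
  show "set_integrable lborel {0..1} (\<lambda>t. (cmod (f (\<Gamma> j t) - g (\<Gamma> j t)))\<^sup>2)"
    unfolding set_integrable_def
  proof (rule Bochner_Integration.integrable_bound)
    show "integrable lborel (\<lambda>t. 2 * (indicator {0..1} t *\<^sub>R (cmod (f (\<Gamma> j t)))\<^sup>2) + 2 * (indicator {0..1} t *\<^sub>R (cmod (g (\<Gamma> j t)))\<^sup>2))"
      using f g j unfolding L2_bdry_def set_integrable_def by (intro Bochner_Integration.integrable_add integrable_mult_right) auto
    show "(\<lambda>t. indicator {0..1} t *\<^sub>R (cmod (f (\<Gamma> j t) - g (\<Gamma> j t)))\<^sup>2) \<in> borel_measurable lborel"
      unfolding eq using m by measurable
    have "(cmod (f (\<Gamma> j t) - g (\<Gamma> j t)))\<^sup>2 \<le> 2 * (cmod (f (\<Gamma> j t)))\<^sup>2 + 2 * (cmod (g (\<Gamma> j t)))\<^sup>2" for t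
    proof -
      let ?x = "cmod (f (\<Gamma> j t))" and ?y = "cmod (g (\<Gamma> j t))"
      have "(cmod (f (\<Gamma> j t) - g (\<Gamma> j t)))\<^sup>2 \<le> (?x + ?y)\<^sup>2" by (intro power_mono norm_triangle_ineq4) auto
      also have "\<dots> \<le> 2 * ?x\<^sup>2 + 2 * ?y\<^sup>2" using sum_squares_bound[of ?x ?y] by (simp add: power2_sum)
      finally show ?thesis .
    qed
    then show "AE t in lborel. norm (indicator {0..1} t *\<^sub>R (cmod (f (\<Gamma> j t) - g (\<Gamma> j t)))\<^sup>2) \<le>
       norm (2 * (indicator {0..1} t *\<^sub>R (cmod (f (\<Gamma> j t)))\<^sup>2) + 2 * (indicator {0..1} t *\<^sub>R (cmod (g (\<Gamma> j t)))\<^sup>2))"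
      by (intro AE_I2) (auto simp: indicator_def)
  qed
qed

lemma L2_bdry_continuous:
  assumes "continuous_on (frontier \<Omega>) h"
  shows "L2_bdry n \<Gamma> h"
  unfolding L2_bdry_def
proof (intro allI impI conjI)
  fix j assume j: "j < n"
  have c: "continuous_on {0..1} (\<lambda>t. h (\<Gamma> j t))"
    using curve_continuous[OF j] curve_in_frontier[OF j]
    by (intro continuous_on_compose2[OF assms]) (auto intro: continuous_on_subset)
  then have "(\<lambda>t. indicator {0..1} t *\<^sub>R h (\<Gamma> j t)) \<in> borel_measurable borel"
    by (intro borel_measurable_continuous_on_indicator) auto
  then show "set_borel_measurable lborel {0..1} (\<lambda>t. h (\<Gamma> j t))"
    by (simp add: set_borel_measurable_def)
  show "set_integrable lborel {0..1} (\<lambda>t. (cmod (h (\<Gamma> j t)))\<^sup>2)"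
    unfolding set_integrable_def by (intro borel_integrable_compact continuous_intros c) auto
qed

lemma L2_bdry_smooth: "smooth_up_to_boundary \<Omega> h \<Longrightarrow> L2_bdry n \<Gamma> h"
  unfolding smooth_up_to_boundary_def using closure_domain
  by (intro L2_bdry_continuous) (auto intro: continuous_on_subset)

lemma hardy_ext_smooth:
  assumes "smooth_up_to_boundary \<Omega> h"
  shows "hardy_ext \<Omega> n \<Gamma> \<phi> h h"
proof -
  have "wnorm2 n \<Gamma> \<phi> (\<lambda>\<zeta>. h \<zeta> - h \<zeta>) = 0" by (simp add: wnorm2_def winner_eq_dens dens_def)
  then show ?thesis unfolding hardy_ext_def using assms L2_bdry_smooth
    by (intro conjI exI[of _ "\<lambda>_. h"]) auto
qed

text \<open>The L1 mass of the density. It bounds the pairing and, divided by the distance to the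
  boundary, the Cauchy transform.\<close>

definition dens_norm :: "(complex \<Rightarrow> complex) \<Rightarrow> (complex \<Rightarrow> complex) \<Rightarrow> real" where
  "dens_norm f g = (\<Sum>j<n. \<integral>t. norm (dens \<Gamma> \<phi> f g j t) \<partial>lborel)"

lemma wnorm2_eq_dens_norm: "wnorm2 n \<Gamma> \<phi> f = dens_norm f f"
proof -
  have "(\<integral>t. dens \<Gamma> \<phi> f f j t \<partial>lborel) = of_real (\<integral>t. norm (dens \<Gamma> \<phi> f f j t) \<partial>lborel)" if j: "j < n" for j
  proof -
    have "dens \<Gamma> \<phi> f f j t = of_real (norm (dens \<Gamma> \<phi> f f j t))" for t
    proof -
      have "f (\<Gamma> j t) * cnj (f (\<Gamma> j t)) = of_real (cmod (f (\<Gamma> j t)) * cmod (f (\<Gamma> j t)))"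
        using complex_norm_square[of "f (\<Gamma> j t)"] by (simp add: power2_eq_square)
      then show ?thesis
        unfolding norm_dens[OF j] by (cases "t \<in> {0..1}") (simp_all add: dens_eq mult.assoc)
    qed
    then show ?thesis by (metis (no_types, lifting) Bochner_Integration.integral_cong integral_complex_of_real)
  qed
  then have "winner n \<Gamma> \<phi> f f = of_real (dens_norm f f)" by (simp add: winner_eq_dens dens_norm_def)
  then show ?thesis by (simp add: wnorm2_def)
qed

lemma dens_norm_nonneg: "dens_norm f g \<ge> 0"
  unfolding dens_norm_def by (intro sum_nonneg) auto

lemma norm_winner_le: "cmod (winner n \<Gamma> \<phi> f g) \<le> dens_norm f g"
  unfolding winner_eq_dens dens_norm_def by (intro order_trans[OF norm_sum] sum_mono integral_norm_bound)

text \<open>Cauchy-Schwarz in additive form: integrating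
  \<open>0 \<le> (x - e * y)\<^sup>2 / (2 * e)\<close> avoids square roots and leaves
  \<open>e\<close> free to be tuned.\<close>

lemma dens_norm_AM_GM:
  assumes f: "L2_bdry n \<Gamma> f" and g: "L2_bdry n \<Gamma> g" and e: "e > 0"
  shows "dens_norm f g \<le> dens_norm f f / (2 * e) + e / 2 * dens_norm g g"
proof -
  have ineq: "norm (dens \<Gamma> \<phi> f g j t) \<le> norm (dens \<Gamma> \<phi> f f j t) / (2 * e) + e / 2 * norm (dens \<Gamma> \<phi> g g j t)"
    if j: "j < n" for j t
  proof -
    let ?x = "cmod (f (\<Gamma> j t))" and ?y = "cmod (g (\<Gamma> j t))"
    have "0 \<le> (?x - e * ?y)\<^sup>2 / (2 * e)" using e by simp
    also have "\<dots> = ?x * ?x / (2 * e) + e / 2 * (?y * ?y) - ?x * ?y"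
      using e by (simp add: power2_eq_square field_simps)
    finally have "?x * ?y \<le> ?x * ?x / (2 * e) + e / 2 * (?y * ?y)" by simp
    then have "arc_weight j t * indicator {0..1} t * (?x * ?y) \<le> arc_weight j t * indicator {0..1} t * (?x * ?x / (2 * e) + e / 2 * (?y * ?y))"
      using arc_weight_nonneg[OF j, of t] by (intro mult_left_mono) auto
    then show ?thesis unfolding norm_dens[OF j] by (simp add: distrib_left mult_ac)
  qed
  have "dens_norm f g \<le> (\<Sum>j<n. \<integral>t. norm (dens \<Gamma> \<phi> f f j t) / (2 * e) + e / 2 * norm (dens \<Gamma> \<phi> g g j t) \<partial>lborel)"
    unfolding dens_norm_def
  proof (rule sum_mono)
    fix j assume "j \<in> {..<n}"
    then have j: "j < n" by simp
    show "(\<integral>t. norm (dens \<Gamma> \<phi> f g j t) \<partial>lborel) \<le> (\<integral>t. norm (dens \<Gamma> \<phi> f f j t) / (2 * e) + e / 2 * norm (dens \<Gamma> \<phi> g g j t) \<partial>lborel)"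
      using dens_integrable[OF f g j] dens_integrable[OF f f j] dens_integrable[OF g g j] ineq[OF j]
      by (intro integral_mono) auto
  qed
  also have "\<dots> = dens_norm f f / (2 * e) + e / 2 * dens_norm g g"
  proof -
    have "(\<integral>t. norm (dens \<Gamma> \<phi> f f j t) / (2 * e) + e / 2 * norm (dens \<Gamma> \<phi> g g j t) \<partial>lborel)
       = (\<integral>t. norm (dens \<Gamma> \<phi> f f j t) \<partial>lborel) / (2 * e) + e / 2 * (\<integral>t. norm (dens \<Gamma> \<phi> g g j t) \<partial>lborel)" if j: "j < n" for j
      using dens_integrable[OF f f j] dens_integrable[OF g g j] by simp
    then show ?thesis by (simp add: dens_norm_def sum.distrib sum_divide_distrib sum_distrib_left)
  qed
  finally show ?thesis .
qed

lemma dens_norm_tendsto_0: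
  assumes f: "\<And>k. L2_bdry n \<Gamma> (f k)" and g: "L2_bdry n \<Gamma> g"
    and lim: "(\<lambda>k. dens_norm (f k) (f k)) \<longlonglongrightarrow> 0"
  shows "(\<lambda>k. dens_norm (f k) g) \<longlonglongrightarrow> 0"
proof (rule LIMSEQ_I)
  fix r :: real assume r: "r > 0"
  \<comment> \<open>The summand 1 keeps \<open>B\<close> positive when \<open>g\<close> has norm 0.
    With \<open>e = r / B\<close> each of the two terms of the estimate is at most
    \<open>r / 2\<close>.\<close>
  define B where "B = dens_norm g g + 1"
  have B: "B > 0" "dens_norm g g \<le> B" using dens_norm_nonneg[of g g] by (auto simp: B_def)
  define e where "e = r / B"
  have e: "e > 0" using r B by (simp add: e_def)
  have "\<forall>\<^sub>F k in sequentially. dens_norm (f k) (f k) < r * e"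
    using order_tendstoD(2)[OF lim, of "r * e"] r e by simp
  then obtain N where N: "\<And>k. k \<ge> N \<Longrightarrow> dens_norm (f k) (f k) < r * e" by (auto simp: eventually_sequentially)
  have "norm (dens_norm (f k) g - 0) < r" if "k \<ge> N" for k
  proof -
    have "dens_norm (f k) g \<le> dens_norm (f k) (f k) / (2 * e) + e / 2 * dens_norm g g"
      by (rule dens_norm_AM_GM[OF f g e])
    also have "dens_norm (f k) (f k) / (2 * e) < r / 2" using N[OF that] e by (simp add: field_simps)
    also have "e / 2 * dens_norm g g \<le> e / 2 * B" using B e by (intro mult_left_mono) auto
    also have "e / 2 * B = r / 2" using B by (simp add: e_def)
    finally show ?thesis using dens_norm_nonneg[of "f k" g] by simp
  qed
  then show "\<exists>N. \<forall>k\<ge>N. norm (dens_norm (f k) g - 0) < r" by blast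
qed

section \<open>Cauchy transforms off the boundary\<close>

lemma dens_div_integrable:
  assumes f: "L2_bdry n \<Gamma> f" and g: "L2_bdry n \<Gamma> g" and j: "j < n" and \<xi>: "\<xi> \<notin> frontier \<Omega>"
  shows "integrable lborel (\<lambda>t. dens \<Gamma> \<phi> f g j t / (\<Gamma> j t - \<xi>))"
proof -
  obtain d where d: "d > 0" "ball \<xi> d \<subseteq> - frontier \<Omega>"
    using \<xi> frontier_closed[of \<Omega>] open_contains_ball[of "- frontier \<Omega>"] by blast
  have far: "d \<le> cmod (\<Gamma> j t - \<xi>)" for t
    using d(2) curve_in_frontier[OF j, of t] by (force simp: dist_norm norm_minus_commute subset_iff)
  have gm: "\<Gamma> j \<in> borel_measurable lborel" using borel_measurable_continuous_onI[OF curve_continuous[OF j]] by simp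
  show ?thesis
  proof (rule Bochner_Integration.integrable_bound)
    show "integrable lborel (\<lambda>t. norm (dens \<Gamma> \<phi> f g j t) / d)" using dens_integrable[OF f g j] by simp
    show "(\<lambda>t. dens \<Gamma> \<phi> f g j t / (\<Gamma> j t - \<xi>)) \<in> borel_measurable lborel"
      by (intro borel_measurable_divide borel_measurable_diff dens_measurable[OF f g j] gm) simp
    have "norm (dens \<Gamma> \<phi> f g j t / (\<Gamma> j t - \<xi>)) \<le> norm (dens \<Gamma> \<phi> f g j t) / d" for t
      unfolding norm_divide using far[of t] d(1) by (intro frac_le) auto
    then show "AE t in lborel. norm (dens \<Gamma> \<phi> f g j t / (\<Gamma> j t - \<xi>)) \<le> norm (norm (dens \<Gamma> \<phi> f g j t) / d)"
      unfolding real_norm_def by (intro AE_I2 order_trans[OF _ abs_ge_self])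
  qed
qed

lemma cauchy_transform_holomorphic:
  assumes f: "L2_bdry n \<Gamma> f" and g: "L2_bdry n \<Gamma> g"
  shows "cauchy_transform n \<Gamma> \<phi> f g holomorphic_on - frontier \<Omega>"
proof -
  have "cauchy_transform n \<Gamma> \<phi> f g field_differentiable at \<xi>" if \<xi>: "\<xi> \<notin> frontier \<Omega>" for \<xi>
  proof -
    obtain d where d: "d > 0" "ball \<xi> d \<subseteq> - frontier \<Omega>"
      using \<xi> frontier_closed[of \<Omega>] open_contains_ball[of "- frontier \<Omega>"] by blast
    \<comment> \<open>The smaller disc keeps distance \<open>d / 2\<close> from the boundary, which
      bounds the kernel uniformly in \<open>z\<close>.\<close>
    have far: "d / 2 \<le> cmod (\<Gamma> j t - z)" if "j < n" "z \<in> ball \<xi> (d / 2)" for j t z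
    proof -
      have "d \<le> dist \<xi> (\<Gamma> j t)" using d(2) curve_in_frontier[OF that(1), of t] by (force simp: subset_iff)
      then show ?thesis using that(2) dist_triangle[of \<xi> "\<Gamma> j t" z] by (simp add: dist_norm norm_minus_commute)
    qed
    have nz: "\<Gamma> j t - z \<noteq> 0" if "j < n" "z \<in> ball \<xi> (d / 2)" for j t z
      using far[OF that, of t] d(1) by auto
    have "(\<lambda>z. \<integral>t. dens \<Gamma> \<phi> f g j t / (\<Gamma> j t - z) \<partial>lborel) holomorphic_on ball \<xi> (d / 2)" if j: "j < n" for j
    proof (rule holomorphic_on_lebesgue_integral)
      show "(\<lambda>z. dens \<Gamma> \<phi> f g j t / (\<Gamma> j t - z)) holomorphic_on ball \<xi> (d / 2)" for t
        using nz[OF j] by (intro holomorphic_intros) auto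
      show "(\<lambda>t. dens \<Gamma> \<phi> f g j t / (\<Gamma> j t - z)) \<in> borel_measurable lborel" if "z \<in> ball \<xi> (d / 2)" for z
      proof -
        have "z \<notin> frontier \<Omega>" using that d by (auto simp: subset_iff)
        then show ?thesis by (rule borel_measurable_integrable[OF dens_div_integrable[OF f g j]])
      qed
      show "integrable lborel (\<lambda>t. norm (dens \<Gamma> \<phi> f g j t) / (d / 2))" using dens_integrable[OF f g j] by simp
      show "norm (dens \<Gamma> \<phi> f g j t / (\<Gamma> j t - z)) \<le> norm (dens \<Gamma> \<phi> f g j t) / (d / 2)" if "z \<in> ball \<xi> (d / 2)" for z t
        unfolding norm_divide using far[OF j that, of t] d(1) by (intro frac_le) auto
    qed simp
    then have "cauchy_transform n \<Gamma> \<phi> f g holomorphic_on ball \<xi> (d / 2)"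
      unfolding cauchy_transform_def by (intro holomorphic_intros) auto
    then show ?thesis using d(1) by (intro holomorphic_on_imp_differentiable_at[OF _ open_ball]) auto
  qed
  then show ?thesis unfolding holomorphic_on_def using field_differentiable_at_within by blast
qed

text \<open>The difference is the Cauchy transform for \<open>h - f\<close>, and the kernel is at
  most \<open>1 / d\<close>. This converts convergence in mass into convergence of the transforms,
  uniformly where \<open>d\<close> is uniform.\<close>

lemma cauchy_transform_diff_le:
  assumes f: "L2_bdry n \<Gamma> f" and h: "L2_bdry n \<Gamma> h" and g: "L2_bdry n \<Gamma> g"
    and d: "d > 0" "\<And>p. p \<in> frontier \<Omega> \<Longrightarrow> d \<le> dist \<xi> p"
  shows "cmod (cauchy_transform n \<Gamma> \<phi> h g \<xi> - cauchy_transform n \<Gamma> \<phi> f g \<xi>) \<le> dens_norm (\<lambda>\<zeta>. h \<zeta> - f \<zeta>) g / d"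
proof -
  have \<xi>: "\<xi> \<notin> frontier \<Omega>" using d by force
  note hf = L2_bdry_diff[OF h f]
  have "cauchy_transform n \<Gamma> \<phi> h g \<xi> - cauchy_transform n \<Gamma> \<phi> f g \<xi>
     = (\<Sum>j<n. \<integral>t. dens \<Gamma> \<phi> (\<lambda>\<zeta>. h \<zeta> - f \<zeta>) g j t / (\<Gamma> j t - \<xi>) \<partial>lborel)"
    unfolding cauchy_transform_def sum_subtractf[symmetric]
  proof (intro sum.cong refl)
    fix j assume "j \<in> {..<n}"
    then have j: "j < n" by simp
    have "(\<lambda>t. dens \<Gamma> \<phi> (\<lambda>\<zeta>. h \<zeta> - f \<zeta>) g j t / (\<Gamma> j t - \<xi>)) =
       (\<lambda>t. dens \<Gamma> \<phi> h g j t / (\<Gamma> j t - \<xi>) - dens \<Gamma> \<phi> f g j t / (\<Gamma> j t - \<xi>))"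
      by (simp add: dens_def diff_divide_distrib[symmetric] algebra_simps)
    then show "(\<integral>t. dens \<Gamma> \<phi> h g j t / (\<Gamma> j t - \<xi>) \<partial>lborel) - (\<integral>t. dens \<Gamma> \<phi> f g j t / (\<Gamma> j t - \<xi>) \<partial>lborel)
       = (\<integral>t. dens \<Gamma> \<phi> (\<lambda>\<zeta>. h \<zeta> - f \<zeta>) g j t / (\<Gamma> j t - \<xi>) \<partial>lborel)"
      using dens_div_integrable[OF h g j \<xi>] dens_div_integrable[OF f g j \<xi>] by simp
  qed
  also have "cmod \<dots> \<le> (\<Sum>j<n. (\<integral>t. norm (dens \<Gamma> \<phi> (\<lambda>\<zeta>. h \<zeta> - f \<zeta>) g j t) \<partial>lborel) / d)"
  proof (intro order_trans[OF norm_sum] sum_mono)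
    fix j assume "j \<in> {..<n}"
    then have j: "j < n" by simp
    have far: "d \<le> cmod (\<Gamma> j t - \<xi>)" for t
      using d(2)[OF curve_in_frontier[OF j, of t]] by (simp add: dist_norm norm_minus_commute)
    have "cmod (\<integral>t. dens \<Gamma> \<phi> (\<lambda>\<zeta>. h \<zeta> - f \<zeta>) g j t / (\<Gamma> j t - \<xi>) \<partial>lborel)
       \<le> (\<integral>t. norm (dens \<Gamma> \<phi> (\<lambda>\<zeta>. h \<zeta> - f \<zeta>) g j t / (\<Gamma> j t - \<xi>)) \<partial>lborel)" by (rule integral_norm_bound)
    also have "\<dots> \<le> (\<integral>t. norm (dens \<Gamma> \<phi> (\<lambda>\<zeta>. h \<zeta> - f \<zeta>) g j t) / d \<partial>lborel)"
    proof (rule integral_mono)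
      show "norm (dens \<Gamma> \<phi> (\<lambda>\<zeta>. h \<zeta> - f \<zeta>) g j t / (\<Gamma> j t - \<xi>)) \<le> norm (dens \<Gamma> \<phi> (\<lambda>\<zeta>. h \<zeta> - f \<zeta>) g j t) / d" for t
        unfolding norm_divide using far[of t] d(1) by (intro frac_le) auto
    qed (use dens_div_integrable[OF hf g j \<xi>] dens_integrable[OF hf g j] in auto)
    finally show "cmod (\<integral>t. dens \<Gamma> \<phi> (\<lambda>\<zeta>. h \<zeta> - f \<zeta>) g j t / (\<Gamma> j t - \<xi>) \<partial>lborel)
       \<le> (\<integral>t. norm (dens \<Gamma> \<phi> (\<lambda>\<zeta>. h \<zeta> - f \<zeta>) g j t) \<partial>lborel) / d" by simp
  qed
  finally show ?thesis by (simp add: dens_norm_def sum_divide_distrib)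
qed

end

subsection \<open>The kernel and its conjugate companion\<close>

lemma holomorphic_eventually_nonzero:
  assumes "f holomorphic_on S" "open S" "connected S" "b \<in> S" "f b \<noteq> 0" "x \<in> S"
  shows "eventually (\<lambda>z. f z \<noteq> 0) (at x)"
proof (cases "f x = 0")
  case True
  obtain r where r: "0 < r" "ball x r \<subseteq> S" "\<And>z. z \<in> ball x r - {x} \<Longrightarrow> f z \<noteq> 0"
    using isolated_zeros[OF assms(1,2,3,6) True assms(4,5)] by blast
  then show ?thesis
    by (auto simp: eventually_at intro!: exI[of _ r] simp: dist_commute)
next
  case False
  have "isCont f x" using assms holomorphic_on_imp_continuous_on continuous_on_eq_continuous_at by blast
  then show ?thesis using False by (simp add: continuous_within tendsto_imp_eventually_ne)
qed

text \<open>The kernel definition only asserts that some family of boundary functions exists. The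
  locale fixes one, so \<open>\<sigma>\<close> is used inside the domain and \<open>K\<close> on its
  boundary.\<close>

locale weighted_szego = weighted_domain +
  fixes \<sigma> K :: "complex \<Rightarrow> complex \<Rightarrow> complex"
  assumes hardy_K: "w \<in> \<Omega> \<Longrightarrow> hardy_ext \<Omega> n \<Gamma> \<phi> (K w) (\<lambda>z. \<sigma> z w)"
    and reproducing: "hardy_ext \<Omega> n \<Gamma> \<phi> f F \<Longrightarrow> w \<in> \<Omega> \<Longrightarrow> F w = winner n \<Gamma> \<phi> f (K w)"
begin

abbreviation CT where "CT \<equiv> cauchy_transform n \<Gamma> \<phi>"

lemma L2_K: "w \<in> \<Omega> \<Longrightarrow> L2_bdry n \<Gamma> (K w)"
  using hardy_K unfolding hardy_ext_def by blast

lemma reproducing_smooth: "smooth_up_to_boundary \<Omega> h \<Longrightarrow> b \<in> \<Omega> \<Longrightarrow> h b = winner n \<Gamma> \<phi> h (K b)"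
  using reproducing[OF hardy_ext_smooth] by blast

lemma smooth_const: "smooth_up_to_boundary \<Omega> (\<lambda>_. c)"
  unfolding smooth_up_to_boundary_def
  by (intro conjI allI holomorphic_intros continuous_intros, rule_tac x = "\<lambda>_. if k = 0 then c else 0" in exI)
    (auto simp: higher_deriv_const)

lemma dens_mult_left: "dens \<Gamma> \<phi> (\<lambda>\<zeta>. f \<zeta> * c \<zeta>) g j t = dens \<Gamma> \<phi> f g j t * c (\<Gamma> j t)"
  by (simp add: dens_def)

lemma cauchy_transform_smooth_outside:
  assumes h: "smooth_up_to_boundary \<Omega> h" and b: "b \<in> \<Omega>" and \<xi>: "\<xi> \<notin> closure \<Omega>"
  shows "(b - \<xi>) * CT h (K b) \<xi> = h b"
proof -
  have "smooth_up_to_boundary \<Omega> (\<lambda>z. h z * (1 / (z - \<xi>)))"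
  proof (rule smooth_up_to_boundary_mult[OF h open_domain])
    show "(\<lambda>z. 1 / (z - \<xi>)) holomorphic_on - {\<xi>}" by (intro holomorphic_intros) auto
  qed (use \<xi> in auto)
  from reproducing_smooth[OF this b] have "h b * (1 / (b - \<xi>)) = CT h (K b) \<xi>"
    unfolding winner_eq_dens cauchy_transform_def dens_mult_left by simp
  moreover have "b \<noteq> \<xi>" using b \<xi> closure_subset by blast
  ultimately show ?thesis by (simp add: field_simps)
qed

text \<open>\<open>P b\<close> is \<open>b - \<xi>\<close> times the companion \<open>\<Lambda>\<^sub>b\<close>; the factor removes the pole at \<open>b\<close>.\<close>

definition P :: "complex \<Rightarrow> complex \<Rightarrow> complex" where
  "P b \<xi> = (b - \<xi>) * CT (\<lambda>_. 1) (K b) \<xi> - 1"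

lemma cauchy_transform_smooth_inside:
  assumes h: "smooth_up_to_boundary \<Omega> h" and b: "b \<in> \<Omega>" and \<xi>: "\<xi> \<in> \<Omega>"
  shows "(b - \<xi>) * CT h (K b) \<xi> - h b = h \<xi> * P b \<xi>"
\<comment> \<open>At \<open>\<xi> = b\<close> both sides are \<open>- h b\<close> because
  \<open>P b b = - 1\<close>; elsewhere \<open>b - \<xi>\<close> may be divided out.\<close>
proof (cases "b = \<xi>")
  case True
  then show ?thesis by (simp add: P_def)
next
  case False
  let ?q = "\<lambda>z. if z = \<xi> then deriv h \<xi> else (h z - h \<xi>) / (z - \<xi>)"
  have \<xi>f: "\<xi> \<notin> frontier \<Omega>" using \<xi> frontier_disjoint_domain by blast
  note L2 = L2_bdry_smooth[OF h] L2_bdry_smooth[OF smooth_const[of 1]]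
  have "winner n \<Gamma> \<phi> ?q (K b) = CT h (K b) \<xi> - h \<xi> * CT (\<lambda>_. 1) (K b) \<xi>"
    unfolding winner_eq_dens cauchy_transform_def sum_distrib_left sum_subtractf[symmetric]
  proof (intro sum.cong refl)
    fix j assume "j \<in> {..<n}"
    then have j: "j < n" by simp
    have ne: "\<Gamma> j t \<noteq> \<xi>" for t using curve_in_frontier[OF j, of t] \<xi>f by auto
    have "dens \<Gamma> \<phi> ?q (K b) j t = dens \<Gamma> \<phi> h (K b) j t / (\<Gamma> j t - \<xi>) - h \<xi> * (dens \<Gamma> \<phi> (\<lambda>_. 1) (K b) j t / (\<Gamma> j t - \<xi>))" for t
      using ne[of t] by (cases "t \<in> {0..1}") (simp_all add: dens_def diff_divide_distrib[symmetric] algebra_simps)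
    then show "(\<integral>t. dens \<Gamma> \<phi> ?q (K b) j t \<partial>lborel) = (\<integral>t. dens \<Gamma> \<phi> h (K b) j t / (\<Gamma> j t - \<xi>) \<partial>lborel)
       - h \<xi> * (\<integral>t. dens \<Gamma> \<phi> (\<lambda>_. 1) (K b) j t / (\<Gamma> j t - \<xi>) \<partial>lborel)"
      by (simp only: Bochner_Integration.integral_diff[OF dens_div_integrable[OF L2(1) L2_K[OF b] j \<xi>f]
            integrable_mult_right[OF dens_div_integrable[OF L2(2) L2_K[OF b] j \<xi>f]]] integral_mult_right_zero)
  qed
  moreover have "winner n \<Gamma> \<phi> ?q (K b) = (h b - h \<xi>) / (b - \<xi>)"
    using reproducing_smooth[OF smooth_up_to_boundary_diff_quotient[OF h open_domain \<xi>] b] False by simp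
  ultimately have e: "CT h (K b) \<xi> - h \<xi> * CT (\<lambda>_. 1) (K b) \<xi> = (h b - h \<xi>) / (b - \<xi>)"
    by (rule trans[OF sym])
  have "(b - \<xi>) * (CT h (K b) \<xi> - h \<xi> * CT (\<lambda>_. 1) (K b) \<xi>) = h b - h \<xi>"
    unfolding e using False by simp
  then show ?thesis by (simp add: P_def algebra_simps)
qed

text \<open>One sequence chosen for \<open>w\<close> serves every \<open>b\<close>: convergence in
  norm controls the mass against each fixed \<open>K b\<close>.\<close>

lemma approximants:
  assumes "w \<in> \<Omega>"
  shows "\<exists>h. (\<forall>k. smooth_up_to_boundary \<Omega> (h k)) \<and>
    (\<forall>b\<in>\<Omega>. (\<lambda>k. dens_norm (\<lambda>\<zeta>. h k \<zeta> - K w \<zeta>) (K b)) \<longlonglongrightarrow> 0) \<and>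
    (\<forall>z\<in>\<Omega>. (\<lambda>k. h k z) \<longlonglongrightarrow> \<sigma> z w)"
proof -
  obtain h :: "nat \<Rightarrow> complex \<Rightarrow> complex" where h: "\<forall>k. smooth_up_to_boundary \<Omega> (h k)"
    "(\<lambda>k. wnorm2 n \<Gamma> \<phi> (\<lambda>\<zeta>. h k \<zeta> - K w \<zeta>)) \<longlonglongrightarrow> 0" "\<forall>z\<in>\<Omega>. (\<lambda>k. h k z) \<longlonglongrightarrow> \<sigma> z w"
    using hardy_K[OF assms] unfolding hardy_ext_def by blast
  have "L2_bdry n \<Gamma> (\<lambda>\<zeta>. h k \<zeta> - K w \<zeta>)" for k
    using L2_bdry_diff[OF L2_bdry_smooth L2_K[OF assms]] h(1) by blast
  then have "(\<lambda>k. dens_norm (\<lambda>\<zeta>. h k \<zeta> - K w \<zeta>) (K b)) \<longlonglongrightarrow> 0" if "b \<in> \<Omega>" for b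
    using dens_norm_tendsto_0[OF _ L2_K[OF that], of "\<lambda>k \<zeta>. h k \<zeta> - K w \<zeta>"] h(2) by (simp add: wnorm2_eq_dens_norm)
  then show ?thesis using h by (intro exI[of _ h]) auto
qed

text \<open>\<open>b - \<xi>\<close> times \<open>F\<^sub>w\<^sub>b\<close>, so that there is no
  pole at \<open>b\<close>.\<close>

definition N :: "complex \<Rightarrow> complex \<Rightarrow> complex \<Rightarrow> complex" where
  "N w b \<xi> = (b - \<xi>) * CT (K w) (K b) \<xi> - \<sigma> b w"

lemma cauchy_transform_approximants:
  assumes w: "w \<in> \<Omega>" and b: "b \<in> \<Omega>" and h: "\<And>k. smooth_up_to_boundary \<Omega> (h k)"
    and lim: "(\<lambda>k. dens_norm (\<lambda>\<zeta>. h k \<zeta> - K w \<zeta>) (K b)) \<longlonglongrightarrow> 0"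
    and \<xi>: "\<xi> \<notin> frontier \<Omega>"
  shows "(\<lambda>k. CT (h k) (K b) \<xi>) \<longlonglongrightarrow> CT (K w) (K b) \<xi>"
proof -
  obtain d where d: "d > 0" "ball \<xi> d \<subseteq> - frontier \<Omega>"
    using \<xi> frontier_closed[of \<Omega>] open_contains_ball[of "- frontier \<Omega>"] by blast
  have far: "d \<le> dist \<xi> p" if "p \<in> frontier \<Omega>" for p
    using d(2) that by (force simp: subset_iff)
  have "(\<lambda>k. CT (h k) (K b) \<xi> - CT (K w) (K b) \<xi>) \<longlonglongrightarrow> 0"
  proof (rule Lim_null_comparison[OF always_eventually])
    show "\<forall>k. cmod (CT (h k) (K b) \<xi> - CT (K w) (K b) \<xi>) \<le> dens_norm (\<lambda>\<zeta>. h k \<zeta> - K w \<zeta>) (K b) / d"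
      using cauchy_transform_diff_le[OF L2_K[OF w] L2_bdry_smooth[OF h] L2_K[OF b] d(1) far] by blast
    show "(\<lambda>k. dens_norm (\<lambda>\<zeta>. h k \<zeta> - K w \<zeta>) (K b) / d) \<longlonglongrightarrow> 0"
      using tendsto_divide[OF lim tendsto_const[of d]] d(1) by simp
  qed
  then show ?thesis by (simp add: LIM_zero_iff)
qed

lemma N_outside:
  assumes w: "w \<in> \<Omega>" and b: "b \<in> \<Omega>" and \<xi>: "\<xi> \<notin> closure \<Omega>"
  shows "N w b \<xi> = 0"
proof -
  from approximants[OF w] obtain h where
    h: "\<And>k. smooth_up_to_boundary \<Omega> (h k)"
    "\<And>b. b \<in> \<Omega> \<Longrightarrow> (\<lambda>k. dens_norm (\<lambda>\<zeta>. h k \<zeta> - K w \<zeta>) (K b)) \<longlonglongrightarrow> 0" "\<And>z. z \<in> \<Omega> \<Longrightarrow> (\<lambda>k. h k z) \<longlonglongrightarrow> \<sigma> z w"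
    by auto
  have "\<xi> \<notin> frontier \<Omega>" using \<xi> closure_domain by blast
  note lim = cauchy_transform_approximants[OF w b h(1) h(2)[OF b] this]
  have "(\<lambda>k. (b - \<xi>) * CT (h k) (K b) \<xi> - h k b) \<longlonglongrightarrow> N w b \<xi>"
    unfolding N_def by (intro tendsto_intros lim h(3) b)
  then have "(\<lambda>k. 0) \<longlonglongrightarrow> N w b \<xi>"
    using cauchy_transform_smooth_outside[OF h(1) b \<xi>] by simp
  then show ?thesis using LIMSEQ_unique tendsto_const by blast
qed

lemma N_inside:
  assumes w: "w \<in> \<Omega>" and b: "b \<in> \<Omega>" and \<xi>: "\<xi> \<in> \<Omega>"
  shows "N w b \<xi> = \<sigma> \<xi> w * P b \<xi>"
proof -
  from approximants[OF w] obtain h where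
    h: "\<And>k. smooth_up_to_boundary \<Omega> (h k)"
    "\<And>b. b \<in> \<Omega> \<Longrightarrow> (\<lambda>k. dens_norm (\<lambda>\<zeta>. h k \<zeta> - K w \<zeta>) (K b)) \<longlonglongrightarrow> 0" "\<And>z. z \<in> \<Omega> \<Longrightarrow> (\<lambda>k. h k z) \<longlonglongrightarrow> \<sigma> z w"
    by auto
  have "\<xi> \<notin> frontier \<Omega>" using \<xi> frontier_disjoint_domain by blast
  note lim = cauchy_transform_approximants[OF w b h(1) h(2)[OF b] this]
  have "(\<lambda>k. (b - \<xi>) * CT (h k) (K b) \<xi> - h k b) \<longlonglongrightarrow> N w b \<xi>"
    unfolding N_def by (intro tendsto_intros lim h(3) b)
  then have "(\<lambda>k. h k \<xi> * P b \<xi>) \<longlonglongrightarrow> N w b \<xi>"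
    using cauchy_transform_smooth_inside[OF h(1) b \<xi>] by simp
  moreover have "(\<lambda>k. h k \<xi> * P b \<xi>) \<longlonglongrightarrow> \<sigma> \<xi> w * P b \<xi>"
    by (intro tendsto_intros h(3) \<xi>)
  ultimately show ?thesis by (rule LIMSEQ_unique)
qed

lemma CT_holomorphic_domain:
  assumes "L2_bdry n \<Gamma> f" "b \<in> \<Omega>"
  shows "CT f (K b) holomorphic_on \<Omega>"
  by (rule holomorphic_on_subset[OF cauchy_transform_holomorphic[OF assms(1) L2_K[OF assms(2)]]])
    (use frontier_disjoint_domain in blast)

lemma P_holomorphic: "b \<in> \<Omega> \<Longrightarrow> P b holomorphic_on \<Omega>"
  unfolding P_def using CT_holomorphic_domain[OF L2_bdry_smooth[OF smooth_const[of 1]]]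
  by (intro holomorphic_intros)

lemma N_holomorphic: "w \<in> \<Omega> \<Longrightarrow> b \<in> \<Omega> \<Longrightarrow> N w b holomorphic_on \<Omega>"
  unfolding N_def using CT_holomorphic_domain[OF L2_K[of w]] by (intro holomorphic_intros)

lemma P_eventually_nonzero:
  assumes "b \<in> \<Omega>" "x \<in> \<Omega>"
  shows "eventually (\<lambda>z. P b z \<noteq> 0) (at x)"
  by (rule holomorphic_eventually_nonzero[OF P_holomorphic[OF assms(1)] open_domain connected_domain assms(1) _ assms(2)])
    (simp add: P_def)

lemma kernel_conv: "z \<in> \<Omega> \<Longrightarrow> w \<in> \<Omega> \<Longrightarrow> \<sigma> z w = winner n \<Gamma> \<phi> (K w) (K z)"
  using reproducing[OF hardy_K] by blast

lemma kernel_sym: "z \<in> \<Omega> \<Longrightarrow> w \<in> \<Omega> \<Longrightarrow> \<sigma> z w = cnj (\<sigma> w z)"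
  using kernel_conv[of z w] kernel_conv[of w z] cnj_winner[of n \<Gamma> \<phi> "K z" "K w"] by simp

text \<open>Constants are smooth up to the boundary, so the value 1 at \<open>b\<close> is
  reproduced by pairing with \<open>K b\<close>; an element of norm zero could not do this.\<close>

lemma kernel_diag_nonzero:
  assumes b: "b \<in> \<Omega>"
  shows "\<sigma> b b \<noteq> 0"
proof
  assume "\<sigma> b b = 0"
  then have "wnorm2 n \<Gamma> \<phi> (K b) = 0" using kernel_conv[OF b b] by (simp add: wnorm2_def)
  then have z: "dens_norm (K b) (K b) = 0" by (simp add: wnorm2_eq_dens_norm)
  define D where "D = dens_norm (\<lambda>_. 1) (\<lambda>_. 1)"
  \<comment> \<open>The term with \<open>K b\<close> vanishes, and this \<open>e\<close> makes the
    remaining \<open>D / (2 * e)\<close> smaller than 1.\<close>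
  define e where "e = D + 1"
  have e: "e > 0" "D < e" using dens_norm_nonneg[of "\<lambda>_. 1" "\<lambda>_. 1"] by (auto simp: e_def D_def)
  have "1 = winner n \<Gamma> \<phi> (\<lambda>_. 1) (K b)" using reproducing_smooth[OF smooth_const b] .
  then have "1 \<le> dens_norm (\<lambda>_. 1) (K b)" using norm_winner_le[of "\<lambda>_. 1" "K b"] by (metis norm_one)
  also have "\<dots> \<le> D / (2 * e) + e / 2 * dens_norm (K b) (K b)"
    unfolding D_def by (rule dens_norm_AM_GM[OF L2_bdry_smooth[OF smooth_const] L2_K[OF b] e(1)])
  also have "\<dots> < 1" using z e by (simp add: divide_less_eq)
  finally show False by simp
qed

text \<open>The approximants converge uniformly on circles that avoid the zeros of \<open>P b\<close>, since
  \<open>h k * P b\<close> is a Cauchy transform; the maximum principle extends this to the discs.\<close>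

lemma kernel_holomorphic:
  assumes w: "w \<in> \<Omega>"
  shows "(\<lambda>z. \<sigma> z w) holomorphic_on \<Omega>"
proof -
  from approximants[OF w] obtain h where
    h: "\<And>k. smooth_up_to_boundary \<Omega> (h k)"
    "\<And>b. b \<in> \<Omega> \<Longrightarrow> (\<lambda>k. dens_norm (\<lambda>\<zeta>. h k \<zeta> - K w \<zeta>) (K b)) \<longlonglongrightarrow> 0" "\<And>z. z \<in> \<Omega> \<Longrightarrow> (\<lambda>k. h k z) \<longlonglongrightarrow> \<sigma> z w"
    by auto
  have hh: "h k holomorphic_on \<Omega>" for k using h(1) by (simp add: smooth_up_to_boundary_def)
  \<comment> \<open>A concrete base point: \<open>P b b = - 1\<close>, so the zeros of
    \<open>P b\<close> are isolated.\<close>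
  define b where "b = w"
  have b: "b \<in> \<Omega>" using w by (simp add: b_def)
  show ?thesis
  proof (rule holomorphic_uniform_sequence[OF open_domain hh])
    fix x assume x: "x \<in> \<Omega>"
    obtain r1 where r1: "r1 > 0" "cball x r1 \<subseteq> \<Omega>" using open_domain x open_contains_cball by metis
    obtain r2 where r2: "r2 > 0" "\<And>z. z \<noteq> x \<Longrightarrow> dist z x < r2 \<Longrightarrow> P b z \<noteq> 0"
      using P_eventually_nonzero[OF b x] unfolding eventually_at by auto
    \<comment> \<open>The punctured disc of radius \<open>r2\<close> is free of zeros of
      \<open>P b\<close>, and the circle of radius \<open>d\<close> lies in it.\<close>
    define d where "d = min r1 (r2 / 2)"
    have d: "d > 0" "d < r2" "d \<le> r1" using r1 r2 by (auto simp: d_def min_def)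
    have cb: "cball x d \<subseteq> \<Omega>" using r1(2) d(3) by (meson order_trans subset_cball)
    have sph: "sphere x d \<subseteq> \<Omega>" using cb sphere_cball by blast
    have nz: "P b z \<noteq> 0" if "z \<in> sphere x d" for z using r2(2)[of z] that d by (auto simp: dist_commute)
    have "\<exists>m>0. \<forall>z\<in>sphere x d. m \<le> cmod (P b z)"
    proof -
      have "continuous_on (sphere x d) (\<lambda>z. cmod (P b z))"
        using holomorphic_on_imp_continuous_on[OF P_holomorphic[OF b]] sph
        by (intro continuous_on_norm) (rule continuous_on_subset)
      moreover have "sphere x d \<noteq> {}" using d(1) by simp
      ultimately obtain z0 where "z0 \<in> sphere x d" "\<forall>z\<in>sphere x d. cmod (P b z0) \<le> cmod (P b z)"
        using continuous_attains_inf[OF compact_sphere] by blast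
      then show ?thesis using nz[of z0] by (intro exI[of _ "cmod (P b z0)"]) auto
    qed
    then obtain m where m: "m > 0" "\<And>z. z \<in> sphere x d \<Longrightarrow> m \<le> cmod (P b z)" by blast
    have "\<exists>\<delta>>0. \<forall>z\<in>sphere x d. \<forall>p\<in>frontier \<Omega>. \<delta> \<le> dist z p"
      by (rule separate_compact_closed[OF compact_sphere frontier_closed]) (use sph frontier_disjoint_domain in blast)
    then obtain \<delta> where \<delta>: "\<delta> > 0" "\<And>z p. z \<in> sphere x d \<Longrightarrow> p \<in> frontier \<Omega> \<Longrightarrow> \<delta> \<le> dist z p" by blast
    define B where "B = dist b x + d"
    \<comment> \<open>Dividing by \<open>P b\<close> costs the factor \<open>1 / m\<close>;
      \<open>B\<close> bounds \<open>b - z\<close>, and \<open>\<delta>\<close> enters through the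
      Cauchy kernel.\<close>
    define \<epsilon> where "\<epsilon> = (\<lambda>k. (B * (dens_norm (\<lambda>\<zeta>. h k \<zeta> - K w \<zeta>) (K b) / \<delta>) + cmod (h k b - \<sigma> b w)) / m)"
    have "(\<lambda>k. cmod (h k b - \<sigma> b w)) \<longlonglongrightarrow> 0"
      using h(3)[OF b] by (simp add: LIM_zero tendsto_norm_zero)
    then have "\<epsilon> \<longlonglongrightarrow> (B * (0 / \<delta>) + 0) / m"
      unfolding \<epsilon>_def using \<delta>(1) m(1) by (intro tendsto_intros h(2) b) auto
    then have \<epsilon>0: "\<epsilon> \<longlonglongrightarrow> 0" by simp
    have on_sphere: "cmod (h k z - \<sigma> z w) \<le> \<epsilon> k" if z: "z \<in> sphere x d" for k z
    proof -
      have z\<Omega>: "z \<in> \<Omega>" using z sph by blast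
      have "(h k z - \<sigma> z w) * P b z = ((b - z) * CT (h k) (K b) z - h k b) - N w b z"
        using cauchy_transform_smooth_inside[OF h(1) b z\<Omega>, of k] N_inside[OF w b z\<Omega>] by (simp add: algebra_simps)
      also have "\<dots> = (b - z) * (CT (h k) (K b) z - CT (K w) (K b) z) - (h k b - \<sigma> b w)"
        by (simp add: N_def algebra_simps)
      finally have "cmod (h k z - \<sigma> z w) * cmod (P b z) = cmod ((b - z) * (CT (h k) (K b) z - CT (K w) (K b) z) - (h k b - \<sigma> b w))"
        by (metis norm_mult)
      also have "\<dots> \<le> cmod (b - z) * cmod (CT (h k) (K b) z - CT (K w) (K b) z) + cmod (h k b - \<sigma> b w)"
        by (metis norm_mult norm_triangle_ineq4)
      also have "\<dots> \<le> B * (dens_norm (\<lambda>\<zeta>. h k \<zeta> - K w \<zeta>) (K b) / \<delta>) + cmod (h k b - \<sigma> b w)"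
      proof (intro add_mono mult_mono order_refl)
        show "cmod (b - z) \<le> B"
          using z dist_triangle[of b z x] by (simp add: B_def dist_norm norm_minus_commute)
        show "cmod (CT (h k) (K b) z - CT (K w) (K b) z) \<le> dens_norm (\<lambda>\<zeta>. h k \<zeta> - K w \<zeta>) (K b) / \<delta>"
          by (rule cauchy_transform_diff_le[OF L2_K[OF w] L2_bdry_smooth[OF h(1)] L2_K[OF b] \<delta>(1) \<delta>(2)[OF z]])
      qed (use d in \<open>auto simp: B_def\<close>)
      finally have "cmod (h k z - \<sigma> z w) * cmod (P b z) \<le> \<epsilon> k * m" using m(1) by (simp add: \<epsilon>_def)
      moreover have "cmod (h k z - \<sigma> z w) * m \<le> cmod (h k z - \<sigma> z w) * cmod (P b z)"
        using m(2)[OF z] by (intro mult_left_mono) auto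
      ultimately have "cmod (h k z - \<sigma> z w) * m \<le> \<epsilon> k * m" by linarith
      then show ?thesis using m(1) by simp
    qed
    \<comment> \<open>Holomorphy of \<open>\<sigma>\<close> is still the goal, so the maximum
      principle is applied to \<open>h k - h l\<close> and the limit in \<open>l\<close> is taken
      afterwards.\<close>
    have cauchy: "cmod (h k z - h l z) \<le> \<epsilon> k + \<epsilon> l" if z: "z \<in> cball x d" for k l z
    proof (rule maximum_modulus_frontier[where f = "\<lambda>z. h k z - h l z" and S = "cball x d"])
      show "(\<lambda>z. h k z - h l z) holomorphic_on interior (cball x d)"
        using hh cb interior_subset by (intro holomorphic_intros) (blast intro: holomorphic_on_subset)+
      show "continuous_on (closure (cball x d)) (\<lambda>z. h k z - h l z)"
        using hh cb by (simp, intro holomorphic_on_imp_continuous_on holomorphic_intros) (blast intro: holomorphic_on_subset)+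
      fix y assume "y \<in> frontier (cball x d)"
      then have y: "y \<in> sphere x d" using d by (simp add: frontier_cball)
      have "cmod (h k y - h l y) = cmod ((h k y - \<sigma> y w) - (h l y - \<sigma> y w))" by simp
      also have "\<dots> \<le> cmod (h k y - \<sigma> y w) + cmod (h l y - \<sigma> y w)" by (rule norm_triangle_ineq4)
      also have "\<dots> \<le> \<epsilon> k + \<epsilon> l" using on_sphere[OF y] by (intro add_mono)
      finally show "cmod (h k y - h l y) \<le> \<epsilon> k + \<epsilon> l" .
    qed (use z in auto)
    have bound: "cmod (h k z - \<sigma> z w) \<le> \<epsilon> k" if z: "z \<in> cball x d" for k z
    proof -
      have "z \<in> \<Omega>" using z cb by blast
      then have "(\<lambda>l. cmod (h k z - h l z)) \<longlonglongrightarrow> cmod (h k z - \<sigma> z w)" by (intro tendsto_intros h(3))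
      moreover have "(\<lambda>l. \<epsilon> k + \<epsilon> l) \<longlonglongrightarrow> \<epsilon> k + 0" by (intro tendsto_intros \<epsilon>0)
      ultimately have "cmod (h k z - \<sigma> z w) \<le> \<epsilon> k + 0" using cauchy[OF z] by (intro LIMSEQ_le) auto
      then show ?thesis by simp
    qed
    have "uniform_limit (cball x d) h (\<lambda>z. \<sigma> z w) sequentially"
    proof (rule uniform_limitI)
      fix e :: real assume "e > 0"
      then have "\<forall>\<^sub>F k in sequentially. \<epsilon> k < e" using order_tendstoD(2)[OF \<epsilon>0] by blast
      then show "\<forall>\<^sub>F k in sequentially. \<forall>z\<in>cball x d. dist (h k z) (\<sigma> z w) < e"
        by (rule eventually_mono) (auto simp: dist_norm intro: le_less_trans[OF bound])
    qed
    then show "\<exists>d>0. cball x d \<subseteq> \<Omega> \<and> uniform_limit (cball x d) h (\<lambda>z. \<sigma> z w) sequentially"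
      using d(1) cb by blast
  qed
qed

end

subsection \<open>Quotients of kernels on the double\<close>

text \<open>The identity theorem for meromorphic functions. Equality is meant on punctured
  neighbourhoods, since values at isolated singularities are arbitrary.\<close>

lemma meromorphic_eventually_eq:
  assumes "f meromorphic_on D" "g meromorphic_on D" "open D" "connected D" "x \<in> D" "y \<in> D"
    and "eventually (\<lambda>z. f z = g z) (at x)"
  shows "eventually (\<lambda>z. f z = g z) (at y)"
proof -
  have m: "(\<lambda>z. f z - g z) meromorphic_on D" using assms(1,2) by (intro meromorphic_intros)
  from meromorphic_imp_constant_or_avoid[OF m assms(3,4), of 0]
  show ?thesis
  proof
    assume "\<forall>\<^sub>\<approx>z\<in>D. f z - g z = 0"
    then have "eventually (\<lambda>z. f z - g z = 0) (at y)"
      using assms(3,6) by (simp add: eventually_cosparse_open_eq)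
    then show ?thesis by simp
  next
    assume "\<forall>\<^sub>\<approx>z\<in>D. f z - g z \<noteq> 0"
    then have "eventually (\<lambda>z. f z - g z \<noteq> 0) (at x)"
      using assms(3,5) by (simp add: eventually_cosparse_open_eq)
    with assms(7) have "eventually (\<lambda>z. False) (at x)" by eventually_elim simp
    then show ?thesis by simp
  qed
qed

text \<open>A ball about a point of the closure meets \<Omega>, where both functions agree with
  \<open>G\<close>; the identity theorem spreads the agreement over the ball.\<close>

lemma meromorphic_eventually_eq_near_closure:
  assumes f: "f meromorphic_on ball \<zeta> r" and g: "g meromorphic_on ball \<zeta> r" and \<Omega>: "open \<Omega>"
    and \<zeta>: "\<zeta> \<in> closure \<Omega>" and y: "y \<in> ball \<zeta> r"
    and eqf: "\<And>x. x \<in> ball \<zeta> r \<inter> \<Omega> \<Longrightarrow> eventually (\<lambda>z. f z = G z) (at x)"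
    and eqg: "\<And>x. x \<in> ball \<zeta> r \<inter> \<Omega> \<Longrightarrow> eventually (\<lambda>z. g z = G z) (at x)"
  shows "eventually (\<lambda>z. f z = g z) (at y)"
proof -
  have "r > 0" using y by (metis ball_eq_empty empty_iff not_le)
  then obtain x where x: "x \<in> \<Omega>" "x \<in> ball \<zeta> r" using \<zeta> unfolding closure_approachable by (auto simp: dist_commute)
  then have "eventually (\<lambda>z. f z = g z) (at x)"
    using eventually_conj[OF eqf[of x] eqg[of x]] by (auto elim: eventually_mono)
  then show ?thesis using meromorphic_eventually_eq[OF f g open_ball _ x(2) y] by simp
qed

text \<open>The overlap of two discs need not meet \<Omega>, so continuations are compared on discs
  centred in the closure. With a Lebesgue number \<open>e\<close> of the cover, the disc of radius
  \<open>e/3\<close> about one centre fits into the disc of radius \<open>e\<close> about any other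
  centre whose \<open>e/3\<close>-disc it meets.\<close>

lemma meromorphic_glue:
  assumes \<Omega>: "open \<Omega>" "bounded \<Omega>"
    and loc: "\<And>\<zeta>. \<zeta> \<in> closure \<Omega> \<Longrightarrow> \<exists>r>0. \<exists>g. g meromorphic_on ball \<zeta> r \<and>
       (\<forall>x\<in>ball \<zeta> r \<inter> \<Omega>. eventually (\<lambda>z. g z = G z) (at x))"
  shows "\<exists>U Gt. open U \<and> closure \<Omega> \<subseteq> U \<and> Gt meromorphic_on U \<and> (\<forall>x\<in>\<Omega>. eventually (\<lambda>z. Gt z = G z) (at x))"
proof -
  have "\<forall>\<zeta>\<in>closure \<Omega>. \<exists>r. r > 0 \<and> (\<exists>g. g meromorphic_on ball \<zeta> r \<and>
       (\<forall>x\<in>ball \<zeta> r \<inter> \<Omega>. eventually (\<lambda>z. g z = G z) (at x)))" using loc by blast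
  from bchoice[OF this] obtain r where r: "\<forall>\<zeta>\<in>closure \<Omega>. r \<zeta> > 0 \<and> (\<exists>g. g meromorphic_on ball \<zeta> (r \<zeta>) \<and>
       (\<forall>x\<in>ball \<zeta> (r \<zeta>) \<inter> \<Omega>. eventually (\<lambda>z. g z = G z) (at x)))" by (rule exE)
  have cpt: "compact (closure \<Omega>)" using \<Omega>(2) by simp
  have "closure \<Omega> \<subseteq> \<Union>((\<lambda>\<zeta>. ball \<zeta> (r \<zeta>)) ` closure \<Omega>)"
  proof
    fix \<zeta> assume "\<zeta> \<in> closure \<Omega>"
    then show "\<zeta> \<in> \<Union>((\<lambda>\<zeta>. ball \<zeta> (r \<zeta>)) ` closure \<Omega>)" using r by (intro UN_I[of \<zeta>]) auto
  qed
  from Heine_Borel_lemma[OF cpt this] obtain e where e: "e > 0"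
    "\<And>x. x \<in> closure \<Omega> \<Longrightarrow> \<exists>B\<in>(\<lambda>\<zeta>. ball \<zeta> (r \<zeta>)) ` closure \<Omega>. ball x e \<subseteq> B"
    by (metis (no_types, lifting) image_iff open_ball)
  have "\<forall>x\<in>closure \<Omega>. \<exists>g. g meromorphic_on ball x e \<and> (\<forall>y\<in>ball x e \<inter> \<Omega>. eventually (\<lambda>z. g z = G z) (at y))"
  proof
    fix x assume "x \<in> closure \<Omega>"
    then obtain \<zeta> where \<zeta>: "\<zeta> \<in> closure \<Omega>" "ball x e \<subseteq> ball \<zeta> (r \<zeta>)" using e(2) by blast
    then obtain g where g: "g meromorphic_on ball \<zeta> (r \<zeta>)" "\<forall>y\<in>ball \<zeta> (r \<zeta>) \<inter> \<Omega>. eventually (\<lambda>z. g z = G z) (at y)"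
      using r by blast
    show "\<exists>g. g meromorphic_on ball x e \<and> (\<forall>y\<in>ball x e \<inter> \<Omega>. eventually (\<lambda>z. g z = G z) (at y))"
      by (rule exI[of _ g]) (use meromorphic_on_subset[OF g(1) \<zeta>(2)] g(2) \<zeta>(2) in blast)
  qed
  from bchoice[OF this] obtain g where g: "\<forall>x\<in>closure \<Omega>. g x meromorphic_on ball x e \<and>
      (\<forall>y\<in>ball x e \<inter> \<Omega>. eventually (\<lambda>z. g x z = G z) (at y))" by (rule exE)
  define U where "U = (\<Union>x\<in>closure \<Omega>. ball x (e/3))"
  define c where "c = (\<lambda>z. SOME x. x \<in> closure \<Omega> \<and> z \<in> ball x (e/3))"
  have c: "c z \<in> closure \<Omega> \<and> z \<in> ball (c z) (e/3)" if "z \<in> U" for z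
  proof -
    have "\<exists>x. x \<in> closure \<Omega> \<and> z \<in> ball x (e/3)" using that by (auto simp: U_def)
    then show ?thesis unfolding c_def by (rule someI_ex)
  qed
  \<comment> \<open>\<open>remove_sings\<close> yields a value that depends only on the punctured
    germ, hence not on the chosen centre.\<close>
  define Gt where "Gt = (\<lambda>z. remove_sings (g (c z)) z)"
  have Gt_eq: "Gt z = remove_sings (g x0) z" if x0: "x0 \<in> closure \<Omega>" and z: "z \<in> ball x0 (e/3)" for x0 z
  proof -
    have "z \<in> U" using x0 z by (auto simp: U_def)
    define x1 where "x1 = c z"
    have x1: "x1 \<in> closure \<Omega>" "z \<in> ball x1 (e/3)" using c[OF \<open>z \<in> U\<close>] by (auto simp: x1_def)
    have sub: "ball x1 (e/3) \<subseteq> ball x0 e"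
    proof
      fix p assume p: "p \<in> ball x1 (e/3)"
      have "dist x0 p \<le> dist x0 z + dist z x1 + dist x1 p"
        using dist_triangle[of x0 p z] dist_triangle[of z p x1] by linarith
      then show "p \<in> ball x0 e" using p x1(2) z by (simp add: dist_commute)
    qed
    have sub1: "ball x1 (e/3) \<subseteq> ball x1 e" using e(1) by (intro subset_ball) auto
    have "eventually (\<lambda>z. g x1 z = g x0 z) (at z)"
    proof (rule meromorphic_eventually_eq_near_closure[OF _ _ \<Omega>(1) x1])
      show "g x1 meromorphic_on ball x1 (e/3)" using g x1(1) sub1 meromorphic_on_subset by blast
      show "g x0 meromorphic_on ball x1 (e/3)" using g x0 sub meromorphic_on_subset by blast
      show "eventually (\<lambda>z. g x1 z = G z) (at x)" if "x \<in> ball x1 (e/3) \<inter> \<Omega>" for x using g x1(1) sub1 that by blast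
      show "eventually (\<lambda>z. g x0 z = G z) (at x)" if "x \<in> ball x1 (e/3) \<inter> \<Omega>" for x using g x0 sub that by blast
    qed
    then have "remove_sings (g x1) z = remove_sings (g x0) z" by (intro remove_sings_cong) auto
    then show ?thesis by (simp add: Gt_def x1_def)
  qed
  have near: "eventually (\<lambda>z. Gt z = g x0 z) (at y)" "Gt meromorphic_on {y}"
    if x0: "x0 \<in> closure \<Omega>" and y: "y \<in> ball x0 (e/3)" for x0 y
  proof -
    have "y \<in> ball x0 e" using y e(1) by simp
    then have m: "g x0 meromorphic_on {y}" using g x0 meromorphic_on_subset[of "g x0" "ball x0 e" "{y}"] by auto
    have ev: "eventually (\<lambda>z. z \<in> ball x0 (e/3)) (at y)"
      using eventually_at_in_open'[OF open_ball y] .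
    have "eventually (\<lambda>z. remove_sings (g x0) z = g x0 z) (at y)"
      using m by (intro eventually_remove_sings_eq_at) (simp add: meromorphic_at_iff)
    with ev show e1: "eventually (\<lambda>z. Gt z = g x0 z) (at y)"
      by eventually_elim (use Gt_eq[OF x0] in auto)
    have "eventually (\<lambda>z. g x0 z = Gt z) (at y)" using e1 by eventually_elim simp
    then show "Gt meromorphic_on {y}"
      using meromorphic_on_cong[of "{y}" "g x0" Gt "{y}"] m by simp
  qed
  show ?thesis
  proof (intro exI[of _ U] exI[of _ Gt] conjI ballI)
    show "open U" by (auto simp: U_def)
    show "closure \<Omega> \<subseteq> U" using e(1) by (force simp: U_def)
    show "Gt meromorphic_on U"
      unfolding meromorphic_on_meromorphic_at[of Gt U] using near(2) by (auto simp: U_def)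
    fix x assume x: "x \<in> \<Omega>"
    then have xc: "x \<in> closure \<Omega>" using closure_subset by blast
    have "eventually (\<lambda>z. Gt z = g x z) (at x)" using near(1)[OF xc] e(1) by simp
    moreover have "eventually (\<lambda>z. g x z = G z) (at x)" using g xc x e(1) by simp
    ultimately show "eventually (\<lambda>z. Gt z = G z) (at x)" by eventually_elim simp
  qed
qed

lemma frequently_at_boundary_value:
  fixes f g :: "complex \<Rightarrow> complex"
  assumes "isCont f \<zeta>" "isCont g \<zeta>" "frequently (\<lambda>z. f z = cnj (g z)) (at \<zeta>)"
  shows "f \<zeta> = cnj (g \<zeta>)"
proof (rule ccontr)
  assume "f \<zeta> \<noteq> cnj (g \<zeta>)"
  then have ne: "f \<zeta> - cnj (g \<zeta>) \<noteq> 0" by simp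
  have "((\<lambda>z. f z - cnj (g z)) \<longlongrightarrow> f \<zeta> - cnj (g \<zeta>)) (at \<zeta>)"
    using assms(1,2) by (intro tendsto_intros) (auto simp: isCont_def)
  from tendsto_imp_eventually_ne[OF this ne] have "eventually (\<lambda>z. \<not> f z = cnj (g z)) (at \<zeta>)"
    by eventually_elim simp
  then show False using assms(3) by (simp add: frequently_def)
qed

context weighted_szego
begin

text \<open>On \<open>\<Omega>\<close>, \<open>quot1 w b\<close> is \<open>\<sigma>(z,w)/\<sigma>(z,b)\<close> off the zeros of \<open>P b\<close>; \<open>quot2 w b\<close> is its
  companion on the reflected copy.\<close>

definition quot1 where "quot1 w b = (\<lambda>z. N w b z / N b b z)"
definition quot2 where "quot2 w b = (\<lambda>z. (N b w z / (w - z)) / (N b b z / (b - z)))"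

text \<open>In the chart the numerator and the denominator become \<open>A\<close> and
  \<open>D\<close>, and the companions become their negative reflections. Jacobian and signs cancel
  in the quotients. On the real axis reflection is plain conjugation, which is the gluing condition
  of the double.\<close>

lemma quotients_near_boundary:
  assumes w: "w \<in> \<Omega>" and b: "b \<in> \<Omega>" and \<zeta>: "\<zeta> \<in> frontier \<Omega>"
  shows "\<exists>r>0. \<exists>g g'. g meromorphic_on ball \<zeta> r \<and> g' meromorphic_on ball \<zeta> r \<and>
    (\<forall>x\<in>ball \<zeta> r \<inter> \<Omega>. g x = quot1 w b x \<and> g' x = quot2 w b x) \<and>
    frequently (\<lambda>z. g z = cnj (g' z)) (at \<zeta>)"
proof -
  have ne: "\<zeta> \<noteq> w" "\<zeta> \<noteq> b" using w b \<zeta> frontier_disjoint_domain by auto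
  \<comment> \<open>Keeps the chart away from \<open>w\<close> and \<open>b\<close>, the poles of
    the explicit terms in \<open>F\<close>.\<close>
  define e0 where "e0 = min (dist \<zeta> w) (dist \<zeta> b)"
  have e0: "e0 > 0" using ne by (simp add: e0_def)
  obtain \<rho> \<psi> where \<rho>: "\<rho> > 0" and \<psi>: "\<psi> holomorphic_on ball 0 \<rho>" "inj_on \<psi> (ball 0 \<rho>)" "\<psi> 0 = \<zeta>"
    "\<psi> ` ball 0 \<rho> \<subseteq> ball \<zeta> e0"
    "\<And>x. x \<in> ball 0 \<rho> \<Longrightarrow> \<psi> x \<in> frontier \<Omega> \<longleftrightarrow> Im x = 0"
    "\<And>x. x \<in> ball 0 \<rho> \<Longrightarrow> Im x > 0 \<Longrightarrow> \<psi> x \<in> \<Omega>"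
    "\<And>x. x \<in> ball 0 \<rho> \<Longrightarrow> Im x < 0 \<Longrightarrow> \<psi> x \<notin> closure \<Omega>"
    using boundary_chart[OF dom \<zeta> e0] by blast
  have off: "\<psi> x \<noteq> w" "\<psi> x \<noteq> b" if "x \<in> ball 0 \<rho>" for x
    using \<psi>(4) that by (auto simp: e0_def image_subset_iff)
  define F where "F = (\<lambda>u v z. CT (K u) (K v) z - \<sigma> v u / (v - z))"
  have FN: "F u v z = N u v z / (v - z)" if "z \<noteq> v" for u v z
    using that by (simp add: F_def N_def diff_divide_distrib)
  have refl: "\<exists>A. A holomorphic_on ball 0 (\<rho>/4) \<and> (\<forall>x\<in>ball 0 (\<rho>/4). Im x > 0 \<longrightarrow>
     deriv \<psi> x * F u b (\<psi> x) = A x \<and> deriv \<psi> x * F b u (\<psi> x) = - cnj (A (cnj x)))"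
    if u: "u \<in> \<Omega>" and off_u: "\<And>x. x \<in> ball 0 \<rho> \<Longrightarrow> \<psi> x \<noteq> u" for u
  proof (rule conjugate_transforms_reflect[where n = n and \<gamma> = \<Gamma> and M = lborel and f = "dens \<Gamma> \<phi> (K u) (K b)"
        and h = "\<lambda>z. - (\<sigma> b u / (b - z))" and h' = "\<lambda>z. - (\<sigma> u b / (u - z))"])
    show "\<psi> holomorphic_on ball 0 \<rho>" "inj_on \<psi> (ball 0 \<rho>)" "\<rho> > 0" by fact+
    show "\<Gamma> j \<in> borel_measurable lborel" if "j < n" for j
      using borel_measurable_continuous_onI[OF curve_continuous[OF that]] by simp
    show "integrable lborel (dens \<Gamma> \<phi> (K u) (K b) j)" if "j < n" for j
      by (rule dens_integrable[OF L2_K[OF u] L2_K[OF b] that])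
    show "Im x = 0" if "j < n" "x \<in> ball 0 \<rho>" "\<psi> x = \<Gamma> j t" for j t x
      using \<psi>(5)[OF that(2)] curve_in_frontier[OF that(1), of t] that(3) by simp
    show "(\<lambda>x. - (\<sigma> b u / (b - \<psi> x))) holomorphic_on ball 0 \<rho>"
      using off(2) by (intro holomorphic_intros \<psi>(1)) force
    show "(\<lambda>x. - (\<sigma> u b / (u - \<psi> x))) holomorphic_on ball 0 \<rho>"
      using off_u by (intro holomorphic_intros \<psi>(1)) force
    show "F u b (\<psi> x) = (\<Sum>j<n. \<integral>t. dens \<Gamma> \<phi> (K u) (K b) j t / (\<Gamma> j t - \<psi> x) \<partial>lborel) + - (\<sigma> b u / (b - \<psi> x))" for x
      by (simp add: F_def cauchy_transform_def)
    show "F b u (\<psi> x) = (\<Sum>j<n. \<integral>t. cnj (dens \<Gamma> \<phi> (K u) (K b) j t) / (\<Gamma> j t - \<psi> x) \<partial>lborel) + - (\<sigma> u b / (u - \<psi> x))" for x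
      by (simp add: F_def cauchy_transform_def cnj_dens)
    show "F u b (\<psi> x) = 0" if "x \<in> ball 0 \<rho>" "Im x < 0" for x
      using FN[OF off(2)[OF that(1)]] N_outside[OF u b \<psi>(7)[OF that]] by simp
    show "F b u (\<psi> x) = 0" if "x \<in> ball 0 \<rho>" "Im x < 0" for x
      using FN[OF off_u[OF that(1)]] N_outside[OF b u \<psi>(7)[OF that]] by simp
  qed
  obtain A where A: "A holomorphic_on ball 0 (\<rho>/4)" "\<And>x. x \<in> ball 0 (\<rho>/4) \<Longrightarrow> Im x > 0 \<Longrightarrow>
     deriv \<psi> x * F w b (\<psi> x) = A x \<and> deriv \<psi> x * F b w (\<psi> x) = - cnj (A (cnj x))"
    using refl[OF w off(1)] by blast
  obtain D where D: "D holomorphic_on ball 0 (\<rho>/4)" "\<And>x. x \<in> ball 0 (\<rho>/4) \<Longrightarrow> Im x > 0 \<Longrightarrow>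
     deriv \<psi> x * F b b (\<psi> x) = D x \<and> deriv \<psi> x * F b b (\<psi> x) = - cnj (D (cnj x))"
    using refl[OF b off(2)] by blast
  have sub: "ball 0 (\<rho>/4) \<subseteq> ball (0::complex) \<rho>" using \<rho> by auto
  obtain s where s: "s holomorphic_on \<psi> ` ball 0 \<rho>" "\<And>z. z \<in> ball 0 \<rho> \<Longrightarrow> s (\<psi> z) = z"
    using holomorphic_has_inverse[OF \<psi>(1) open_ball \<psi>(2)] by metis
  have op: "open (\<psi> ` ball 0 (\<rho>/4))"
    by (rule open_mapping_thm3[OF holomorphic_on_subset[OF \<psi>(1) sub] open_ball inj_on_subset[OF \<psi>(2) sub]])
  have "\<zeta> \<in> \<psi> ` ball 0 (\<rho>/4)" using \<psi>(3) \<rho> by (intro image_eqI[of _ _ 0]) auto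
  then obtain r where r: "r > 0" "ball \<zeta> r \<subseteq> \<psi> ` ball 0 (\<rho>/4)" using op open_contains_ball by metis
  have sm: "s p \<in> ball 0 (\<rho>/4) \<and> \<psi> (s p) = p" if "p \<in> ball \<zeta> r" for p
  proof -
    obtain y where y: "y \<in> ball 0 (\<rho>/4)" "p = \<psi> y" using r(2) \<open>p \<in> ball \<zeta> r\<close> by blast
    have "y \<in> ball 0 \<rho>" using sub y(1) by (rule subsetD)
    from s(2)[OF this] show ?thesis using y by simp
  qed
  have sh: "s holomorphic_on ball \<zeta> r"
    by (rule holomorphic_on_subset[OF s(1) subset_trans[OF r(2) image_mono[OF sub]]])
  have comp: "(\<lambda>p. B (s p)) holomorphic_on ball \<zeta> r" if "B holomorphic_on ball 0 (\<rho>/4)" for B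
  proof -
    have "s ` ball \<zeta> r \<subseteq> ball 0 (\<rho>/4)" using sm by blast
    from holomorphic_on_compose_gen[OF sh that this] show ?thesis by (simp only: o_def)
  qed
  have cj: "(\<lambda>x. cnj (B (cnj x))) holomorphic_on ball 0 (\<rho>/4)" if "B holomorphic_on ball 0 (\<rho>/4)" for B
  proof -
    have "cnj ` ball 0 (\<rho>/4) = ball 0 (\<rho>/4)"
    proof
      show "ball 0 (\<rho>/4) \<subseteq> cnj ` ball 0 (\<rho>/4)"
      proof
        fix x :: complex assume "x \<in> ball 0 (\<rho>/4)"
        then show "x \<in> cnj ` ball 0 (\<rho>/4)" by (intro image_eqI[of _ _ "cnj x"]) auto
      qed
    qed auto
    then show ?thesis using holomorphic_on_compose_cnj_cnj[of B "ball 0 (\<rho>/4)"] that by (simp add: o_def)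
  qed
  have mero: "(\<lambda>p. B (s p) / C (s p)) meromorphic_on ball \<zeta> r"
    if "B holomorphic_on ball 0 (\<rho>/4)" "C holomorphic_on ball 0 (\<rho>/4)" for B C
    using comp[OF that(1)] comp[OF that(2)]
    by (intro meromorphic_on_divide analytic_on_imp_meromorphic_on) (simp_all add: analytic_on_open)
  define g where "g = (\<lambda>p. A (s p) / D (s p))"
  define g' where "g' = (\<lambda>p. cnj (A (cnj (s p))) / cnj (D (cnj (s p))))"
  have gm: "g meromorphic_on ball \<zeta> r" "g' meromorphic_on ball \<zeta> r"
    unfolding g_def g'_def using mero[OF A(1) D(1)] mero[OF cj[OF A(1)] cj[OF D(1)]] by auto
  have eq: "g p = quot1 w b p \<and> g' p = quot2 w b p" if p: "p \<in> ball \<zeta> r \<inter> \<Omega>" for p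
  proof -
    define x where "x = s p"
    have x: "x \<in> ball 0 (\<rho>/4)" "\<psi> x = p" using sm p by (auto simp: x_def)
    have xr: "x \<in> ball 0 \<rho>" using x sub by blast
    have "Im x > 0"
      using \<psi>(5)[OF xr] \<psi>(7)[OF xr] p x(2) frontier_disjoint_domain closure_subset[of \<Omega>]
      by (metis IntD2 disjoint_iff linorder_neqE_linordered_idom subsetD)
    note AD = A(2)[OF x(1) this] D(2)[OF x(1) this]
    have d: "deriv \<psi> x \<noteq> 0" using holomorphic_injective_imp_regular[OF \<psi>(1) open_ball \<psi>(2) xr] .
    have pn: "p \<noteq> w" "p \<noteq> b" using off[OF xr] x(2) by auto
    have "g p = (deriv \<psi> x * F w b p) / (deriv \<psi> x * F b b p)"
      using AD x(2) by (simp add: g_def x_def[symmetric])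
    then have 1: "g p = quot1 w b p" using d pn by (simp add: FN quot1_def)
    have "g' p = (- cnj (A (cnj x))) / (- cnj (D (cnj x)))" by (simp add: g'_def x_def)
    also have "\<dots> = (deriv \<psi> x * F b w p) / (deriv \<psi> x * F b b p)" using AD x(2) by metis
    finally have "g' p = quot2 w b p" using d pn by (simp add: FN quot2_def)
    with 1 show ?thesis by blast
  qed
  \<comment> \<open>The relation is checked along the boundary arc, which accumulates at \<zeta>;
    hence \<open>frequently\<close>. Where \<open>D\<close> vanishes both sides are 0 by the
    convention for division.\<close>
  have "frequently (\<lambda>z. g z = cnj (g' z)) (at \<zeta>)"
  proof -
    have "isCont \<psi> 0" using holomorphic_on_imp_continuous_on[OF \<psi>(1)] \<rho> by (simp add: continuous_on_eq_continuous_at)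
    then have "isCont (\<lambda>x. \<psi> (complex_of_real x)) 0"
      by (intro isCont_o2[where f = complex_of_real and g = \<psi>]) auto
    then have lim: "((\<lambda>x. \<psi> (complex_of_real x)) \<longlongrightarrow> \<zeta>) (at_right 0)"
      using \<psi>(3) by (metis continuous_at_imp_continuous_at_within continuous_within of_real_0)
    have small: "eventually (\<lambda>x::real. x \<in> {0<..<\<rho>}) (at_right 0)"
      using eventually_at_right_real[OF \<rho>] .
    have "eventually (\<lambda>x. \<psi> (complex_of_real x) \<noteq> \<zeta>) (at_right 0)"
      using small
    proof eventually_elim
      case (elim x)
      show "\<psi> (complex_of_real x) \<noteq> \<zeta>"
      proof
        assume "\<psi> (complex_of_real x) = \<zeta>"
        then have "\<psi> (complex_of_real x) = \<psi> 0" by (simp only: \<psi>(3))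
        moreover have "complex_of_real x \<in> ball 0 \<rho>" "0 \<in> ball (0::complex) \<rho>" using elim \<rho> by simp_all
        ultimately have "complex_of_real x = 0" by (rule inj_onD[OF \<psi>(2)])
        then show False using elim by simp
      qed
    qed
    with lim have fl: "filterlim (\<lambda>x. \<psi> (complex_of_real x)) (at \<zeta>) (at_right 0)" by (rule filterlim_atI)
    show ?thesis
    proof (rule ccontr)
      assume "\<not> ?thesis"
      then have "eventually (\<lambda>z. g z \<noteq> cnj (g' z)) (at \<zeta>)" by (simp add: frequently_def)
      then have "eventually (\<lambda>x. g (\<psi> (complex_of_real x)) \<noteq> cnj (g' (\<psi> (complex_of_real x)))) (at_right 0)"
        using fl unfolding filterlim_iff by blast
      with small have "eventually (\<lambda>x::real. False) (at_right 0)"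
      proof eventually_elim
        case (elim x)
        then have "s (\<psi> (complex_of_real x)) = complex_of_real x" by (intro s(2)) auto
        then show False using elim by (simp add: g_def g'_def)
      qed
      then show False by (simp add: trivial_limit_at_right_real)
    qed
  qed
  then show ?thesis using r(1) gm eq by blast
qed

text \<open>Gluing the local continuations of both quotients produces \<open>Gt\<close> and
  \<open>Ht\<close>. Their germs at a boundary point agree with the local pieces on a punctured
  disc, so the relation between the pieces is inherited.\<close>

lemma kernel_quotient_mero_on_double:
  assumes w: "w \<in> \<Omega>" and b: "b \<in> \<Omega>"
  shows "mero_on_double \<Omega> (\<lambda>z. \<sigma> z w / \<sigma> z b)"
proof -
  have q: "quot1 w b meromorphic_on \<Omega>" "quot2 w b meromorphic_on \<Omega>"
  proof -
    have "N u v meromorphic_on \<Omega>" if "u \<in> \<Omega>" "v \<in> \<Omega>" for u v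
      using N_holomorphic[OF that] open_domain by (intro analytic_on_imp_meromorphic_on) (simp add: analytic_on_open)
    note m = this[OF w b] this[OF b b] this[OF b w]
    show "quot1 w b meromorphic_on \<Omega>"
      unfolding quot1_def by (intro meromorphic_on_divide m)
    show "quot2 w b meromorphic_on \<Omega>"
      unfolding quot2_def
      by (intro meromorphic_on_divide meromorphic_on_diff meromorphic_on_const meromorphic_on_id m)
  qed
  have loc: "\<exists>r>0. \<exists>g. g meromorphic_on ball \<zeta> r \<and> (\<forall>x\<in>ball \<zeta> r \<inter> \<Omega>. eventually (\<lambda>z. g z = G z) (at x))"
    if \<zeta>: "\<zeta> \<in> closure \<Omega>" and G: "G = quot1 w b \<or> G = quot2 w b" for \<zeta> G
  proof (cases "\<zeta> \<in> \<Omega>")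
    case True
    then obtain r where r: "r > 0" "ball \<zeta> r \<subseteq> \<Omega>" using open_domain open_contains_ball by metis
    have "G meromorphic_on \<Omega>" using q G by auto
    then have "G meromorphic_on ball \<zeta> r" using r(2) meromorphic_on_subset by blast
    then show ?thesis using r(1) by (intro exI[of _ r] conjI exI[of _ G]) auto
  next
    case False
    then have "\<zeta> \<in> frontier \<Omega>" using \<zeta> closure_domain by blast
    from quotients_near_boundary[OF w b this] obtain r g g' where r: "r > 0" "g meromorphic_on ball \<zeta> r"
      "g' meromorphic_on ball \<zeta> r" "\<And>x. x \<in> ball \<zeta> r \<inter> \<Omega> \<Longrightarrow> g x = quot1 w b x \<and> g' x = quot2 w b x" by blast
    have ev: "eventually (\<lambda>z. g z = quot1 w b z \<and> g' z = quot2 w b z) (at x)" if "x \<in> ball \<zeta> r \<inter> \<Omega>" for x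
      using eventually_at_in_open'[OF open_Int[OF open_ball open_domain] that] by (rule eventually_mono) (rule r(4))
    have ev1: "eventually (\<lambda>z. g z = quot1 w b z) (at x)" if "x \<in> ball \<zeta> r \<inter> \<Omega>" for x
      using ev[OF that] by eventually_elim simp
    have ev2: "eventually (\<lambda>z. g' z = quot2 w b z) (at x)" if "x \<in> ball \<zeta> r \<inter> \<Omega>" for x
      using ev[OF that] by eventually_elim simp
    show ?thesis
    proof (cases "G = quot1 w b")
      case True
      then show ?thesis using r(1,2) ev1 by (intro exI[of _ r] conjI exI[of _ g]) auto
    next
      case False
      then have "G = quot2 w b" using G by blast
      then show ?thesis using r(1,3) ev2 by (intro exI[of _ r] conjI exI[of _ g']) auto
    qed
  qed
  obtain U1 Gt where U1: "open U1" "closure \<Omega> \<subseteq> U1" "Gt meromorphic_on U1"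
    "\<And>x. x \<in> \<Omega> \<Longrightarrow> eventually (\<lambda>z. Gt z = quot1 w b z) (at x)"
    using meromorphic_glue[OF open_domain bounded_domain loc[where G = "quot1 w b"]] by blast
  obtain U2 Ht where U2: "open U2" "closure \<Omega> \<subseteq> U2" "Ht meromorphic_on U2"
    "\<And>x. x \<in> \<Omega> \<Longrightarrow> eventually (\<lambda>z. Ht z = quot2 w b z) (at x)"
    using meromorphic_glue[OF open_domain bounded_domain loc[where G = "quot2 w b"]] by blast
  have frequent: "frequently (\<lambda>z. Gt z = cnj (Ht z)) (at \<zeta>)" if \<zeta>: "\<zeta> \<in> frontier \<Omega>" for \<zeta>
  proof -
    obtain r g g' where r: "r > 0" "g meromorphic_on ball \<zeta> r"
      "g' meromorphic_on ball \<zeta> r" "\<And>x. x \<in> ball \<zeta> r \<inter> \<Omega> \<Longrightarrow> g x = quot1 w b x \<and> g' x = quot2 w b x"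
      "frequently (\<lambda>z. g z = cnj (g' z)) (at \<zeta>)"
      using quotients_near_boundary[OF w b \<zeta>] by blast
    have \<zeta>c: "\<zeta> \<in> closure \<Omega>" using \<zeta> closure_domain by blast
    then obtain r' where r': "r' > 0" "ball \<zeta> r' \<subseteq> U1 \<inter> U2" using U1(1,2) U2(1,2) open_contains_ball[of "U1 \<inter> U2"] by blast
    define d where "d = min r r'"
    have d: "d > 0" "ball \<zeta> d \<subseteq> ball \<zeta> r" "ball \<zeta> d \<subseteq> U1" "ball \<zeta> d \<subseteq> U2" using r(1) r' by (auto simp: d_def)
    have ev: "eventually (\<lambda>z. g z = quot1 w b z \<and> g' z = quot2 w b z) (at x)" if "x \<in> ball \<zeta> d \<inter> \<Omega>" for x
    proof -
      have "x \<in> ball \<zeta> r \<inter> \<Omega>" using that d(2) by blast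
      from eventually_at_in_open'[OF open_Int[OF open_ball open_domain] this] show ?thesis
        by (rule eventually_mono) (rule r(4))
    qed
    have e1: "eventually (\<lambda>z. Gt z = g z) (at \<zeta>)"
    proof (rule meromorphic_eventually_eq_near_closure[OF _ _ open_domain \<zeta>c])
      show "Gt meromorphic_on ball \<zeta> d" by (rule meromorphic_on_subset[OF U1(3) d(3)])
      show "g meromorphic_on ball \<zeta> d" by (rule meromorphic_on_subset[OF r(2) d(2)])
      show "eventually (\<lambda>z. Gt z = quot1 w b z) (at x)" if "x \<in> ball \<zeta> d \<inter> \<Omega>" for x using U1(4) that by blast
      show "eventually (\<lambda>z. g z = quot1 w b z) (at x)" if "x \<in> ball \<zeta> d \<inter> \<Omega>" for x
        using ev[OF that] by eventually_elim simp
    qed (use d in auto)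
    have e2: "eventually (\<lambda>z. Ht z = g' z) (at \<zeta>)"
    proof (rule meromorphic_eventually_eq_near_closure[OF _ _ open_domain \<zeta>c])
      show "Ht meromorphic_on ball \<zeta> d" by (rule meromorphic_on_subset[OF U2(3) d(4)])
      show "g' meromorphic_on ball \<zeta> d" by (rule meromorphic_on_subset[OF r(3) d(2)])
      show "eventually (\<lambda>z. Ht z = quot2 w b z) (at x)" if "x \<in> ball \<zeta> d \<inter> \<Omega>" for x using U2(4) that by blast
      show "eventually (\<lambda>z. g' z = quot2 w b z) (at x)" if "x \<in> ball \<zeta> d \<inter> \<Omega>" for x
        using ev[OF that] by eventually_elim simp
    qed (use d in auto)
    show ?thesis
    proof (rule ccontr)
      assume "\<not> ?thesis"
      then have "eventually (\<lambda>z. Gt z \<noteq> cnj (Ht z)) (at \<zeta>)" by (simp add: frequently_def)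
      with e1 e2 have "eventually (\<lambda>z. g z \<noteq> cnj (g' z)) (at \<zeta>)" by eventually_elim simp
      then show False using r(5) by (simp add: frequently_def)
    qed
  qed
  show ?thesis
    unfolding mero_on_double_def
  proof (rule exI[of _ "U1 \<inter> U2"], rule exI[of _ Gt], rule exI[of _ Ht], intro conjI ballI impI)
    show "open (U1 \<inter> U2)" "closure \<Omega> \<subseteq> U1 \<inter> U2" using U1 U2 by auto
    show "Gt meromorphic_on U1 \<inter> U2" "Ht meromorphic_on U1 \<inter> U2"
      using U1(3) U2(3) by (auto intro: meromorphic_on_subset)
    \<comment> \<open>By \<open>N_inside\<close> the common factor \<open>P b\<close> cancels
      wherever it does not vanish.\<close>
    show "eventually (\<lambda>x. Gt x = \<sigma> x w / \<sigma> x b) (at z)" if z: "z \<in> \<Omega>" for z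
      using U1(4)[OF z] P_eventually_nonzero[OF b z] eventually_at_in_open'[OF open_domain z]
      by eventually_elim (simp add: quot1_def N_inside w b)
    show "Gt \<zeta> = cnj (Ht \<zeta>)" if "\<zeta> \<in> frontier \<Omega>" "Gt analytic_on {\<zeta>} \<and> Ht analytic_on {\<zeta>}" for \<zeta>
      using frequently_at_boundary_value[OF _ _ frequent[OF that(1)]] that(2) analytic_at_imp_isCont by blast
  qed
qed

end

subsection \<open>Rationality of the kernel\<close>

text \<open>\<open>G\<close> may have poles or stray values at isolated points; on a small punctured
  disc it equals its continuation \<open>Gt\<close>, which is analytic there.\<close>

lemma mero_on_double_eventually_analytic:
  assumes G: "mero_on_double \<Omega> G" and z: "z \<in> \<Omega>"
  shows "eventually (\<lambda>x. G analytic_on {x}) (at z)"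
proof -
  obtain U Gt where U: "open U" "closure \<Omega> \<subseteq> U" "Gt meromorphic_on U"
    "\<forall>z\<in>\<Omega>. eventually (\<lambda>x. Gt x = G x) (at z)"
    using G unfolding mero_on_double_def by blast
  have "z \<in> U" using U(2) z closure_subset by blast
  then have "Gt meromorphic_on {z}" using meromorphic_on_subset[OF U(3)] by simp
  then have "isolated_singularity_at Gt z" by (rule meromorphic_on_isolated_singularity)
  then obtain r where r: "r > 0" "Gt analytic_on ball z r - {z}" unfolding isolated_singularity_at_def by blast
  obtain d where d: "d > 0" "\<And>x. x \<noteq> z \<Longrightarrow> dist x z < d \<Longrightarrow> Gt x = G x"
    using bspec[OF U(4) z] unfolding eventually_at by auto
  define B where "B = ball z (min r d) - {z}"
  have B: "open B" by (simp add: B_def open_delete)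
  have "Gt holomorphic_on B"
    using r(2) by (intro analytic_imp_holomorphic) (auto simp: B_def intro: analytic_on_subset)
  then have "G holomorphic_on B"
    by (rule holomorphic_transform) (use d(2) in \<open>auto simp: B_def dist_commute\<close>)
  then have "G analytic_on {x}" if "x \<in> B" for x
    using that B by (auto simp: analytic_at)
  moreover have "eventually (\<lambda>x. x \<in> B) (at z)"
    unfolding eventually_at B_def using r(1) d(1) by (intro exI[of _ "min r d"]) (auto simp: dist_commute)
  ultimately show ?thesis by (auto elim: eventually_mono)
qed

lemma open_analytic_points: "open {z. f analytic_on {z}}"
proof (subst open_subopen, rule ballI)
  fix z assume "z \<in> {z. f analytic_on {z}}"
  then obtain s where s: "open s" "z \<in> s" "f holomorphic_on s" by (auto simp: analytic_at)
  then have "s \<subseteq> {z. f analytic_on {z}}" by (auto simp: analytic_at)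
  then show "\<exists>T. open T \<and> z \<in> T \<and> T \<subseteq> {z. f analytic_on {z}}" using s by blast
qed

lemma isCont_eq_of_eventually_eq:
  fixes f g :: "complex \<Rightarrow> complex"
  assumes "isCont f z" "isCont g z" "eventually (\<lambda>x. f x = g x) (at z)"
  shows "f z = g z"
proof -
  have "(f \<longlongrightarrow> g z) (at z)"
    using assms(2) tendsto_cong[OF assms(3)] by (simp add: isCont_def)
  then show ?thesis using assms(1) LIM_unique by (auto simp: isCont_def)
qed

lemma isCont_poly2:
  assumes "isCont a z" "isCont b z"
  shows "isCont (\<lambda>x. poly2 N c (a x) (b x)) z"
  unfolding poly2_def using assms by (intro continuous_intros)

lemma isCont_poly4:
  assumes "isCont a1 z" "isCont a2 z" "isCont a3 z" "isCont a4 z"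
  shows "isCont (\<lambda>x. poly4 N c (a1 x) (a2 x) (a3 x) (a4 x)) z"
  unfolding poly4_def using assms by (intro continuous_intros)

lemma poly2_scale: "poly2 N (\<lambda>i j. a * c i j) x y = a * poly2 N c x y"
  by (simp add: poly2_def sum_distrib_left mult.assoc)

context weighted_szego
begin

text \<open>On \<open>S\<close> both \<open>G1\<close> and \<open>G2\<close> are analytic and no
  denominator of \<open>T\<close> vanishes; \<open>S\<close> is connected because \<Omega> loses
  only countably many points. The identity found there is cross-multiplied, so continuity carries it
  to all points where \<open>G1\<close> and \<open>G2\<close> are analytic, including zeros of
  \<open>\<sigma> z b\<close>.\<close>

lemma kernel_rational:
  assumes prim: "primitive_pair \<Omega> G1 G2" and b: "b \<in> \<Omega>"
  shows "\<exists>N p q.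
     (\<exists>z\<in>\<Omega>. \<exists>w\<in>\<Omega>. G1 analytic_on {z} \<and> G2 analytic_on {z} \<and>
        G1 analytic_on {w} \<and> G2 analytic_on {w} \<and>
        poly4 N q (G1 z) (G2 z) (cnj (G1 w)) (cnj (G2 w)) \<noteq> 0) \<and>
     (\<forall>z\<in>\<Omega>. \<forall>w\<in>\<Omega>. G1 analytic_on {z} \<and> G2 analytic_on {z} \<and>
        G1 analytic_on {w} \<and> G2 analytic_on {w} \<and>
        poly4 N q (G1 z) (G2 z) (cnj (G1 w)) (cnj (G2 w)) \<noteq> 0 \<longrightarrow>
        \<sigma> z w = \<sigma> z b * \<sigma> b w *
          (poly4 N p (G1 z) (G2 z) (cnj (G1 w)) (cnj (G2 w)) /
           poly4 N q (G1 z) (G2 z) (cnj (G1 w)) (cnj (G2 w))))"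
proof -
  have md: "mero_on_double \<Omega> G1" "mero_on_double \<Omega> G2" using prim by (auto simp: primitive_pair_def)
  define A where "A = {z\<in>\<Omega>. G1 analytic_on {z} \<and> G2 analytic_on {z}}"
  define S where "S = {z\<in>A. \<sigma> z b \<noteq> 0}"
  have kh: "(\<lambda>z. \<sigma> z w) holomorphic_on \<Omega>" if "w \<in> \<Omega>" for w by (rule kernel_holomorphic[OF that])
  have kc: "isCont (\<lambda>z. \<sigma> z w) z" if "w \<in> \<Omega>" "z \<in> \<Omega>" for w z
    using holomorphic_on_imp_continuous_on[OF kh[OF that(1)]] that(2) open_domain
    by (simp add: continuous_on_eq_continuous_at)
  have AO: "A \<subseteq> \<Omega>" and SA: "S \<subseteq> A" by (auto simp: A_def S_def)
  have ev_S: "eventually (\<lambda>x. x \<in> S) (at z)" if z: "z \<in> \<Omega>" for z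
  proof -
    have "eventually (\<lambda>x. \<sigma> x b \<noteq> 0) (at z)"
      by (rule holomorphic_eventually_nonzero[OF kh[OF b] open_domain connected_domain b kernel_diag_nonzero[OF b] z])
    with mero_on_double_eventually_analytic[OF md(1) z] mero_on_double_eventually_analytic[OF md(2) z]
      eventually_at_in_open'[OF open_domain z]
    show ?thesis by eventually_elim (simp add: S_def A_def)
  qed
  have A_eq: "A = \<Omega> \<inter> {z. G1 analytic_on {z}} \<inter> {z. G2 analytic_on {z}}" by (auto simp: A_def)
  have oA: "open A" unfolding A_eq by (intro open_Int open_domain open_analytic_points)
  have oS: "open S"
  proof -
    have "continuous_on A (\<lambda>z. \<sigma> z b)" using holomorphic_on_imp_continuous_on[OF kh[OF b]] AO continuous_on_subset by blast
    then have "open (A \<inter> (\<lambda>z. \<sigma> z b) -` (- {0}))" using oA by (intro continuous_open_preimage) auto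
    moreover have "S = A \<inter> (\<lambda>z. \<sigma> z b) -` (- {0})" by (auto simp: S_def)
    ultimately show ?thesis by simp
  qed
  have cS: "connected S"
  proof -
    have "(- S) sparse_in \<Omega>" using ev_S open_domain by (simp add: sparse_in_eventually_iff)
    then have "countable (\<Omega> \<inter> - S)" by (rule sparse_imp_countable[OF open_domain])
    then have "connected (\<Omega> - (\<Omega> \<inter> - S))"
      using open_domain connected_domain by (intro connected_open_diff_countable) auto
    moreover have "\<Omega> - (\<Omega> \<inter> - S) = S" using SA AO by blast
    ultimately show ?thesis by simp
  qed
  have neS: "S \<noteq> {}" using ev_S[OF b] eventually_happens'[of "at b" "\<lambda>x. x \<in> S"] by auto
  have gc: "isCont G1 z" "isCont G2 z" if "z \<in> A" for z
    using that analytic_at_imp_isCont by (auto simp: A_def)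
  have gh: "G1 holomorphic_on S" "G2 holomorphic_on S"
    using SA by (intro analytic_imp_holomorphic; subst analytic_on_analytic_at; auto simp: A_def)+
  \<comment> \<open>Dividing by both factors keeps the Hermitian symmetry, which
    \<open>\<sigma> z w / \<sigma> z b\<close> lacks.\<close>
  define T where "T = (\<lambda>z w. \<sigma> z w / (\<sigma> z b * \<sigma> b w))"
  have S\<Omega>: "z \<in> \<Omega>" if "z \<in> S" for z using that SA AO by blast
  have nz: "\<sigma> z b \<noteq> 0" "\<sigma> b z \<noteq> 0" if "z \<in> S" for z
    using that kernel_sym[OF b S\<Omega>[OF that]] by (auto simp: S_def)
  have "\<exists>N p q. (\<exists>z\<in>S. \<exists>w\<in>S. poly4 N q (G1 z) (G2 z) (cnj (G1 w)) (cnj (G2 w)) \<noteq> 0) \<and>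
           (\<forall>z\<in>S. \<forall>w\<in>S. T z w * poly4 N q (G1 z) (G2 z) (cnj (G1 w)) (cnj (G2 w)) =
                poly4 N p (G1 z) (G2 z) (cnj (G1 w)) (cnj (G2 w)))"
  proof (rule separately_rational_imp_rational[OF oS cS neS gh])
    show "(\<lambda>z. T z w) holomorphic_on S" if "w \<in> S" for w
      unfolding T_def using nz nz[OF that] S\<Omega>
      by (intro holomorphic_intros holomorphic_on_subset[OF kh] S\<Omega>[OF that] b) auto
    show "T z w = cnj (T w z)" if "z \<in> S" "w \<in> S" for z w
      using kernel_sym[OF S\<Omega>[OF that(1)] S\<Omega>[OF that(2)]] kernel_sym[OF S\<Omega>[OF that(1)] b] kernel_sym[OF b S\<Omega>[OF that(2)]]
      by (simp add: T_def mult.commute)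
    fix w assume w: "w \<in> S"
    have "mero_on_double \<Omega> (\<lambda>z. \<sigma> z w / \<sigma> z b)" by (rule kernel_quotient_mero_on_double[OF S\<Omega>[OF w] b])
    then obtain N p q x0 where x0: "x0 \<in> \<Omega>" "G1 analytic_on {x0}" "G2 analytic_on {x0}" "poly2 N q (G1 x0) (G2 x0) \<noteq> 0"
      and eq: "\<And>z. z \<in> \<Omega> \<Longrightarrow> eventually (\<lambda>x. \<sigma> x w / \<sigma> x b = poly2 N p (G1 x) (G2 x) / poly2 N q (G1 x) (G2 x)) (at z)"
      using prim unfolding primitive_pair_def by blast
    define Q where "Q = (\<lambda>x. poly2 N q (G1 x) (G2 x))"
    have Qh: "Q holomorphic_on S" unfolding Q_def poly2_def using gh by (intro holomorphic_intros)
    have "isCont Q x0" unfolding Q_def using x0 gc[of x0] by (intro isCont_poly2) (auto simp: A_def)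
    then have "eventually (\<lambda>x. Q x \<noteq> 0) (at x0)"
      using x0(4) by (simp add: isCont_def tendsto_imp_eventually_ne Q_def)
    with ev_S[OF x0(1)] have "eventually (\<lambda>x. x \<in> S \<and> Q x \<noteq> 0) (at x0)" by eventually_elim simp
    then obtain x1 where x1: "x1 \<in> S" "Q x1 \<noteq> 0" using eventually_happens'[of "at x0"] by auto
    \<comment> \<open>The primitive pair represents the quotient only on punctured neighbourhoods;
      after cross-multiplication continuity extends it to every point of \<open>S\<close>. The
      constant \<open>1 / \<sigma> b w\<close> goes into the numerator.\<close>
    have "T x w * Q x = poly2 N (\<lambda>i j. (1 / \<sigma> b w) * p i j) (G1 x) (G2 x)" if x: "x \<in> S" for x
    proof -
      have c1: "isCont (\<lambda>x. \<sigma> x w / \<sigma> x b * Q x) x"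
        using nz(1)[OF x] gc[of x] SA x unfolding Q_def
        by (intro continuous_intros kc S\<Omega> w b isCont_poly2) auto
      have c2: "isCont (\<lambda>x. poly2 N p (G1 x) (G2 x)) x" using gc[of x] SA x by (intro isCont_poly2) auto
      have "\<sigma> x w / \<sigma> x b * Q x = poly2 N p (G1 x) (G2 x)"
      proof (rule isCont_eq_of_eventually_eq[OF c1 c2])
        have "eventually (\<lambda>x. Q x \<noteq> 0) (at x)"
          by (rule holomorphic_eventually_nonzero[OF Qh oS cS x1 x])
        with eq[OF S\<Omega>[OF x]] show "eventually (\<lambda>x. \<sigma> x w / \<sigma> x b * Q x = poly2 N p (G1 x) (G2 x)) (at x)"
          by eventually_elim (simp add: Q_def)
      qed
      moreover have "T x w * Q x = (1 / \<sigma> b w) * (\<sigma> x w / \<sigma> x b * Q x)" by (simp add: T_def)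
      ultimately show ?thesis by (simp only: poly2_scale)
    qed
    then show "\<exists>N p q. (\<exists>x\<in>S. poly2 N q (G1 x) (G2 x) \<noteq> 0) \<and>
                (\<forall>x\<in>S. T x w * poly2 N q (G1 x) (G2 x) = poly2 N p (G1 x) (G2 x))"
      using x1 unfolding Q_def by blast
  qed
  then obtain N p q z0 w0 where zw0: "z0 \<in> S" "w0 \<in> S" "poly4 N q (G1 z0) (G2 z0) (cnj (G1 w0)) (cnj (G2 w0)) \<noteq> 0"
    and TT: "\<And>z w. z \<in> S \<Longrightarrow> w \<in> S \<Longrightarrow> T z w * poly4 N q (G1 z) (G2 z) (cnj (G1 w)) (cnj (G2 w)) =
                poly4 N p (G1 z) (G2 z) (cnj (G1 w)) (cnj (G2 w))" by blast
  define q' where "q' = (\<lambda>z w. poly4 N q (G1 z) (G2 z) (cnj (G1 w)) (cnj (G2 w)))"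
  define p' where "p' = (\<lambda>z w. poly4 N p (G1 z) (G2 z) (cnj (G1 w)) (cnj (G2 w)))"
  have SS: "\<sigma> z w * q' z w = \<sigma> z b * \<sigma> b w * p' z w" if "z \<in> S" "w \<in> S" for z w
    using TT[OF that, symmetric] nz[OF that(1)] nz[OF that(2)] by (simp add: T_def q'_def p'_def)
  \<comment> \<open>The variables move from \<open>S\<close> to \<open>A\<close> one at a time, so
    continuity in each variable separately suffices.\<close>
  have AS: "\<sigma> z w * q' z w = \<sigma> z b * \<sigma> b w * p' z w" if z: "z \<in> A" and w: "w \<in> S" for z w
  proof (rule isCont_eq_of_eventually_eq[where f = "\<lambda>z. \<sigma> z w * q' z w" and g = "\<lambda>z. \<sigma> z b * \<sigma> b w * p' z w" and z = z])
    have z\<Omega>: "z \<in> \<Omega>" using z AO by blast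
    show "isCont (\<lambda>z. \<sigma> z w * q' z w) z" "isCont (\<lambda>z. \<sigma> z b * \<sigma> b w * p' z w) z"
      unfolding q'_def p'_def by (intro continuous_intros isCont_poly4 kc S\<Omega> w z\<Omega> b gc z)+
    show "eventually (\<lambda>z. \<sigma> z w * q' z w = \<sigma> z b * \<sigma> b w * p' z w) (at z)"
      using ev_S[OF z\<Omega>] by eventually_elim (rule SS[OF _ w])
  qed
  have AA: "\<sigma> z w * q' z w = \<sigma> z b * \<sigma> b w * p' z w" if z: "z \<in> A" and w: "w \<in> A" for z w
  proof (rule isCont_eq_of_eventually_eq[where f = "\<lambda>w. \<sigma> z w * q' z w" and g = "\<lambda>w. \<sigma> z b * \<sigma> b w * p' z w" and z = w])
    have \<Omega>: "z \<in> \<Omega>" "w \<in> \<Omega>" using z w AO by auto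
    \<comment> \<open>Continuity in the second variable is obtained from the first by Hermitian
      symmetry.\<close>
    have kc': "isCont (\<lambda>w. \<sigma> u w) w" if u: "u \<in> \<Omega>" for u
    proof -
      have c: "isCont (\<lambda>w. cnj (\<sigma> w u)) w" by (intro continuous_intros kc u \<Omega>)
      have ev: "eventually (\<lambda>w. cnj (\<sigma> w u) = \<sigma> u w) (nhds w)"
        using eventually_nhds_in_open[OF open_domain \<Omega>(2)] by eventually_elim (rule kernel_sym[OF u, symmetric])
      show ?thesis by (rule iffD1[OF isCont_cong[OF ev] c])
    qed
    show "isCont (\<lambda>w. \<sigma> z w * q' z w) w" "isCont (\<lambda>w. \<sigma> z b * \<sigma> b w * p' z w) w"
      unfolding q'_def p'_def by (intro continuous_intros isCont_poly4 kc' \<Omega> b gc w)+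
    show "eventually (\<lambda>w. \<sigma> z w * q' z w = \<sigma> z b * \<sigma> b w * p' z w) (at w)"
      using ev_S[OF \<Omega>(2)] by eventually_elim (rule AS[OF z])
  qed
  show ?thesis
  proof (rule exI[of _ N], rule exI[of _ p], rule exI[of _ q], intro conjI ballI impI)
    show "\<exists>z\<in>\<Omega>. \<exists>w\<in>\<Omega>. G1 analytic_on {z} \<and> G2 analytic_on {z} \<and>
        G1 analytic_on {w} \<and> G2 analytic_on {w} \<and>
        poly4 N q (G1 z) (G2 z) (cnj (G1 w)) (cnj (G2 w)) \<noteq> 0"
      using zw0 by (intro bexI[of _ z0] bexI[of _ w0]) (auto simp: S_def A_def)
  next
    fix z w assume zw: "z \<in> \<Omega>" "w \<in> \<Omega>" and *: "G1 analytic_on {z} \<and> G2 analytic_on {z} \<and>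
        G1 analytic_on {w} \<and> G2 analytic_on {w} \<and>
        poly4 N q (G1 z) (G2 z) (cnj (G1 w)) (cnj (G2 w)) \<noteq> 0"
    have "\<sigma> z w * q' z w = \<sigma> z b * \<sigma> b w * p' z w" using zw * by (intro AA) (auto simp: A_def)
    moreover have "q' z w \<noteq> 0" using * by (simp add: q'_def)
    ultimately have "\<sigma> z w = \<sigma> z b * \<sigma> b w * (p' z w / q' z w)" by (simp add: eq_divide_eq)
    then show "\<sigma> z w = \<sigma> z b * \<sigma> b w *
          (poly4 N p (G1 z) (G2 z) (cnj (G1 w)) (cnj (G2 w)) /
           poly4 N q (G1 z) (G2 z) (cnj (G1 w)) (cnj (G2 w)))" by (simp add: p'_def q'_def)
  qed
qed

end

theorem theorem9p1:
  fixes \<Omega> :: "complex set" and n :: nat and \<Gamma> :: "nat \<Rightarrow> real \<Rightarrow> complex"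
    and \<phi> :: "complex \<Rightarrow> real" and \<sigma> :: "complex \<Rightarrow> complex \<Rightarrow> complex"
    and G1 G2 :: "complex \<Rightarrow> complex"
  assumes "smooth_nconnected_domain \<Omega> n \<Gamma>"
    and "boundary_weight \<Omega> n \<Gamma> \<phi>"
    and "szego_kernel \<Omega> n \<Gamma> \<phi> \<sigma>"
    and "primitive_pair \<Omega> G1 G2"
  shows "\<forall>b\<in>\<Omega>. \<exists>N p q.
     (\<exists>z\<in>\<Omega>. \<exists>w\<in>\<Omega>. G1 analytic_on {z} \<and> G2 analytic_on {z} \<and>
        G1 analytic_on {w} \<and> G2 analytic_on {w} \<and>
        poly4 N q (G1 z) (G2 z) (cnj (G1 w)) (cnj (G2 w)) \<noteq> 0) \<and>
     (\<forall>z\<in>\<Omega>. \<forall>w\<in>\<Omega>. G1 analytic_on {z} \<and> G2 analytic_on {z} \<and>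
        G1 analytic_on {w} \<and> G2 analytic_on {w} \<and>
        poly4 N q (G1 z) (G2 z) (cnj (G1 w)) (cnj (G2 w)) \<noteq> 0 \<longrightarrow>
        \<sigma> z w = \<sigma> z b * \<sigma> b w *
          (poly4 N p (G1 z) (G2 z) (cnj (G1 w)) (cnj (G2 w)) /
           poly4 N q (G1 z) (G2 z) (cnj (G1 w)) (cnj (G2 w))))"
proof -
  obtain K where K: "\<forall>w\<in>\<Omega>. hardy_ext \<Omega> n \<Gamma> \<phi> (K w) (\<lambda>z. \<sigma> z w)"
    "\<forall>f F w. hardy_ext \<Omega> n \<Gamma> \<phi> f F \<and> w \<in> \<Omega> \<longrightarrow> F w = winner n \<Gamma> \<phi> f (K w)"
    using assms(3) unfolding szego_kernel_def by blast
  interpret weighted_szego \<Omega> n \<Gamma> \<phi> \<sigma> K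
    by unfold_locales (use assms(1,2) K in simp_all)
  show ?thesis by (rule ballI) (rule kernel_rational[OF assms(4)])
qed

end
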